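(* Let $X\subset\mathbb{G}_m^d$ be an irreducible variety of dimension $r$ over $\Bbbk$. Then $\mathscr{T}(X)=\mathscr{BG}(X)$, i.e. the tropical variety of $X$ equals the Bieri-Groves set of $X$. In particular, $\mathscr{T}(X)$ and the amoeba $\mathscr{A}(X)$ are $\Gamma$-rational polyhedral sets of pure dimension $r$.
   Context: $\Bbbk$ is a field that is complete with respect to a nontrivial non-archimedean norm $|\cdot|$; $v=-\log|\cdot|$ is the corresponding valuation. $\overline{\Bbbk}$ is a fixed algebraic closure, with the norm and $v$ extended (uniquely) to it, and $\Gamma=v(\overline{\Bbbk}^\times)\subset\mathbb{R}$. $\mathbb{G}_m^d=\operatorname{Spec}\Bbbk[x_1^{\pm1},\dots,x_d^{\pm1}]$; subvarieties are closed, $X=\operatorname{Spec}(\Bbbk[x_1^{\pm1},\dots,x_d^{\pm1}]/I)$ for an ideal $I$, and $\Bbbk[X]=\Bbbk[x_1^{\pm1},\dots,x_d^{\pm1}]/I$. Tropical variety and amoeba: define $\operatorname{val}$ and $\operatorname{Log}$ from $(\overline{\Bbbk}^\times)^d$ to $\mathbb{R}^d$ by $\operatorname{val}(a_1,\dots,a_d)=(v(a_1),\dots,v(a_d))$ and $\operatorname{Log}=-\operatorname{val}$, so $\operatorname{Log}(a_1,\dots,a_d)=(\log|a_1|,\dots,\log|a_d|)$. Then $\mathscr{T}(X)$ is the closure of $\operatorname{val}(X(\overline{\Bbbk}))$ in $\mathbb{R}^d$, and $\mathscr{A}(X)$ is the closure of $\operatorname{Log}(X(\overline{\Bbbk}))$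 in $\mathbb{R}^d$. Bieri-Groves set: a ring valuation on a commutative ring $A$ with $1$ is a map $w\colon A\to\mathbb{R}\cup\{\infty\}$ with $w(ab)=w(a)+w(b)$, $w(a+b)\ge\min\{w(a),w(b)\}$, $w(0)=\infty$ and $w(1)=0$ (nonzero elements may have value $\infty$). For $A=\Bbbk[X]$ let $\mathscr{W}(A)$ be the set of all ring valuations on $A$ extending $v$ on $\Bbbk$. Then $\mathscr{BG}(X)=\{(w(x_1),\dots,w(x_d)):w\in\mathscr{W}(A)\}\subset\mathbb{R}^d$. A convex polyhedron in $\mathbb{R}^d$ is a subset given by a finite system of inequalities $\sum_{j=1}^d b_{ij}u_j\ge c_i$, $i=1,\dots,s$; it is $\Gamma$-rational if one can choose $b_{ij}\in\mathbb{Z}$ and $c_i\in\Gamma$ (it need not have full dimension). A $\Gamma$-rational polyhedral set is a finite union of $\Gamma$-rational convex polyhedra; it is of pure dimension $r$ if all its maximal polyhedra have dimension $r$. *)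

theory Defs
  imports
    "HOL-Analysis.Analysis"
    "HOL-Library.Poly_Mapping"
    "HOL-Algebra.QuotRing"
    "HOL-Algebra.Algebraic_Closure_Type"
begin

section \<open>Non-archimedean norms\<close>

definition nonarch_norm :: "('k::field \<Rightarrow> real) \<Rightarrow> bool" where
  "nonarch_norm N \<longleftrightarrow>
     (\<forall>x. N x \<ge> 0) \<and> (\<forall>x. N x = 0 \<longleftrightarrow> x = 0) \<and>
     (\<forall>x y. N (x * y) = N x * N y) \<and> (\<forall>x y. N (x + y) \<le> max (N x) (N y))"

definition nontrivial_norm :: "('k::field \<Rightarrow> real) \<Rightarrow> bool" where
  "nontrivial_norm N \<longleftrightarrow> (\<exists>x. x \<noteq> 0 \<and> N x \<noteq> 1)"

definition complete_norm :: "('k::field \<Rightarrow> real) \<Rightarrow> bool" where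
  "complete_norm N \<longleftrightarrow> Metric_space.mcomplete UNIV (\<lambda>x y. N (x - y))"

definition norm_val :: "('k::field \<Rightarrow> real) \<Rightarrow> 'k \<Rightarrow> ereal" where
  "norm_val N a = (if a = 0 then \<infinity> else ereal (- ln (N a)))"

definition value_group :: "('k::field \<Rightarrow> real) \<Rightarrow> real set" where
  "value_group N = {- ln (N a) | a. a \<noteq> 0}"


section \<open>Laurent polynomials and subvarieties of the torus\<close>

text \<open>The Laurent polynomial ring is the monoid algebra of the exponent group:
  the product of \<^typ>\<open>'e \<Rightarrow>\<^sub>0 'k\<close> is convolution.\<close>

type_synonym ('k, 'n) laurent = "(int ^ 'n) \<Rightarrow>\<^sub>0 'k"

abbreviation laurent_ring :: "('k::field, 'n::finite) laurent ring" where
  "laurent_ring \<equiv> ring_of_type_algebra"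

definition laurent_const :: "'k::field \<Rightarrow> ('k, 'n::finite) laurent" where
  "laurent_const c = Poly_Mapping.single 0 c"

definition laurent_var :: "'n::finite \<Rightarrow> ('k::field, 'n) laurent" where
  "laurent_var i = Poly_Mapping.single (axis i 1) 1"

definition laurent_eval ::
  "('k::field, 'n::finite) laurent \<Rightarrow> 'k alg_closure ^ 'n \<Rightarrow> 'k alg_closure" where
  "laurent_eval f a =
     (\<Sum>m \<in> Poly_Mapping.keys f.
        to_ac (Poly_Mapping.lookup f m) * (\<Prod>i\<in>UNIV. (a $ i) powi (m $ i)))"

definition coord_ring ::
  "('k::field, 'n::finite) laurent set \<Rightarrow> ('k, 'n) laurent set ring" where
  "coord_ring I = laurent_ring Quot I"

definition coord_class ::
  "('k::field, 'n::finite) laurent set \<Rightarrow> ('k, 'n) laurent \<Rightarrow> ('k, 'n) laurent set" where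
  "coord_class I f = I +>\<^bsub>laurent_ring\<^esub> f"

definition geometric_points ::
  "('k::field, 'n::finite) laurent set \<Rightarrow> ('k alg_closure ^ 'n) set" where
  "geometric_points I = {a. (\<forall>i. a $ i \<noteq> 0) \<and> (\<forall>f\<in>I. laurent_eval f a = 0)}"


section \<open>Irreducibility and dimension of spectra\<close>

definition prime_spectrum :: "('a, 'm) ring_scheme \<Rightarrow> 'a set set" where
  "prime_spectrum A = {P. primeideal P A}"

definition zariski_topology :: "('a, 'm) ring_scheme \<Rightarrow> 'a set topology" where
  "zariski_topology A =
     topology_generated_by ((\<lambda>f. {P \<in> prime_spectrum A. f \<notin> P}) ` carrier A)"

definition irreducible_closedin :: "'a topology \<Rightarrow> 'a set \<Rightarrow> bool" where
  "irreducible_closedin T Z \<longleftrightarrow>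
     closedin T Z \<and> Z \<noteq> {} \<and>
     (\<forall>C D. closedin T C \<and> closedin T D \<and> Z = C \<union> D \<longrightarrow> Z = C \<or> Z = D)"

definition irreducible_chain :: "'a topology \<Rightarrow> nat \<Rightarrow> (nat \<Rightarrow> 'a set) \<Rightarrow> bool" where
  "irreducible_chain T n Z \<longleftrightarrow>
     (\<forall>i\<le>n. irreducible_closedin T (Z i)) \<and> (\<forall>i<n. Z i \<subset> Z (Suc i))"

definition has_topological_dimension :: "'a topology \<Rightarrow> nat \<Rightarrow> bool" where
  "has_topological_dimension T r \<longleftrightarrow>
     (\<exists>Z. irreducible_chain T r Z) \<and> (\<forall>n Z. irreducible_chain T n Z \<longrightarrow> n \<le> r)"

text \<open>The subscheme cut out by the ideal \<open>I\<close>; its underlying space is the spectrum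
  of \<^term>\<open>coord_ring I\<close>, so nilpotents are allowed.\<close>

definition irreducible_subvariety :: "('k::field, 'n::finite) laurent set \<Rightarrow> bool" where
  "irreducible_subvariety I \<longleftrightarrow>
     irreducible_closedin (zariski_topology (coord_ring I)) (prime_spectrum (coord_ring I))"

definition subvariety_dimension :: "('k::field, 'n::finite) laurent set \<Rightarrow> nat \<Rightarrow> bool" where
  "subvariety_dimension I r \<longleftrightarrow> has_topological_dimension (zariski_topology (coord_ring I)) r"


section \<open>Tropical variety, amoeba and Bieri-Groves set\<close>

definition val_map :: "('k::field \<Rightarrow> real) \<Rightarrow> 'k ^ 'n::finite \<Rightarrow> real ^ 'n" where
  "val_map N a = (\<chi> i. - ln (N (a $ i)))"

definition Log_map :: "('k::field \<Rightarrow> real) \<Rightarrow> 'k ^ 'n::finite \<Rightarrow> real ^ 'n" where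
  "Log_map N a = - val_map N a"

definition tropical_variety ::
  "('k::field alg_closure \<Rightarrow> real) \<Rightarrow> ('k, 'n::finite) laurent set \<Rightarrow> (real ^ 'n) set" where
  "tropical_variety N I = closure (val_map N ` geometric_points I)"

definition amoeba ::
  "('k::field alg_closure \<Rightarrow> real) \<Rightarrow> ('k, 'n::finite) laurent set \<Rightarrow> (real ^ 'n) set" where
  "amoeba N I = closure (Log_map N ` geometric_points I)"

definition ring_valuation :: "('a, 'm) ring_scheme \<Rightarrow> ('a \<Rightarrow> ereal) \<Rightarrow> bool" where
  "ring_valuation A w \<longleftrightarrow>
     (\<forall>a\<in>carrier A. w a \<noteq> -\<infinity>) \<and>
     (\<forall>a\<in>carrier A. \<forall>b\<in>carrier A. w (a \<otimes>\<^bsub>A\<^esub> b) = w a + w b) \<and>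
     (\<forall>a\<in>carrier A. \<forall>b\<in>carrier A. w (a \<oplus>\<^bsub>A\<^esub> b) \<ge> min (w a) (w b)) \<and>
     w \<zero>\<^bsub>A\<^esub> = \<infinity> \<and> w \<one>\<^bsub>A\<^esub> = 0"

definition extending_valuations ::
  "('k::field \<Rightarrow> real) \<Rightarrow> ('k, 'n::finite) laurent set \<Rightarrow>
     (('k, 'n) laurent set \<Rightarrow> ereal) set" where
  "extending_valuations N I =
     {w. ring_valuation (coord_ring I) w \<and>
         (\<forall>c. w (coord_class I (laurent_const c)) = norm_val N c)}"

text \<open>The coordinates are units, so their values are automatically finite.\<close>

definition bieri_groves_set ::
  "('k::field \<Rightarrow> real) \<Rightarrow> ('k, 'n::finite) laurent set \<Rightarrow> (real ^ 'n) set" where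
  "bieri_groves_set N I =
     {u. \<exists>w \<in> extending_valuations N I. \<forall>i. w (coord_class I (laurent_var i)) = ereal (u $ i)}"


section \<open>Rational polyhedral sets\<close>

definition rational_polyhedron :: "real set \<Rightarrow> (real ^ 'n::finite) set \<Rightarrow> bool" where
  "rational_polyhedron \<Gamma> P \<longleftrightarrow>
     (\<exists>S :: ((int ^ 'n) \<times> real) set. finite S \<and> snd ` S \<subseteq> \<Gamma> \<and>
        P = {u. \<forall>(b, c)\<in>S. (\<Sum>j\<in>UNIV. of_int (b $ j) * u $ j) \<ge> c})"

text \<open>The maximal polyhedra are the inclusion-maximal members of some presenting family.
  They are not the maximal convex subsets of the set: the union of two opposite quadrants
  of the plane has pure dimension 2, yet contains maximal convex subsets of dimension 1.\<close>

definition pure_rational_polyhedral_set ::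
  "real set \<Rightarrow> nat \<Rightarrow> (real ^ 'n::finite) set \<Rightarrow> bool" where
  "pure_rational_polyhedral_set \<Gamma> r S \<longleftrightarrow>
     (\<exists>F. finite F \<and> (\<forall>P\<in>F. rational_polyhedron \<Gamma> P) \<and> S = \<Union>F \<and>
        (\<forall>P\<in>F. (\<forall>Q\<in>F. P \<subseteq> Q \<longrightarrow> P = Q) \<longrightarrow> aff_dim P = int r))"

end

theory Submission
  imports Defs
begin

text \<open>
  An irreducible subvariety has a least prime \<open>P\<close> over its ideal \<open>I\<close>: the kernel of a ring
  valuation that extends \<open>v\<close> and the kernel of the evaluation at a geometric point are primes
  over \<open>I\<close>, so all three sets in question are unchanged when \<open>I\<close> is replaced by \<open>P\<close>.  For a prime
  \<open>P\<close> the equality and the polyhedral structure come from a circle of inclusions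
  (\<open>closure_points_eq\<close>)

  valuations of points \<open>\<subseteq>\<close> Bieri-Groves set \<open>\<subseteq>\<close> intersection of all tropical hypersurfaces
  \<open>trop f\<close> with \<open>f \<in> P\<close> \<open>\<subseteq>\<close> intersection of finitely many of them \<open>\<subseteq>\<close> closure of the valuations of
  points.

  In the first inclusion a point gives the seminorm \<open>f \<mapsto> |f(a)|\<close>, and the Bieri-Groves set is closed
  by a compactness argument (\<open>closed_seminorm_set\<close>).  The second one holds because a seminorm
  cannot vanish on a sum with a single dominant term (\<open>seminorm_set_subset_trop\<close>).  The last one
  is the heart of the matter.

  Noether normalization supplies an automorphism of the torus after which the projection to
  some of the coordinates is finite on the variety and dominant (\<open>noether_exists\<close>).  Coordinates
  are eliminated in directions that separate the exponents of an equation, so that its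
  coefficients with respect to the eliminated coordinate are monomials.  As the leading and the
  lowest coefficient are units, the projection is finite; as any two terms that balance at a
  tropical point determine the eliminated coordinate, the projection of the tropical variety
  has finite fibres of bounded size.  For one further monomial \<open>h\<close> the variety maps onto a
  hypersurface whose equation \<open>f\<close> is monic in \<open>h\<close>, because Laurent polynomial rings are normal;
  normality is checked with Gauss's lemma over power series on generic one-parameter curves
  (\<open>monic_relation\<close>), and every point of the hypersurface lifts to the variety by lying over
  (\<open>hypersurface_projection\<close>).  Kapranov's theorem for the single equation \<open>f\<close>
  (\<open>kapranov_hypersurface\<close>) then says: a point \<open>u\<close> of \<open>trop f\<close> with coordinates in \<open>\<Gamma>\<close> agrees with
  the valuation of some point of the variety in the base coordinates and in \<open>h\<close>.  All these
  valuations lie in one finite fibre.  When \<open>h\<close> runs through sufficiently many monomials in general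
  position, one of the valuations must be \<open>u\<close> itself (\<open>finite_tropical_basis\<close>).  Finally, points
  with coordinates in \<open>\<Gamma>\<close> are dense in a \<open>\<Gamma>\<close>-rational polyhedron (\<open>polyhedral_dense\<close>), which gives
  the last inclusion.

  Let \<open>s\<close> be the rank of the base torus.  A polyhedron in the tropical variety meets the fibres of
  the projection to the base in points, so it has dimension at most \<open>s\<close>.  If the polyhedra of dimension
  \<open>s\<close> missed a point \<open>u\<close>, then for a suitable \<open>h\<close> the hypersurface \<open>trop f\<close> would be contained near \<open>u\<close>
  in affine spaces of codimension two, which a tropical hypersurface never is
  (\<open>full_dimensional_cover\<close>).  So the tropical variety has pure dimension \<open>s\<close>.  The rank \<open>s\<close> is also
  the largest length of a chain of primes over \<open>P\<close>: the rank drops strictly along a chain by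
  incomparability, and a chain of length \<open>s\<close> arises by setting base monomials equal to one
  (\<open>prime_chain_bound\<close>, \<open>prime_chain_exists\<close>).  Chains of primes are chains of irreducible closed
  subsets of the spectrum, whence \<open>s = r\<close> (\<open>dimension_eq_rank\<close>).
\<close>

(* From here on coeff, monom, smult and degree refer to univariate polynomials, and X is a variable. *)
hide_const (open) up_ring.coeff up_ring.monom Module.smult Polynomials.lead_coeff Polynomials.degree
no_notation var (\<open>X\<index>\<close>)

section \<open>Integral extensions of commutative rings\<close>

definition is_ideal :: "'a::comm_ring_1 set \<Rightarrow> bool" where
  "is_ideal Q \<longleftrightarrow> 0 \<in> Q \<and> (\<forall>x\<in>Q. \<forall>y\<in>Q. x + y \<in> Q) \<and> (\<forall>a. \<forall>x\<in>Q. a * x \<in> Q)"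

definition is_prime :: "'a::comm_ring_1 set \<Rightarrow> bool" where
  "is_prime Q \<longleftrightarrow> is_ideal Q \<and> 1 \<notin> Q \<and> (\<forall>a b. a * b \<in> Q \<longrightarrow> a \<in> Q \<or> b \<in> Q)"

definition is_subring :: "'a::comm_ring_1 set \<Rightarrow> bool" where
  "is_subring B \<longleftrightarrow> 1 \<in> B \<and> (\<forall>x\<in>B. \<forall>y\<in>B. x - y \<in> B \<and> x * y \<in> B)"

definition prime_in :: "'a::comm_ring_1 set \<Rightarrow> 'a set \<Rightarrow> bool" where
  "prime_in B \<mm> \<longleftrightarrow> \<mm> \<subseteq> B \<and> 0 \<in> \<mm> \<and> 1 \<notin> \<mm> \<and> (\<forall>x\<in>\<mm>. \<forall>y\<in>\<mm>. x + y \<in> \<mm>) \<and>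
     (\<forall>b\<in>B. \<forall>x\<in>\<mm>. b * x \<in> \<mm>) \<and> (\<forall>a\<in>B. \<forall>b\<in>B. a * b \<in> \<mm> \<longrightarrow> a \<in> \<mm> \<or> b \<in> \<mm>)"

text \<open>The quotient ring by \<open>P\<close> is a finite module over the image of \<open>B\<close>, generated by \<open>E\<close>.\<close>

definition finite_mod :: "'a::comm_ring_1 set \<Rightarrow> 'a set \<Rightarrow> 'a set \<Rightarrow> bool" where
  "finite_mod B E P \<longleftrightarrow> finite E \<and>
     (\<forall>g. \<exists>c. (\<forall>x\<in>E. c x \<in> B) \<and> g - (\<Sum>x\<in>E. c x * x) \<in> P)"

lemma
  assumes "is_ideal Q"
  shows ideal_0: "0 \<in> Q" and ideal_add: "x \<in> Q \<Longrightarrow> y \<in> Q \<Longrightarrow> x + y \<in> Q"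
    and ideal_mult: "x \<in> Q \<Longrightarrow> a * x \<in> Q" and ideal_mult2: "x \<in> Q \<Longrightarrow> x * a \<in> Q"
    and ideal_uminus: "x \<in> Q \<Longrightarrow> - x \<in> Q" and ideal_diff: "x \<in> Q \<Longrightarrow> y \<in> Q \<Longrightarrow> x - y \<in> Q"
proof -
  show *: "0 \<in> Q" "x \<in> Q \<Longrightarrow> y \<in> Q \<Longrightarrow> x + y \<in> Q" "x \<in> Q \<Longrightarrow> a * x \<in> Q" for x y a
    using assms by (auto simp: is_ideal_def)
  show "x \<in> Q \<Longrightarrow> x * a \<in> Q" using *(3)[of x a] by (simp add: mult.commute)
  show **: "x \<in> Q \<Longrightarrow> - x \<in> Q" for x using *(3)[of x "-1"] by simp
  show "x \<in> Q \<Longrightarrow> y \<in> Q \<Longrightarrow> x - y \<in> Q" using *(2)[of x "-y"] **[of y] by simp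
qed

lemma ideal_sum: "is_ideal Q \<Longrightarrow> (\<And>x. x \<in> A \<Longrightarrow> f x \<in> Q) \<Longrightarrow> sum f A \<in> Q"
  by (induction A rule: infinite_finite_induct) (auto simp: ideal_0 intro: ideal_add)

lemma ideal_diff_cong: "is_ideal Q \<Longrightarrow> x - y \<in> Q \<Longrightarrow> x \<in> Q \<longleftrightarrow> y \<in> Q"
  using ideal_add[of Q "x - y" y] ideal_diff[of Q x "x - y"] by auto

lemma prime_ideal: "is_prime Q \<Longrightarrow> is_ideal Q"
  by (simp add: is_prime_def)

lemma prime_1: "is_prime Q \<Longrightarrow> 1 \<notin> Q"
  by (simp add: is_prime_def)

lemma prime_multD: "is_prime Q \<Longrightarrow> a * b \<in> Q \<Longrightarrow> a \<in> Q \<or> b \<in> Q"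
  by (simp add: is_prime_def)

lemma
  assumes "is_subring B"
  shows subring_1: "1 \<in> B" and subring_0: "0 \<in> B" and subring_mult: "x \<in> B \<Longrightarrow> y \<in> B \<Longrightarrow> x * y \<in> B"
    and subring_add: "x \<in> B \<Longrightarrow> y \<in> B \<Longrightarrow> x + y \<in> B" and subring_uminus: "x \<in> B \<Longrightarrow> - x \<in> B"
    and subring_diff: "x \<in> B \<Longrightarrow> y \<in> B \<Longrightarrow> x - y \<in> B"
proof -
  show *: "1 \<in> B" "x \<in> B \<Longrightarrow> y \<in> B \<Longrightarrow> x * y \<in> B" "x \<in> B \<Longrightarrow> y \<in> B \<Longrightarrow> x - y \<in> B" for x y
    using assms by (auto simp: is_subring_def)
  show **: "0 \<in> B" using *(3)[of 1 1] *(1) by simp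
  show ***: "x \<in> B \<Longrightarrow> - x \<in> B" for x using *(3)[of 0 x] ** by simp
  show "x \<in> B \<Longrightarrow> y \<in> B \<Longrightarrow> x + y \<in> B" using *(3)[of x "-y"] ***[of y] by simp
qed

lemma subring_sum: "is_subring B \<Longrightarrow> (\<And>x. x \<in> A \<Longrightarrow> f x \<in> B) \<Longrightarrow> sum f A \<in> B"
  by (induction A rule: infinite_finite_induct) (auto simp: subring_0 intro: subring_add)

lemma subring_power: "is_subring B \<Longrightarrow> x \<in> B \<Longrightarrow> x ^ n \<in> B"
  by (induction n) (auto simp: subring_1 intro: subring_mult)

text \<open>Gaussian elimination for a system \<open>c\<^sub>x x = \<Sum>\<^sub>y m\<^sub>x\<^sub>y y\<close> whose coefficients \<open>m\<^sub>x\<^sub>y\<close> are negligible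
  against the diagonal ones.  It replaces the determinant trick: \<open>R c m\<close> reads "\<open>m\<close> lies in a
  prime ideal that does not contain \<open>c\<close>" for Nakayama's lemma, and "\<open>c\<close> is a monic polynomial of
  larger degree than \<open>m\<close>" for the integrality of finite extensions.\<close>

lemma elimination:
  fixes R :: "'b::comm_ring_1 \<Rightarrow> 'b \<Rightarrow> bool" and h :: "'b \<Rightarrow> 'a::comm_ring_1"
  assumes h: "\<And>x y. h (x + y) = h x + h y" "\<And>x y. h (x * y) = h x * h y"
    and Q: "is_ideal Q"
    and step: "\<And>c m m1 d m' m''. R c m \<Longrightarrow> R c m1 \<Longrightarrow> R d m' \<Longrightarrow> R d m'' \<Longrightarrow>
                 R (c * (d - m')) ((d - m') * m + m1 * m'')"
    and "finite E" "x0 \<notin> E"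
    and rel: "\<And>x. x \<in> insert x0 E \<Longrightarrow> \<exists>c \<mu>. (\<forall>y\<in>insert x0 E. R c (\<mu> y)) \<and>
                 h c * x - (\<Sum>y\<in>insert x0 E. h (\<mu> y) * y) \<in> Q"
  shows "\<exists>c m. R c m \<and> h (c - m) * x0 \<in> Q"
  using \<open>finite E\<close> \<open>x0 \<notin> E\<close> rel
proof (induction E rule: finite_induct)
  have hd: "h (x - y) = h x - h y" for x y
    using h(1)[of "x - y" y] by simp
  case empty
  then obtain c \<mu> where "R c (\<mu> x0)" "h c * x0 - h (\<mu> x0) * x0 \<in> Q" by auto
  then show ?case by (auto simp: hd left_diff_distrib)
next
  have hd: "h (x - y) = h x - h y" for x y
    using h(1)[of "x - y" y] by simp
  case (insert z E)
  let ?E = "insert x0 E"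
  have fin: "finite ?E" "z \<notin> ?E" using insert by auto
  have eq: "insert x0 (insert z E) = insert z ?E" by auto
  obtain d \<nu> where d: "\<And>y. y \<in> insert z ?E \<Longrightarrow> R d (\<nu> y)"
    and dz: "h d * z - (\<Sum>y\<in>insert z ?E. h (\<nu> y) * y) \<in> Q"
    using insert.prems(2)[of z] by (auto simp: eq)
  have "x0 \<notin> E" using insert by auto
  then show ?case
  proof (rule insert.IH)
    fix x assume x: "x \<in> ?E"
    obtain c \<mu> where c: "\<And>y. y \<in> insert z ?E \<Longrightarrow> R c (\<mu> y)"
      and cx: "h c * x - (\<Sum>y\<in>insert z ?E. h (\<mu> y) * y) \<in> Q"
      using insert.prems(2)[of x] x by (auto simp: eq)
    \<comment> \<open>multiply the equation of \<open>x\<close> by \<open>d - \<nu> z\<close> and eliminate \<open>z\<close> with its own equation\<close>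
    let ?c = "c * (d - \<nu> z)" and ?\<mu> = "\<lambda>y. (d - \<nu> z) * \<mu> y + \<mu> z * \<nu> y"
    have "h ?c * x - (\<Sum>y\<in>?E. h (?\<mu> y) * y) =
        h (d - \<nu> z) * (h c * x - (\<Sum>y\<in>insert z ?E. h (\<mu> y) * y)) +
        h (\<mu> z) * (h d * z - (\<Sum>y\<in>insert z ?E. h (\<nu> y) * y))"
      unfolding sum.insert[OF fin] using h hd
      by (simp only:) (simp add: algebra_simps sum.distrib sum_subtractf sum_distrib_left)
    also have "\<dots> \<in> Q"
      using cx dz Q by (intro ideal_add ideal_mult)
    finally have "h ?c * x - (\<Sum>y\<in>?E. h (?\<mu> y) * y) \<in> Q" .
    moreover have "\<forall>y\<in>?E. R ?c (?\<mu> y)"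
      using step c d by blast
    ultimately show "\<exists>c \<mu>. (\<forall>y\<in>?E. R c (\<mu> y)) \<and> h c * x - (\<Sum>y\<in>?E. h (\<mu> y) * y) \<in> Q"
      by (intro exI[of _ ?c] exI[of _ ?\<mu>] conjI)
  qed
qed

lemma finite_mod_mono:
  "finite_mod B E P \<Longrightarrow> B \<subseteq> B' \<Longrightarrow> P \<subseteq> P' \<Longrightarrow> finite_mod B' E P'"
  unfolding finite_mod_def by blast

lemma finite_mod_insert:
  assumes "is_subring B" "finite_mod B E P"
  shows "finite_mod B (insert x E) P"
proof (cases "x \<in> E")
  case True then show ?thesis using assms by (simp add: insert_absorb)
next
  case False
  have "finite E" using assms by (simp add: finite_mod_def)
  show ?thesis unfolding finite_mod_def
  proof (intro conjI allI)
    show "finite (insert x E)" using \<open>finite E\<close> by simp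
    fix g
    obtain c where c: "\<forall>x\<in>E. c x \<in> B" "g - (\<Sum>x\<in>E. c x * x) \<in> P"
      using assms unfolding finite_mod_def by blast
    have "(\<Sum>y\<in>insert x E. (c(x := 0)) y * y) = (\<Sum>y\<in>E. (c(x := 0)) y * y)"
      using \<open>finite E\<close> by (intro sum.mono_neutral_right) auto
    also have "\<dots> = (\<Sum>x\<in>E. c x * x)" using False by (intro sum.cong) auto
    finally show "\<exists>c. (\<forall>x\<in>insert x E. c x \<in> B) \<and> g - (\<Sum>x\<in>insert x E. c x * x) \<in> P"
      using c subring_0[OF assms(1)] by (intro exI[of _ "c(x := 0)"]) auto
  qed
qed

text \<open>Lying over: Nakayama's lemma shows that \<open>P\<close> and \<open>\<mm>\<close> generate an ideal that meets \<open>B\<close> inside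
  \<open>\<mm>\<close>; an ideal that is maximal with this property is prime.\<close>

lemma lying_over:
  assumes B: "is_subring B" and P: "is_ideal P" and fin: "finite_mod B E P"
    and m: "prime_in B \<mm>" and PB: "P \<inter> B \<subseteq> \<mm>"
  obtains Q where "is_prime Q" "P \<subseteq> Q" "Q \<inter> B = \<mm>"
proof -
  define F where "F = insert 1 E"
  have finF: "finite_mod B F P" unfolding F_def by (rule finite_mod_insert[OF B fin])
  then have "finite F" by (simp add: finite_mod_def)
  have mB: "x \<in> \<mm> \<Longrightarrow> x \<in> B" and m0: "0 \<in> \<mm>" and m1: "1 \<notin> \<mm>"
    and madd: "x \<in> \<mm> \<Longrightarrow> y \<in> \<mm> \<Longrightarrow> x + y \<in> \<mm>" and mmul: "b \<in> B \<Longrightarrow> x \<in> \<mm> \<Longrightarrow> b * x \<in> \<mm>"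
    and mpr: "a \<in> B \<Longrightarrow> b \<in> B \<Longrightarrow> a * b \<in> \<mm> \<Longrightarrow> a \<in> \<mm> \<or> b \<in> \<mm>" for x y a b
    using m unfolding prime_in_def by blast+
  have msum: "(\<And>x. x \<in> A \<Longrightarrow> f x \<in> \<mm>) \<Longrightarrow> sum f A \<in> \<mm>" for f and A :: "'a set"
    by (induction A rule: infinite_finite_induct) (auto simp: m0 madd)
  \<comment> \<open>the ideal generated by \<open>P\<close> and \<open>\<mm>\<close>\<close>
  define J where "J = {g. \<exists>c. (\<forall>x\<in>F. c x \<in> \<mm>) \<and> g - (\<Sum>x\<in>F. c x * x) \<in> P}"
  have Jadd: "g + g' \<in> J" if "g \<in> J" "g' \<in> J" for g g'
  proof -
    obtain c c' where c: "\<forall>x\<in>F. c x \<in> \<mm>" "g - (\<Sum>x\<in>F. c x * x) \<in> P"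
      and c': "\<forall>x\<in>F. c' x \<in> \<mm>" "g' - (\<Sum>x\<in>F. c' x * x) \<in> P" using \<open>g \<in> J\<close> \<open>g' \<in> J\<close>
      unfolding J_def by blast
    have "g + g' - (\<Sum>x\<in>F. (c x + c' x) * x) = g - (\<Sum>x\<in>F. c x * x) + (g' - (\<Sum>x\<in>F. c' x * x))"
      by (simp add: algebra_simps sum.distrib)
    also have "\<dots> \<in> P" using c c' by (intro ideal_add[OF P])
    finally show "g + g' \<in> J" unfolding J_def using c c' madd
      by (intro CollectI exI[of _ "\<lambda>x. c x + c' x"]) auto
  qed
  have JP: "P \<subseteq> J" unfolding J_def using m0 by (auto intro!: exI[of _ "\<lambda>_. 0"])
  have Jm: "c * a \<in> J" if "c \<in> \<mm>" for c a
  proof -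
    obtain d where d: "\<forall>x\<in>F. d x \<in> B" "a - (\<Sum>x\<in>F. d x * x) \<in> P"
      using finF unfolding finite_mod_def by blast
    have "c * a - (\<Sum>x\<in>F. (d x * c) * x) = c * (a - (\<Sum>x\<in>F. d x * x))"
      by (simp add: algebra_simps sum_distrib_left)
    then show ?thesis unfolding J_def using d that mmul ideal_mult[OF P]
      by (intro CollectI exI[of _ "\<lambda>x. d x * c"]) auto
  qed
  have Jsum: "(\<And>x. x \<in> A \<Longrightarrow> f x \<in> J) \<Longrightarrow> sum f A \<in> J" for f and A :: "'a set"
    using JP ideal_0[OF P]
    by (induction A rule: infinite_finite_induct) (auto intro: Jadd)
  have Jid: "is_ideal J" unfolding is_ideal_def
  proof (intro conjI ballI allI)
    show "0 \<in> J" using JP ideal_0[OF P] by auto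
    fix a g assume "g \<in> J"
    then obtain c where c: "\<forall>x\<in>F. c x \<in> \<mm>" "g - (\<Sum>x\<in>F. c x * x) \<in> P" unfolding J_def by blast
    have "a * g = a * (g - (\<Sum>x\<in>F. c x * x)) + (\<Sum>x\<in>F. c x * (a * x))"
      by (simp add: algebra_simps sum_distrib_left)
    also have "\<dots> \<in> J"
    proof (intro Jadd Jsum)
      show "a * (g - (\<Sum>x\<in>F. c x * x)) \<in> J" using c JP ideal_mult[OF P] by blast
    qed (use c Jm in blast)
    finally show "a * g \<in> J" .
  qed (auto intro: Jadd)
  have JB: "J \<inter> B \<subseteq> \<mm>"
  proof
    fix c assume c: "c \<in> J \<inter> B"
    show "c \<in> \<mm>"
    proof (rule ccontr)
      assume "c \<notin> \<mm>"
      \<comment> \<open>\<open>c\<close> maps each generator into the combinations with coefficients in \<open>\<mm>\<close>; since \<open>1\<close> is one of the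
        generators, elimination leaves an element of \<open>P\<close> outside \<open>\<mm>\<close>\<close>
      let ?R = "\<lambda>c m. c \<in> B \<and> c \<notin> \<mm> \<and> m \<in> \<mm>"
      have insF: "insert 1 (F - {1}) = F" by (auto simp: F_def)
      have "\<exists>c m. ?R c m \<and> (\<lambda>x. x) (c - m) * 1 \<in> P"
      proof (rule elimination[where h = "\<lambda>x. x" and R = ?R and E = "F - {1}"])
        fix c m m1 d m' m'' assume *: "?R c m" "?R c m1" "?R d m'" "?R d m''"
        have "d - m' \<in> B" using * mB B by (auto intro: subring_diff)
        moreover have "d - m' \<notin> \<mm>" using madd[of "d - m'" m'] * by auto
        ultimately show "?R (c * (d - m')) ((d - m') * m + m1 * m'')"
          using * mpr mB B by (auto intro!: subring_mult madd mmul)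
      next
        fix x assume "x \<in> insert 1 (F - {1})"
        have "c * x \<in> J" using c ideal_mult2[OF Jid] by auto
        then obtain d where "\<forall>y\<in>F. d y \<in> \<mm>" "c * x - (\<Sum>y\<in>F. d y * y) \<in> P" unfolding J_def by blast
        then show "\<exists>c \<mu>. (\<forall>y\<in>insert 1 (F - {1}). ?R c (\<mu> y)) \<and>
            (\<lambda>x. x) c * x - (\<Sum>y\<in>insert 1 (F - {1}). (\<lambda>x. x) (\<mu> y) * y) \<in> P"
          unfolding insF using c \<open>c \<notin> \<mm>\<close> by blast
      qed (use P \<open>finite F\<close> in auto)
      then obtain d m where d: "d \<in> B" "d \<notin> \<mm>" "m \<in> \<mm>" "d - m \<in> P" by auto
      then have "d - m \<in> \<mm>" using PB mB B by (auto intro: subring_diff)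
      then show False using madd[of "d - m" m] d by auto
    qed
  qed
  define C where "C = {K. is_ideal K \<and> J \<subseteq> K \<and> K \<inter> B \<subseteq> \<mm>}"
  have "\<exists>M\<in>C. \<forall>X\<in>C. M \<subseteq> X \<longrightarrow> X = M"
  proof (rule subset_Zorn_nonempty)
    show "C \<noteq> {}" using Jid JB by (auto simp: C_def)
    fix \<C> assume ne: "\<C> \<noteq> {}" and "subset.chain C \<C>"
    then have sub: "\<C> \<subseteq> C" and ch: "\<And>X Y. X \<in> \<C> \<Longrightarrow> Y \<in> \<C> \<Longrightarrow> X \<subseteq> Y \<or> Y \<subseteq> X"
      by (auto simp: subset.chain_def)
    have "is_ideal (\<Union>\<C>)" unfolding is_ideal_def
    proof (intro conjI ballI allI)
      show "0 \<in> \<Union>\<C>" using ne sub by (auto simp: C_def is_ideal_def)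
    next
      fix x y assume "x \<in> \<Union>\<C>" "y \<in> \<Union>\<C>"
      then obtain X Y where "X \<in> \<C>" "Y \<in> \<C>" "x \<in> X" "y \<in> Y" by auto
      then obtain Z where "Z \<in> \<C>" "x \<in> Z" "y \<in> Z" using ch[of X Y] by auto
      then show "x + y \<in> \<Union>\<C>" using sub by (auto simp: C_def intro: ideal_add)
    next
      fix a x assume "x \<in> \<Union>\<C>"
      then show "a * x \<in> \<Union>\<C>" using sub by (auto simp: C_def intro: ideal_mult)
    qed
    then show "\<Union>\<C> \<in> C" using ne sub unfolding C_def by blast
  qed
  then obtain K where K: "is_ideal K" "J \<subseteq> K" "K \<inter> B \<subseteq> \<mm>"
    and Kmax: "\<And>X. is_ideal X \<Longrightarrow> X \<inter> B \<subseteq> \<mm> \<Longrightarrow> K \<subseteq> X \<Longrightarrow> X = K"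
    unfolding C_def by auto
  \<comment> \<open>by maximality \<open>K\<close> and any further element generate an ideal that meets \<open>B\<close> outside \<open>\<mm>\<close>\<close>
  have ext: "\<exists>k r. k \<in> K \<and> k + r * a \<in> B \<and> k + r * a \<notin> \<mm>" if "a \<notin> K" for a
  proof (rule ccontr)
    assume neg: "\<not> ?thesis"
    define X where "X = {k + r * a |k r. k \<in> K}"
    have "is_ideal X" unfolding is_ideal_def
    proof (intro conjI ballI allI)
      show "0 \<in> X" using ideal_0[OF K(1)] by (auto simp: X_def intro!: exI[of _ 0])
    next
      fix x y assume "x \<in> X" "y \<in> X"
      then obtain k r k' r' where "x = k + r * a" "y = k' + r' * a" "k \<in> K" "k' \<in> K" by (auto simp: X_def)
      then have "x + y = (k + k') + (r + r') * a" "k + k' \<in> K" using K(1) by (auto simp: algebra_simps ideal_add)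
      then show "x + y \<in> X" unfolding X_def by blast
    next
      fix b x assume "x \<in> X"
      then obtain k r where "x = k + r * a" "k \<in> K" by (auto simp: X_def)
      then have "b * x = b * k + (b * r) * a" "b * k \<in> K" using K(1) by (auto simp: algebra_simps ideal_mult)
      then show "b * x \<in> X" unfolding X_def by blast
    qed
    moreover have "X \<inter> B \<subseteq> \<mm>" using neg by (auto simp: X_def)
    moreover have "K \<subseteq> X" unfolding X_def by (force intro: exI[of _ "0"])
    ultimately have "X = K" using Kmax by blast
    moreover have "a \<in> X" unfolding X_def using ideal_0[OF K(1)] by (intro CollectI exI[of _ 0] exI[of _ 1]) auto
    ultimately show False using that by auto
  qed
  have "is_prime K" unfolding is_prime_def
  proof (intro conjI allI impI K(1))
    show "1 \<notin> K" using K m1 subring_1[OF B] by auto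
    fix a b assume ab: "a * b \<in> K"
    show "a \<in> K \<or> b \<in> K"
    proof (rule ccontr)
      assume "\<not> ?thesis"
      then obtain k r k' r' where *: "k \<in> K" "k + r * a \<in> B" "k + r * a \<notin> \<mm>"
        "k' \<in> K" "k' + r' * b \<in> B" "k' + r' * b \<notin> \<mm>" using ext by blast
      have "(k + r * a) * (k' + r' * b) = (k' + r' * b) * k + (r * a) * k' + (r * r') * (a * b)"
        by (simp add: algebra_simps)
      also have "\<dots> \<in> K" using * ab by (simp add: ideal_add[OF K(1)] ideal_mult[OF K(1)])
      finally have "(k + r * a) * (k' + r' * b) \<in> \<mm>" using * K(3) subring_mult[OF B] by blast
      then show False using mpr * by blast
    qed
  qed
  moreover have "P \<subseteq> K" using JP K by blast
  moreover have "K \<inter> B = \<mm>" using K Jm[of _ 1] mB by fastforce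
  ultimately show thesis using that by blast
qed

lemma poly_in_subring:
  assumes "is_subring B" "\<And>i. coeff F i \<in> B" "z \<in> B"
  shows "poly F z \<in> B"
  unfolding poly_altdef using assms by (intro subring_sum subring_mult subring_power) auto

lemma coeff_mult_subring:
  assumes "is_subring B" "\<And>i. coeff F i \<in> B" "\<And>i. coeff G i \<in> B"
  shows "coeff (F * G) i \<in> B"
  unfolding coeff_mult using assms by (intro subring_sum subring_mult) auto

lemma monic_diff_lower:
  fixes c m :: "'a::comm_ring_1 poly"
  assumes "lead_coeff c = 1" "m = 0 \<or> degree m < degree c"
  shows "degree (c - m) = degree c" "lead_coeff (c - m) = 1"
proof -
  have "coeff (c - m) (degree c) = 1" using assms by (auto simp: coeff_eq_0)
  moreover have "degree (c - m) \<le> degree c"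
    using assms by (auto intro!: degree_diff_le)
  ultimately show "degree (c - m) = degree c"
    by (metis le_antisym le_degree zero_neq_one)
  then show "lead_coeff (c - m) = 1" using \<open>coeff (c - m) (degree c) = 1\<close> by simp
qed

lemma degree_mult_monic:
  fixes c d :: "'a::comm_ring_1 poly"
  assumes "lead_coeff c = 1" "lead_coeff d = 1"
  shows "degree (c * d) = degree c + degree d" "lead_coeff (c * d) = 1"
proof -
  have "coeff (c * d) (degree c + degree d) = 1" using assms by (simp add: coeff_mult_degree_sum)
  then show "degree (c * d) = degree c + degree d"
    by (metis degree_mult_le le_antisym le_degree zero_neq_one)
  then show "lead_coeff (c * d) = 1" using \<open>coeff (c * d) _ = 1\<close> by simp
qed

text \<open>The product of \<open>z\<close> with each generator is a \<open>B\<close>-combination of the generators.  Eliminating from these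
  equations, in which \<open>z\<close> is the diagonal coefficient, all generators but \<open>1\<close> leaves a polynomial in
  \<open>z\<close> that is monic because the diagonal dominates in degree.\<close>

lemma finite_mod_integral:
  assumes B: "is_subring B" and P: "is_ideal P" and fin: "finite_mod B E P"
  obtains F where "lead_coeff F = 1" "\<And>i. coeff F i \<in> B" "poly F z \<in> P"
proof -
  define E' where "E' = insert 1 E"
  have finE: "finite_mod B E' P" unfolding E'_def by (rule finite_mod_insert[OF B fin])
  then have "finite E'" by (simp add: finite_mod_def)
  have insE: "insert 1 (E' - {1}) = E'" by (auto simp: E'_def)
  let ?R = "\<lambda>c m :: 'a poly. (\<forall>i. coeff c i \<in> B) \<and> (\<forall>i. coeff m i \<in> B) \<and>
      lead_coeff c = 1 \<and> (m = 0 \<or> degree m < degree c)"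
  have "\<exists>c m. ?R c m \<and> poly (c - m) z * 1 \<in> P"
  proof (rule elimination[where h = "\<lambda>p. poly p z" and R = ?R and E = "E' - {1}"])
    fix c m m1 d m' m'' assume *: "?R c m" "?R c m1" "?R d m'" "?R d m''"
    have d: "degree (d - m') = degree d" "lead_coeff (d - m') = 1"
      using monic_diff_lower[of d m'] * by auto
    have dB: "\<forall>i. coeff (d - m') i \<in> B" using * subring_diff[OF B] by auto
    have c: "degree (c * (d - m')) = degree c + degree d" "lead_coeff (c * (d - m')) = 1"
      using degree_mult_monic[of c "d - m'"] d * by auto
    have 1: "(d - m') * m = 0 \<or> degree ((d - m') * m) < degree c + degree d"
      using degree_mult_le[of "d - m'" m] d * by auto
    have 2: "m1 * m'' = 0 \<or> degree (m1 * m'') < degree c + degree d"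
      using degree_mult_le[of m1 m''] * by auto
    have 3: "(d - m') * m + m1 * m'' = 0 \<or> degree ((d - m') * m + m1 * m'') < degree c + degree d"
      using 1 2 degree_add_less[of "(d - m') * m" "degree c + degree d" "m1 * m''"] by auto
    have "coeff (c * (d - m')) i \<in> B" "coeff ((d - m') * m) i \<in> B" "coeff (m1 * m'') i \<in> B" for i
      by (rule coeff_mult_subring[OF B]; use * dB in blast)+
    then show "?R (c * (d - m')) ((d - m') * m + m1 * m'')"
      unfolding c(1) coeff_add using 3 c(2) subring_add[OF B] c(1) by simp
  next
    fix x assume "x \<in> insert 1 (E' - {1})"
    obtain d where d: "\<forall>y\<in>E'. d y \<in> B" "z * x - (\<Sum>y\<in>E'. d y * y) \<in> P"
      using finE unfolding finite_mod_def by blast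
    have "\<forall>y\<in>E'. ?R [:0, 1:] [:d y:]"
      using d subring_0[OF B] subring_1[OF B] by (auto simp: coeff_pCons split: nat.splits)
    moreover have "poly [:0, 1:] z * x - (\<Sum>y\<in>E'. poly [:d y:] z * y) \<in> P" using d by simp
    ultimately show "\<exists>c \<mu>. (\<forall>y\<in>insert 1 (E' - {1}). ?R c (\<mu> y)) \<and>
        poly c z * x - (\<Sum>y\<in>insert 1 (E' - {1}). poly (\<mu> y) z * y) \<in> P"
      unfolding insE by (intro exI[of _ "[:0, 1:]"] exI[of _ "\<lambda>y. [:d y:]"]) blast
  qed (use P \<open>finite E'\<close> in auto)
  then obtain c m where cm: "?R c m" "poly (c - m) z \<in> P" by auto
  show thesis
    using that[of "c - m"] cm monic_diff_lower[of c m] subring_diff[OF B] by auto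
qed

text \<open>Incomparability: for an element of \<open>P' - P\<close> take the constant term of an integral equation of
  least degree modulo \<open>P\<close>.  It lies in \<open>P'\<close>, and if it were in \<open>P\<close> the equation could be shortened.\<close>

lemma incomparability:
  assumes B: "is_subring B" and P: "is_prime P" and fin: "finite_mod B E P"
    and P': "is_ideal P'" and "P \<subseteq> P'" "g \<in> P'" "g \<notin> P"
  obtains b where "b \<in> B" "b \<in> P'" "b \<notin> P"
proof -
  let ?S = "\<lambda>n. \<exists>F. lead_coeff F = 1 \<and> (\<forall>i. coeff F i \<in> B) \<and> poly F g \<in> P \<and> degree F = n"
  have "\<exists>n. ?S n" using finite_mod_integral[OF B prime_ideal[OF P] fin, of g] by metis
  then obtain n where n: "?S n" and min: "\<And>k. k < n \<Longrightarrow> \<not> ?S k"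
    using exists_least_iff[of ?S] by blast
  then obtain F where F: "lead_coeff F = 1" "\<And>i. coeff F i \<in> B" "poly F g \<in> P" "degree F = n" by blast
  obtain a F' where aF: "F = pCons a F'" by (cases F)
  have "n \<noteq> 0"
  proof
    assume "n = 0"
    then have "poly F g = 1" using F by (auto elim!: degree_eq_zeroE)
    then show False using F prime_1[OF P] by auto
  qed
  then have "F' \<noteq> 0" "n = Suc (degree F')" using F aF by auto
  then have F': "lead_coeff F' = 1" "degree F' < n" using F aF by auto
  have F'B: "coeff F' i \<in> B" for i using F(2)[of "Suc i"] aF by simp
  have aB: "a \<in> B" using F(2)[of 0] aF by simp
  have eq: "a + g * poly F' g \<in> P" using F aF by simp
  have "a \<in> P'" using eq \<open>P \<subseteq> P'\<close> ideal_diff[OF P', of "a + g * poly F' g" "g * poly F' g"]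
      ideal_mult2[OF P' \<open>g \<in> P'\<close>] by auto
  moreover have "a \<notin> P"
  proof
    assume "a \<in> P"
    then have "g * poly F' g \<in> P" using ideal_diff[OF prime_ideal[OF P] eq] by force
    then have "poly F' g \<in> P" using prime_multD[OF P] assms by blast
    then show False using min[OF F'(2)] F' F'B by blast
  qed
  ultimately show thesis using that aB by blast
qed

section \<open>Laurent polynomials\<close>

definition idot :: "int ^ 'n::finite \<Rightarrow> int ^ 'n \<Rightarrow> int" where
  "idot x y = (\<Sum>i\<in>UNIV. x $ i * y $ i)"

lemma idot_add_right: "idot e (x + y) = idot e x + idot e y"
  by (simp add: idot_def algebra_simps sum.distrib)

lemma idot_diff_right: "idot e (x - y) = idot e x - idot e y"
  by (simp add: idot_def algebra_simps sum_subtractf)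

lemma idot_uminus_right: "idot e (- y) = - idot e y"
  by (simp add: idot_def sum_negf)

lemma idot_zero_right [simp]: "idot e 0 = 0"
  by (simp add: idot_def)

lemma idot_commute: "idot x y = idot y x"
  by (simp add: idot_def mult.commute)

lemma idot_scale_right: "idot e (k *s x) = k * idot e x"
  by (simp add: idot_def algebra_simps sum_distrib_left)

lemma idot_sum_right: "idot e (sum f A) = (\<Sum>x\<in>A. idot e (f x))"
  by (induction A rule: infinite_finite_induct) (simp_all add: idot_add_right)

lemma idot_axis: "idot (axis i 1) m = m $ i"
proof -
  have "idot (axis i 1) m = (\<Sum>j\<in>UNIV. if j = i then m $ j else 0)"
    unfolding idot_def by (intro sum.cong) (auto simp: axis_def)
  then show ?thesis by simp
qed

lemmas idot_linear_right = idot_add_right idot_diff_right idot_uminus_right idot_scale_right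

definition lmon :: "int ^ 'n::finite \<Rightarrow> ('k::field, 'n) laurent" where
  "lmon m = Poly_Mapping.single m 1"

lemma lmon_add: "lmon (m + m') = lmon m * lmon m'"
  by (simp add: lmon_def mult_single)

lemma lmon_0 [simp]: "lmon 0 = 1"
  by (simp add: lmon_def)

lemma lmon_inverse: "lmon (- m) * lmon m = 1" "lmon m * lmon (- m) = 1"
  by (simp_all flip: lmon_add)

lemma lmon_power: "lmon m ^ n = lmon (int n *s m)"
proof (induction n)
  case (Suc n)
  have "int (Suc n) *s m = m + int n *s m" by (simp add: vec_eq_iff algebra_simps)
  then show ?case using Suc by (simp add: lmon_add)
next
  case 0
  have "int 0 *s m = 0" by (simp add: vec_eq_iff)
  then show ?case by simp
qed

lemma laurent_expand:
  "finite A \<Longrightarrow> Poly_Mapping.keys f \<subseteq> A \<Longrightarrow> f = (\<Sum>m\<in>A. Poly_Mapping.single m (Poly_Mapping.lookup f m))"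
  by (rule poly_mapping_eqI)
     (auto simp: lookup_sum lookup_single when_def in_keys_iff)

text \<open>The homomorphism out of the Laurent polynomial ring given by a map on the coefficients
  and a multiplicative map on the monomials.\<close>

definition lift :: "('k::field \<Rightarrow> 'r::comm_ring_1) \<Rightarrow> (int ^ 'n::finite \<Rightarrow> 'r) \<Rightarrow> ('k, 'n) laurent \<Rightarrow> 'r" where
  "lift c \<psi> f = (\<Sum>m\<in>Poly_Mapping.keys f. c (Poly_Mapping.lookup f m) * \<psi> m)"

definition lift_data :: "('k::field \<Rightarrow> 'r::comm_ring_1) \<Rightarrow> (int ^ 'n::finite \<Rightarrow> 'r) \<Rightarrow> bool" where
  "lift_data c \<psi> \<longleftrightarrow> c 0 = 0 \<and> c 1 = 1 \<and> (\<forall>x y. c (x + y) = c x + c y) \<and> (\<forall>x y. c (x * y) = c x * c y) \<and>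
     \<psi> 0 = 1 \<and> (\<forall>m m'. \<psi> (m + m') = \<psi> m * \<psi> m')"

lemma lift_superset:
  assumes "c 0 = 0" "finite A" "Poly_Mapping.keys f \<subseteq> A"
  shows "lift c \<psi> f = (\<Sum>m\<in>A. c (Poly_Mapping.lookup f m) * \<psi> m)"
  unfolding lift_def using assms by (intro sum.mono_neutral_left) (auto simp: in_keys_iff)

lemma
  assumes L: "lift_data c \<psi>"
  shows lift_0: "lift c \<psi> 0 = 0" and lift_single: "lift c \<psi> (Poly_Mapping.single m x) = c x * \<psi> m"
    and lift_1: "lift c \<psi> 1 = 1"
    and lift_add: "lift c \<psi> (f + g) = lift c \<psi> f + lift c \<psi> g"
    and lift_uminus: "lift c \<psi> (- f) = - lift c \<psi> f"
    and lift_diff: "lift c \<psi> (f - g) = lift c \<psi> f - lift c \<psi> g"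
    and lift_lmon: "lift c \<psi> (lmon m) = \<psi> m"
proof -
  have c: "c 0 = 0" "c 1 = 1" "c (x + y) = c x + c y" "\<psi> 0 = 1" for x y
    using L by (auto simp: lift_data_def)
  show l0: "lift c \<psi> 0 = 0" by (simp add: lift_def)
  show single: "lift c \<psi> (Poly_Mapping.single m x) = c x * \<psi> m" for m x
    using lift_superset[of c "{m}" "Poly_Mapping.single m x" \<psi>] c by simp
  show add: "lift c \<psi> (f + g) = lift c \<psi> f + lift c \<psi> g" for f g
  proof -
    let ?A = "Poly_Mapping.keys f \<union> Poly_Mapping.keys g"
    have "Poly_Mapping.keys (f + g) \<subseteq> ?A" by (rule Poly_Mapping.keys_add)
    then show ?thesis
      using lift_superset[of c ?A "f + g" \<psi>] lift_superset[of c ?A f \<psi>] lift_superset[of c ?A g \<psi>] c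
      by (simp add: lookup_add sum.distrib algebra_simps)
  qed
  show "lift c \<psi> 1 = 1" using single[of 0 1] c by simp
  show neg: "lift c \<psi> (- f) = - lift c \<psi> f" for f
    using add[of f "- f"] l0 by (simp add: eq_neg_iff_add_eq_0 add.commute)
  show "lift c \<psi> (f - g) = lift c \<psi> f - lift c \<psi> g"
    using add[of f "- g"] neg[of g] by simp
  show "lift c \<psi> (lmon m) = \<psi> m" by (simp add: lmon_def single c)
qed

lemma lift_sum: "lift_data c \<psi> \<Longrightarrow> lift c \<psi> (sum F A) = (\<Sum>x\<in>A. lift c \<psi> (F x))"
  by (induction A rule: infinite_finite_induct) (simp_all add: lift_0 lift_add)

lemma lift_mult:
  assumes L: "lift_data c \<psi>"
  shows "lift c \<psi> (f * g) = lift c \<psi> f * lift c \<psi> g"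
proof -
  have c: "c (x * y) = c x * c y" "\<psi> (n + m') = \<psi> n * \<psi> m'" for x y n m'
    using L by (auto simp: lift_data_def)
  let ?F = "Poly_Mapping.keys f" and ?G = "Poly_Mapping.keys g"
  have "f * g = (\<Sum>m\<in>?F. Poly_Mapping.single m (Poly_Mapping.lookup f m)) *
      (\<Sum>m\<in>?G. Poly_Mapping.single m (Poly_Mapping.lookup g m))"
    using laurent_expand[of ?F f] laurent_expand[of ?G g] by simp
  also have "\<dots> = (\<Sum>m\<in>?F. \<Sum>m'\<in>?G. Poly_Mapping.single (m + m')
      (Poly_Mapping.lookup f m * Poly_Mapping.lookup g m'))"
    by (simp add: sum_product mult_single)
  also have "lift c \<psi> \<dots> = (\<Sum>m\<in>?F. \<Sum>m'\<in>?G.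
      (c (Poly_Mapping.lookup f m) * \<psi> m) * (c (Poly_Mapping.lookup g m') * \<psi> m'))"
    unfolding lift_sum[OF L] lift_single[OF L] by (simp add: c mult_ac)
  also have "\<dots> = lift c \<psi> f * lift c \<psi> g"
    by (simp add: lift_def sum_product)
  finally show ?thesis .
qed

subsection \<open>Points of the torus\<close>

definition torus :: "('c::field ^ 'n::finite) set" where
  "torus = {a. \<forall>i. a $ i \<noteq> 0}"

definition tmon :: "'c::field ^ 'n::finite \<Rightarrow> int ^ 'n \<Rightarrow> 'c" where
  "tmon a m = (\<Prod>i\<in>UNIV. (a $ i) powi (m $ i))"

text \<open>The point \<open>a\<close> moved by the one-parameter subgroup with direction \<open>e\<close>.\<close>

definition translate :: "'c::field ^ 'n::finite \<Rightarrow> int ^ 'n \<Rightarrow> 'c \<Rightarrow> 'c ^ 'n" where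
  "translate a e t = (\<chi> i. a $ i * t powi (e $ i))"

lemma tmon_0 [simp]: "tmon a 0 = 1"
  by (simp add: tmon_def)

lemma tmon_add: "a \<in> torus \<Longrightarrow> tmon a (m + m') = tmon a m * tmon a m'"
  by (simp add: tmon_def torus_def power_int_add prod.distrib)

lemma tmon_nonzero: "a \<in> torus \<Longrightarrow> tmon a m \<noteq> 0"
  by (simp add: tmon_def torus_def power_int_eq_0_iff)

lemma translate_torus: "a \<in> torus \<Longrightarrow> t \<noteq> 0 \<Longrightarrow> translate a e t \<in> torus"
  by (simp add: torus_def translate_def power_int_eq_0_iff)

lemma powi_sum: "t \<noteq> 0 \<Longrightarrow> (t::'c::field) powi (sum f A) = (\<Prod>x\<in>A. t powi f x)"
  by (induction A rule: infinite_finite_induct) (simp_all add: power_int_add)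

lemma tmon_translate:
  assumes "t \<noteq> 0"
  shows "tmon (translate a e t) m = tmon a m * t powi (idot e m)"
  using assms by (simp add: tmon_def translate_def power_int_mult_distrib prod.distrib idot_def powi_sum
      flip: power_int_mult)

lemma lift_data_eval: "a \<in> torus \<Longrightarrow> lift_data to_ac (tmon a)"
  by (simp add: lift_data_def tmon_add)

lemma laurent_eval_lift: "laurent_eval f a = lift to_ac (tmon a) f"
  by (simp add: laurent_eval_def lift_def tmon_def)

subsection \<open>Sublattices given by dual bases\<close>

text \<open>Subtori and quotient tori are described by bases \<open>b\<close> of the exponent lattice with dual basis \<open>e\<close>.
  The sublattice \<open>lat e S\<close> is spanned by the \<open>b j\<close> with \<open>j \<in> S\<close>, and \<open>supp_in (lat e S)\<close> is the coordinate
  ring of the torus with these monomials as coordinates.\<close>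

definition supp_in :: "(int ^ 'n::finite) set \<Rightarrow> ('k::field, 'n) laurent set" where
  "supp_in G = {f. Poly_Mapping.keys f \<subseteq> G}"

definition lat :: "('n::finite \<Rightarrow> int ^ 'n) \<Rightarrow> 'n set \<Rightarrow> (int ^ 'n) set" where
  "lat e S = {m. \<forall>j. j \<notin> S \<longrightarrow> idot (e j) m = 0}"

definition dual :: "('n::finite \<Rightarrow> int ^ 'n) \<Rightarrow> ('n \<Rightarrow> int ^ 'n) \<Rightarrow> bool" where
  "dual b e \<longleftrightarrow> (\<forall>i j. idot (e i) (b j) = (if i = j then 1 else 0)) \<and>
     (\<forall>m. m = (\<Sum>j\<in>UNIV. idot (e j) m *s b j))"

definition lattice :: "(int ^ 'n::finite) set \<Rightarrow> bool" where
  "lattice G \<longleftrightarrow> 0 \<in> G \<and> (\<forall>x\<in>G. \<forall>y\<in>G. x + y \<in> G \<and> x - y \<in> G)"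

lemma lattice_lat [simp]: "lattice (lat e S)"
  by (simp add: lattice_def lat_def idot_linear_right)

lemma lat_mono: "S \<subseteq> T \<Longrightarrow> lat e S \<subseteq> lat e T"
  by (auto simp: lat_def)

lemma lat_UNIV [simp]: "lat e UNIV = UNIV"
  by (simp add: lat_def)

lemma supp_in_mono: "G \<subseteq> G' \<Longrightarrow> supp_in G \<subseteq> supp_in G'"
  by (auto simp: supp_in_def)

lemma supp_in_UNIV [simp]: "supp_in UNIV = UNIV"
  by (simp add: supp_in_def)

lemma subring_supp_in:
  assumes "lattice G"
  shows "is_subring (supp_in G)"
  unfolding is_subring_def
proof (intro conjI ballI)
  show "1 \<in> supp_in G" using assms by (simp add: supp_in_def lattice_def)
  fix f g :: "('k::field, 'a) laurent" assume *: "f \<in> supp_in G" "g \<in> supp_in G"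
  show "f - g \<in> supp_in G" using * keys_diff[of f g] by (auto simp: supp_in_def)
  have "Poly_Mapping.keys (f * g) \<subseteq> {x + y |x y. x \<in> Poly_Mapping.keys f \<and> y \<in> Poly_Mapping.keys g}"
    using keys_mult[of f g] by auto
  also have "\<dots> \<subseteq> G" using * assms by (auto simp: supp_in_def lattice_def)
  finally show "f * g \<in> supp_in G" by (simp add: supp_in_def)
qed

lemma subring_lat [simp]: "is_subring (supp_in (lat e S))"
  by (simp add: subring_supp_in)

lemma single_supp_in [simp]: "Poly_Mapping.single m c \<in> supp_in G \<longleftrightarrow> c = 0 \<or> m \<in> G"
  by (simp add: supp_in_def)

lemma lmon_supp_in [simp]: "lmon m \<in> supp_in G \<longleftrightarrow> m \<in> G"
  by (simp add: lmon_def)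

lemma lmon_not_in_prime: "is_prime P \<Longrightarrow> lmon m \<notin> P"
  using ideal_mult[OF prime_ideal, of P "lmon m" "lmon (- m)"] prime_1 by (auto simp: lmon_inverse)

lemma single_not_in_prime:
  fixes P :: "('k::field, 'n::finite) laurent set"
  assumes "is_prime P" "c \<noteq> 0"
  shows "Poly_Mapping.single m c \<notin> P"
proof
  assume "Poly_Mapping.single m c \<in> P"
  then have "Poly_Mapping.single (- m) (inverse c) * Poly_Mapping.single m c \<in> P"
    by (rule ideal_mult[OF prime_ideal[OF assms(1)]])
  then show False using assms prime_1[OF assms(1)] by (simp add: mult_single)
qed

lemma dualD:
  assumes "dual b e"
  shows "idot (e i) (b j) = (if i = j then 1 else 0)" "m = (\<Sum>j\<in>UNIV. idot (e j) m *s b j)"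
  using assms unfolding dual_def by blast+

lemma dual_axis: "dual (\<lambda>i. axis i 1) (\<lambda>i. axis i 1)"
proof -
  have "m = (\<Sum>j\<in>UNIV. m $ j *s axis j 1)" for m :: "int ^ 'n"
  proof (subst vec_eq_iff, rule allI)
    fix i
    have "(\<Sum>j\<in>UNIV. m $ j *s axis j 1) $ i = (\<Sum>j\<in>UNIV. if j = i then m $ j else 0)"
      unfolding sum_component by (intro sum.cong) (auto simp: axis_def)
    then show "m $ i = (\<Sum>j\<in>UNIV. m $ j *s axis j 1) $ i" by simp
  qed
  then show ?thesis unfolding dual_def idot_axis by (auto simp: axis_def)
qed

lemma dual_sym:
  assumes "dual b e" shows "dual e b"
proof -
  have *: "idot x m = (\<Sum>j\<in>UNIV. idot (e j) m * idot (b j) x)" for x m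
  proof -
    have "idot x m = idot x (\<Sum>j\<in>UNIV. idot (e j) m *s b j)"
      using dualD(2)[OF assms, of m] by simp
    also have "\<dots> = (\<Sum>j\<in>UNIV. idot (e j) m * idot (b j) x)"
      by (simp add: idot_sum_right idot_scale_right idot_commute)
    finally show ?thesis .
  qed
  have "m = (\<Sum>j\<in>UNIV. idot (b j) m *s e j)" for m
  proof (subst vec_eq_iff, rule allI)
    fix i
    have "m $ i = idot m (axis i 1)" by (subst idot_commute) (simp add: idot_axis)
    also have "\<dots> = (\<Sum>j\<in>UNIV. idot (e j) (axis i 1) * idot (b j) m)" by (rule *)
    also have "\<dots> = (\<Sum>j\<in>UNIV. idot (b j) m *s e j) $ i"
      by (simp add: idot_commute[of "e _"] idot_axis mult.commute)
    finally show "m $ i = (\<Sum>j\<in>UNIV. idot (b j) m *s e j) $ i" .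
  qed
  then show ?thesis using assms by (auto simp: dual_def idot_commute)
qed

text \<open>Replacing the dual vector \<open>e i\<close> by \<open>\<Sum>j\<in>S. c j *s e j\<close> is unimodular when \<open>c i = 1\<close>.\<close>

lemma dual_shear:
  assumes d: "dual b e" and "i \<in> S" "c i = 1"
  defines "e' \<equiv> e(i := \<Sum>j\<in>S. c j *s e j)"
  defines "b' \<equiv> (\<lambda>j. if j \<in> S \<and> j \<noteq> i then b j - c j *s b i else b j)"
  shows "dual b' e'"
  unfolding dual_def
proof (intro conjI allI)
  have fin: "finite S" by simp
  have ei: "idot (\<Sum>j\<in>S. c j *s e j) m = (\<Sum>j\<in>S. c j * idot (e j) m)" for m
    by (subst idot_commute) (simp add: idot_sum_right idot_scale_right idot_commute)
  have S: "(\<Sum>j\<in>S. f j) = f i + (\<Sum>j\<in>S - {i}. f j)" for f :: "'a \<Rightarrow> int"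
    using \<open>i \<in> S\<close> fin by (simp add: sum.remove)
  show "idot (e' k) (b' j) = (if k = j then 1 else 0)" for k j
  proof -
    have 1: "(\<Sum>l\<in>S. c l * (if l = j then 1 else 0)) = (if j \<in> S then c j else 0)" for j
      by (simp add: if_distrib cong: if_cong)
    show ?thesis
      using assms(2,3)
      by (auto simp: e'_def b'_def ei idot_linear_right dualD(1)[OF d] 1 right_diff_distrib sum_subtractf
          if_distrib sum_distrib_left[symmetric] cong: if_cong)
  qed
  fix m
  have "(\<Sum>j\<in>UNIV. idot (e' j) m *s b' j) = idot (e' i) m *s b i + (\<Sum>j\<in>UNIV - {i}. idot (e j) m *s b' j)"
    by (subst sum.remove[of _ i]) (auto simp: b'_def e'_def intro!: sum.cong)
  also have "(\<Sum>j\<in>UNIV - {i}. idot (e j) m *s b' j) =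
     (\<Sum>j\<in>UNIV - {i}. idot (e j) m *s b j) - (\<Sum>j\<in>UNIV - {i}. if j \<in> S then (c j * idot (e j) m) *s b i else 0)"
    unfolding sum_subtractf[symmetric]
    by (intro sum.cong) (auto simp: b'_def vec_eq_iff algebra_simps)
  also have "(\<Sum>j\<in>UNIV - {i}. if j \<in> S then (c j * idot (e j) m) *s b i else 0) =
      (\<Sum>j\<in>S - {i}. (c j * idot (e j) m) *s b i)"
    by (subst sum.inter_filter[symmetric]) (auto intro!: sum.cong)
  also have "\<dots> = (\<Sum>j\<in>S - {i}. c j * idot (e j) m) *s b i"
    by (simp add: vec_eq_iff sum_distrib_right)
  also have "idot (e' i) m = idot (e i) m + (\<Sum>j\<in>S - {i}. c j * idot (e j) m)"
    using assms(3) by (simp add: e'_def ei S)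
  finally have "(\<Sum>j\<in>UNIV. idot (e' j) m *s b' j) = idot (e i) m *s b i + (\<Sum>j\<in>UNIV - {i}. idot (e j) m *s b j)"
    by (simp add: vec_eq_iff algebra_simps)
  also have "\<dots> = (\<Sum>j\<in>UNIV. idot (e j) m *s b j)"
    by (simp add: sum.remove[of UNIV i])
  finally show "m = (\<Sum>j\<in>UNIV. idot (e' j) m *s b' j)"
    using dualD(2)[OF d, of m] by simp
qed

lemma dual_update:
  assumes d: "dual b e" and "i \<in> S" "c i = 1"
  defines "b' \<equiv> b(i := \<Sum>j\<in>S. c j *s b j)"
  defines "e' \<equiv> (\<lambda>j. if j \<in> S \<and> j \<noteq> i then e j - c j *s e i else e j)"
  shows "dual b' e'"
  using dual_sym[OF dual_shear[OF dual_sym[OF d], of i S c]] assms(2,3) unfolding b'_def e'_def .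

lemma dual_in_lat: "dual b e \<Longrightarrow> j \<in> S \<Longrightarrow> b j \<in> lat e S"
  by (auto simp: lat_def dualD(1))

lemma lat_split:
  assumes "dual b e" "m \<in> lat e (insert j T)"
  shows "m - idot (e j) m *s b j \<in> lat e T"
  using assms by (auto simp: lat_def idot_linear_right dualD(1))

text \<open>A vector of distinct powers of \<open>T\<close> is orthogonal to \<open>\<delta>\<close> exactly at the roots of a nonzero polynomial with
  coefficients \<open>\<delta> j\<close>, of degree less than \<open>card S\<close>.  The power zero is given to \<open>i\<close>.\<close>

lemma moment_curve:
  fixes S :: "'n::finite set"
  assumes "i \<in> S"
  shows "\<exists>c :: nat \<Rightarrow> 'n \<Rightarrow> int. (\<forall>T. c T i = 1) \<and>
     (\<forall>\<delta> :: 'n \<Rightarrow> real. (\<exists>j\<in>S. \<delta> j \<noteq> 0) \<longrightarrow>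
       finite {T. (\<Sum>j\<in>S. of_int (c T j) * \<delta> j) = 0} \<and>
       card {T. (\<Sum>j\<in>S. of_int (c T j) * \<delta> j) = 0} < card S)"
proof -
  have fin: "finite (S - {i})" by simp
  obtain g where g: "bij_betw g (S - {i}) {0..<card (S - {i})}"
    using ex_bij_betw_finite_nat[OF fin] by blast
  define h where "h j = (if j = i then 0 else Suc (g j))" for j
  have inj: "inj_on h S" using g by (auto simp: inj_on_def h_def bij_betw_def)
  have hS: "h j < card S" if "j \<in> S" for j
  proof (cases "j = i")
    case True then show ?thesis using assms by (auto simp: h_def card_gt_0_iff)
  next
    case False
    then have "g j < card (S - {i})" using g that by (auto simp: bij_betw_def)
    then show ?thesis using False assms by (simp add: h_def)
  qed
  define c :: "nat \<Rightarrow> 'n \<Rightarrow> int" where "c T j = int T ^ h j" for T j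
  show ?thesis
  proof (intro exI[of _ c] conjI allI impI)
    show "c T i = 1" for T by (simp add: c_def h_def)
    fix \<delta> :: "'n \<Rightarrow> real" assume "\<exists>j\<in>S. \<delta> j \<noteq> 0"
    then obtain j0 where j0: "j0 \<in> S" "\<delta> j0 \<noteq> 0" by blast
    define p where "p = (\<Sum>j\<in>S. Polynomial.monom (\<delta> j) (h j))"
    have "coeff p (h j0) = (\<Sum>j\<in>S. if j = j0 then \<delta> j else 0)"
      unfolding p_def coeff_sum
      by (intro sum.cong) (use inj j0 in \<open>auto simp: coeff_monom inj_on_def\<close>)
    then have "p \<noteq> 0" using j0 by auto
    have deg: "degree p < card S"
    proof -
      have "degree p \<le> card S - 1" unfolding p_def
      proof (intro degree_sum_le)
        fix j assume "j \<in> S"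
        then show "degree (Polynomial.monom (\<delta> j) (h j)) \<le> card S - 1"
          using hS[of j] degree_monom_le[of "\<delta> j" "h j"] by linarith
      qed simp
      moreover have "0 < card S" using assms by (auto simp: card_gt_0_iff)
      ultimately show ?thesis by linarith
    qed
    have ev: "poly p (real T) = (\<Sum>j\<in>S. of_int (c T j) * \<delta> j)" for T
      by (simp add: p_def poly_sum poly_monom c_def mult.commute)
    have sub: "real ` {T. (\<Sum>j\<in>S. of_int (c T j) * \<delta> j) = 0} \<subseteq> {x. poly p x = 0}"
      by (auto simp: ev)
    have finr: "finite {x. poly p x = 0}" using \<open>p \<noteq> 0\<close> by (rule poly_roots_finite)
    have f: "finite {T. (\<Sum>j\<in>S. of_int (c T j) * \<delta> j) = 0}"
      using finite_subset[OF sub finr] by (rule finite_imageD) (simp add: inj_on_def)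
    have "card {T. (\<Sum>j\<in>S. of_int (c T j) * \<delta> j) = 0} = card (real ` {T. (\<Sum>j\<in>S. of_int (c T j) * \<delta> j) = 0})"
      by (rule card_image[symmetric]) (simp add: inj_on_def)
    also have "\<dots> \<le> card {x. poly p x = 0}" by (rule card_mono[OF finr sub])
    also have "\<dots> \<le> degree p" using \<open>p \<noteq> 0\<close> by (rule card_poly_roots_bound)
    finally show "card {T. (\<Sum>j\<in>S. of_int (c T j) * \<delta> j) = 0} < card S" using deg by simp
    show "finite {T. (\<Sum>j\<in>S. of_int (c T j) * \<delta> j) = 0}" by (rule f)
  qed
qed

subsection \<open>Division with remainder in a generic direction\<close>

definition extreme_terms :: "int ^ 'n::finite \<Rightarrow> ('k::field, 'n) laurent \<Rightarrow> int ^ 'n \<Rightarrow> int ^ 'n \<Rightarrow> bool" where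
  "extreme_terms e q mt mb \<longleftrightarrow> mt \<in> Poly_Mapping.keys q \<and> mb \<in> Poly_Mapping.keys q \<and>
     (\<forall>m\<in>Poly_Mapping.keys q. m \<noteq> mt \<longrightarrow> idot e m < idot e mt) \<and>
     (\<forall>m\<in>Poly_Mapping.keys q. m \<noteq> mb \<longrightarrow> idot e mb < idot e m)"

lemma extreme_terms_bounds:
  assumes "extreme_terms e q mt mb"
  shows "k \<in> Poly_Mapping.keys q \<Longrightarrow> idot e k \<le> idot e mt"
    and "k \<in> Poly_Mapping.keys q \<Longrightarrow> idot e mb \<le> idot e k"
    and "k \<in> Poly_Mapping.keys q \<Longrightarrow> k \<noteq> mt \<Longrightarrow> idot e k < idot e mt"
    and "k \<in> Poly_Mapping.keys q \<Longrightarrow> k \<noteq> mb \<Longrightarrow> idot e mb < idot e k"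
    and "idot e mb \<le> idot e mt" and "mt \<in> Poly_Mapping.keys q" and "mb \<in> Poly_Mapping.keys q"
proof -
  show 1: "mt \<in> Poly_Mapping.keys q" "mb \<in> Poly_Mapping.keys q"
    and 2: "k \<in> Poly_Mapping.keys q \<Longrightarrow> k \<noteq> mt \<Longrightarrow> idot e k < idot e mt"
    "k \<in> Poly_Mapping.keys q \<Longrightarrow> k \<noteq> mb \<Longrightarrow> idot e mb < idot e k" for k
    using assms unfolding extreme_terms_def by blast+
  show 3: "idot e k \<le> idot e mt" if "k \<in> Poly_Mapping.keys q" for k
    using 2(1)[OF that] by (cases "k = mt") simp_all
  show "idot e mb \<le> idot e k" if "k \<in> Poly_Mapping.keys q" for k
    using 2(2)[OF that] by (cases "k = mb") simp_all
  show "idot e mb \<le> idot e mt" using 3 1 by blast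
qed

text \<open>If \<open>q\<close> has a single term of largest and a single term of smallest \<open>e\<close>-degree, these terms
  are units of the Laurent polynomial ring, so that terms outside a window as wide as \<open>q\<close> can
  be pushed into the window from both sides.\<close>

lemma laurent_division:
  fixes q :: "('k::field, 'n::finite) laurent"
  assumes ext: "extreme_terms e q mt mb" and G: "lattice G"
    and q: "q \<in> supp_in G" and p: "p \<in> supp_in G"
  obtains \<kappa> where "\<kappa> \<in> supp_in G"
    "\<And>m. m \<in> Poly_Mapping.keys (p - \<kappa> * q) \<Longrightarrow> D \<le> idot e m \<and> idot e m < D + (idot e mt - idot e mb)"
proof -
  let ?W = "idot e mt - idot e mb"
  let ?in = "\<lambda>m. D \<le> idot e m \<and> idot e m < D + ?W"
  define good where "good p \<longleftrightarrow> (\<exists>\<kappa>\<in>supp_in G. \<forall>m\<in>Poly_Mapping.keys (p - \<kappa> * q). ?in m)"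
    for p :: "('k, 'n) laurent"
  have sub: "is_subring (supp_in G :: ('k, 'n) laurent set)" using G by (rule subring_supp_in)
  have good0: "good 0" unfolding good_def using subring_0[OF sub] by (auto intro!: bexI[of _ 0])
  have good_add: "good (p + p')" if "good p" "good p'" for p p'
  proof -
    obtain \<kappa> \<kappa>' where k: "\<kappa> \<in> supp_in G" "\<forall>m\<in>Poly_Mapping.keys (p - \<kappa> * q). ?in m"
      "\<kappa>' \<in> supp_in G" "\<forall>m\<in>Poly_Mapping.keys (p' - \<kappa>' * q). ?in m"
      using \<open>good p\<close> \<open>good p'\<close> unfolding good_def by blast
    have eq: "p + p' - (\<kappa> + \<kappa>') * q = (p - \<kappa> * q) + (p' - \<kappa>' * q)" by (simp add: algebra_simps)
    have "\<forall>m\<in>Poly_Mapping.keys (p + p' - (\<kappa> + \<kappa>') * q). ?in m"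
      unfolding eq using k Poly_Mapping.keys_add[of "p - \<kappa> * q" "p' - \<kappa>' * q"] by blast
    then show ?thesis unfolding good_def using k subring_add[OF sub] by blast
  qed
  have good_sum: "(\<And>x. x \<in> A \<Longrightarrow> good (F x)) \<Longrightarrow> good (sum F A)" for F and A :: "(int^'n) set"
    by (induction A rule: infinite_finite_induct) (auto simp: good0 intro: good_add)
  have good_red: "good p" if "good (p - \<kappa>0 * q)" "\<kappa>0 \<in> supp_in G" for p \<kappa>0
  proof -
    obtain \<kappa> where k: "\<kappa> \<in> supp_in G" "\<forall>m\<in>Poly_Mapping.keys (p - \<kappa>0 * q - \<kappa> * q). ?in m"
      using \<open>good (p - \<kappa>0 * q)\<close> unfolding good_def by blast
    have "p - \<kappa>0 * q - \<kappa> * q = p - (\<kappa>0 + \<kappa>) * q" by (simp add: algebra_simps)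
    then show ?thesis unfolding good_def using k that subring_add[OF sub] by metis
  qed
  have W: "0 \<le> ?W" using extreme_terms_bounds(5)[OF ext] by simp
  have Gadd: "x \<in> G \<Longrightarrow> y \<in> G \<Longrightarrow> x + y \<in> G" "x \<in> G \<Longrightarrow> y \<in> G \<Longrightarrow> x - y \<in> G" for x y
    using G by (auto simp: lattice_def)
  have mono: "good (Poly_Mapping.single m c)" if "m \<in> G" for m c
    using that
  \<comment> \<open>induction on the distance of the exponent to the window\<close>
  proof (induction "nat (max (idot e m - (D + ?W) + 1) (D - idot e m))" arbitrary: m c rule: less_induct)
    case less
    have pivot: ?case if k0: "k0 \<in> Poly_Mapping.keys q"
      and IH: "\<And>k. k \<in> Poly_Mapping.keys q \<Longrightarrow> k \<noteq> k0 \<Longrightarrow>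
        nat (max (idot e (m - k0 + k) - (D + ?W) + 1) (D - idot e (m - k0 + k))) <
        nat (max (idot e m - (D + ?W) + 1) (D - idot e m))" for k0
    proof (rule good_red)
      let ?c = "c / Poly_Mapping.lookup q k0" and ?K = "Poly_Mapping.keys q"
      have kG: "k \<in> G" if "k \<in> ?K" for k using q that by (auto simp: supp_in_def)
      have "m - k0 \<in> G" using less.prems Gadd kG k0 by auto
      then show "Poly_Mapping.single (m - k0) ?c \<in> supp_in G" by simp
      have "Poly_Mapping.single (m - k0) ?c * q =
         Poly_Mapping.single (m - k0) ?c * (\<Sum>k\<in>?K. Poly_Mapping.single k (Poly_Mapping.lookup q k))"
        using laurent_expand[of ?K q] by simp
      also have "\<dots> = (\<Sum>k\<in>?K. Poly_Mapping.single (m - k0 + k) (?c * Poly_Mapping.lookup q k))"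
        by (simp add: sum_distrib_left mult_single)
      also have "\<dots> = Poly_Mapping.single m c +
          (\<Sum>k\<in>?K - {k0}. Poly_Mapping.single (m - k0 + k) (?c * Poly_Mapping.lookup q k))"
        using k0 by (subst sum.remove[OF _ k0]) (auto simp: in_keys_iff)
      finally have eq: "Poly_Mapping.single m c - Poly_Mapping.single (m - k0) ?c * q =
         (\<Sum>k\<in>?K - {k0}. Poly_Mapping.single (m - k0 + k) (- (?c * Poly_Mapping.lookup q k)))"
        by (simp add: sum_negf single_uminus)
      show "good (Poly_Mapping.single m c - Poly_Mapping.single (m - k0) ?c * q)"
        unfolding eq
        by (intro good_sum less.hyps) (use IH \<open>m - k0 \<in> G\<close> Gadd kG in auto)
    qed
    consider "?in m" | "idot e m \<ge> D + ?W" | "idot e m < D" by linarith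
    then show ?case
    proof cases
      case 1
      then show ?thesis unfolding good_def using subring_0[OF sub] by (intro bexI[of _ 0]) auto
    next
      case 2
      show ?thesis
      proof (rule pivot[of mt])
        show "mt \<in> Poly_Mapping.keys q" using ext by (simp add: extreme_terms_def)
        fix k assume "k \<in> Poly_Mapping.keys q" "k \<noteq> mt"
        then have "idot e k < idot e mt" "idot e mb \<le> idot e k"
          using extreme_terms_bounds[OF ext] by blast+
        then show "nat (max (idot e (m - mt + k) - (D + ?W) + 1) (D - idot e (m - mt + k))) <
          nat (max (idot e m - (D + ?W) + 1) (D - idot e m))"
          using 2 W by (simp add: idot_linear_right)
      qed
    next
      case 3
      show ?thesis
      proof (rule pivot[of mb])
        show "mb \<in> Poly_Mapping.keys q" using ext by (simp add: extreme_terms_def)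
        fix k assume "k \<in> Poly_Mapping.keys q" "k \<noteq> mb"
        then have "idot e k \<le> idot e mt" "idot e mb < idot e k"
          using extreme_terms_bounds[OF ext] by blast+
        then show "nat (max (idot e (m - mb + k) - (D + ?W) + 1) (D - idot e (m - mb + k))) <
          nat (max (idot e m - (D + ?W) + 1) (D - idot e m))"
          using 3 W by (simp add: idot_linear_right)
      qed
    qed
  qed
  have "good (\<Sum>m\<in>Poly_Mapping.keys p. Poly_Mapping.single m (Poly_Mapping.lookup p m))"
    using p by (intro good_sum mono) (auto simp: supp_in_def)
  then have "good p" using laurent_expand[of "Poly_Mapping.keys p" p] by simp
  then show thesis using that unfolding good_def by blast
qed

lemma extreme_terms_exist:
  assumes "q \<noteq> 0" "inj_on (idot e) (Poly_Mapping.keys q)"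
  obtains mt mb where "extreme_terms e q mt mb"
proof -
  let ?K = "Poly_Mapping.keys q"
  have K: "finite ?K" "?K \<noteq> {}" using assms by auto
  have "Max (idot e ` ?K) \<in> idot e ` ?K" "Min (idot e ` ?K) \<in> idot e ` ?K"
    using K by (auto intro!: Max_in Min_in)
  then obtain mt mb where m: "mt \<in> ?K" "idot e mt = Max (idot e ` ?K)"
    "mb \<in> ?K" "idot e mb = Min (idot e ` ?K)" by force
  have 1: "idot e m \<le> idot e mt" "idot e mb \<le> idot e m" if "m \<in> ?K" for m
    using K that m by (auto intro: Max_ge Min_le)
  have "idot e m < idot e mt" if "m \<in> ?K" "m \<noteq> mt" for m
    using 1(1)[OF that(1)] inj_onD[OF assms(2) _ that(1) m(1)] that(2) by force
  moreover have "idot e mb < idot e m" if "m \<in> ?K" "m \<noteq> mb" for m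
    using 1(2)[OF that(1)] inj_onD[OF assms(2) _ that(1) m(3)] that(2) by force
  ultimately have "extreme_terms e q mt mb" using m by (auto simp: extreme_terms_def)
  then show thesis using that by blast
qed

text \<open>A separating direction may keep the \<open>i\<close>-th coefficient equal to \<open>1\<close>, so that it replaces \<open>e i\<close> in a
  dual basis.\<close>

lemma generic_direction:
  assumes d: "dual b e" and "i \<in> S" and "finite K" "K \<subseteq> lat e S"
  obtains c where "c i = 1" "inj_on (idot (\<Sum>j\<in>S. c j *s e j)) K"
proof -
  from moment_curve[OF \<open>i \<in> S\<close>] obtain c :: "nat \<Rightarrow> 'a \<Rightarrow> int" where
    "(\<forall>T. c T i = 1) \<and> (\<forall>\<delta> :: 'a \<Rightarrow> real. (\<exists>j\<in>S. \<delta> j \<noteq> 0) \<longrightarrow>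
       finite {T. (\<Sum>j\<in>S. of_int (c T j) * \<delta> j) = 0} \<and>
       card {T. (\<Sum>j\<in>S. of_int (c T j) * \<delta> j) = 0} < card S)"
    by (rule exE)
  note c = conjunct1[OF this] and bad = conjunct2[OF this]
  define B where "B m m' = {T. (\<Sum>j\<in>S. of_int (c T j) * real_of_int (idot (e j) (m - m'))) = 0}" for m m'
  have fin: "finite (B m m')" if "m \<in> K" "m' \<in> K" "m \<noteq> m'" for m m'
  proof -
    have "m - m' \<in> lat e S" using that assms(4) lattice_lat[of e S] by (auto simp: lattice_def)
    then have 0: "idot (e j) (m - m') = 0" if "j \<notin> S" for j using that by (auto simp: lat_def)
    have "\<exists>j\<in>S. idot (e j) (m - m') \<noteq> 0"
    proof (rule ccontr)
      assume "\<not> ?thesis"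
      then have "m - m' = 0" using dualD(2)[OF d, of "m - m'"] 0
        by (metis (no_types, lifting) sum.neutral vector_smult_lzero)
      then show False using that by simp
    qed
    then show ?thesis unfolding B_def using bad[THEN spec, of "\<lambda>j. real_of_int (idot (e j) (m - m'))"] by simp
  qed
  let ?U = "\<Union>(m, m') \<in> {(m, m') \<in> K \<times> K. m \<noteq> m'}. B m m'"
  have "finite {(m, m') \<in> K \<times> K. m \<noteq> m'}" using \<open>finite K\<close>
    by (rule_tac finite_subset[of _ "K \<times> K"]) auto
  then have "finite ?U" using fin by auto
  then obtain T where T: "T \<notin> ?U" using ex_new_if_finite[of ?U] by (auto simp: infinite_UNIV_nat)
  have dot: "idot (\<Sum>j\<in>S. c T j *s e j) m = (\<Sum>j\<in>S. c T j * idot (e j) m)" for m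
    by (subst idot_commute) (simp add: idot_sum_right idot_scale_right idot_commute)
  have "inj_on (idot (\<Sum>j\<in>S. c T j *s e j)) K"
  proof (rule inj_onI, rule ccontr)
    fix m m' assume m: "m \<in> K" "m' \<in> K" "m \<noteq> m'"
      and eq: "idot (\<Sum>j\<in>S. c T j *s e j) m = idot (\<Sum>j\<in>S. c T j *s e j) m'"
    have "(\<Sum>j\<in>S. c T j * idot (e j) (m - m')) = 0"
      unfolding dot[symmetric] using eq by (simp add: idot_linear_right)
    then have "of_int (\<Sum>j\<in>S. c T j * idot (e j) (m - m')) = (0::real)" by simp
    then have "T \<in> B m m'" unfolding B_def by simp
    then show False using T m by auto
  qed
  then show thesis using that c by blast
qed

section \<open>Tropical hypersurfaces\<close>

definition rdot :: "int ^ 'n::finite \<Rightarrow> real ^ 'n \<Rightarrow> real" where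
  "rdot m u = (\<Sum>i\<in>UNIV. of_int (m $ i) * u $ i)"

lemma rdot_add_left: "rdot (m + m') u = rdot m u + rdot m' u"
  by (simp add: rdot_def algebra_simps sum.distrib)

lemma rdot_diff_left: "rdot (m - m') u = rdot m u - rdot m' u"
  by (simp add: rdot_def algebra_simps sum_subtractf)

lemma rdot_scale_left: "rdot (k *s m) u = of_int k * rdot m u"
  by (simp add: rdot_def algebra_simps sum_distrib_left)

lemma rdot_0_left [simp]: "rdot 0 u = 0"
  by (simp add: rdot_def)

lemma rdot_sum_left: "rdot (sum f A) u = (\<Sum>x\<in>A. rdot (f x) u)"
  by (induction A rule: infinite_finite_induct) (simp_all add: rdot_add_left)

lemma rdot_axis: "rdot (axis i 1) u = u $ i"
proof -
  have "rdot (axis i 1) u = (\<Sum>j\<in>UNIV. if j = i then u $ i else 0)"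
    unfolding rdot_def by (intro sum.cong) (auto simp: axis_def)
  then show ?thesis by simp
qed

lemma rdot_add_right: "rdot m (u + u') = rdot m u + rdot m u'"
  by (simp add: rdot_def algebra_simps sum.distrib)

lemma rdot_diff_right: "rdot m (u - u') = rdot m u - rdot m u'"
  by (simp add: rdot_def algebra_simps sum_subtractf)

lemma rdot_scale_right: "rdot m (k *\<^sub>R u) = k * rdot m u"
  by (simp add: rdot_def algebra_simps sum_distrib_left)

lemmas rdot_linear = rdot_add_left rdot_diff_left rdot_scale_left rdot_add_right rdot_diff_right
  rdot_scale_right

text \<open>The valuation of a term of \<open>f\<close> at a point with valuation \<open>u\<close>, and the tropical hypersurface of \<open>f\<close> in
  the minimum convention.\<close>

definition wt :: "('k::field \<Rightarrow> real) \<Rightarrow> ('k, 'n::finite) laurent \<Rightarrow> int ^ 'n \<Rightarrow> real ^ 'n \<Rightarrow> real" where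
  "wt N f m u = - ln (N (Poly_Mapping.lookup f m)) + rdot m u"

definition trop :: "('k::field \<Rightarrow> real) \<Rightarrow> ('k, 'n::finite) laurent \<Rightarrow> (real ^ 'n) set" where
  "trop N f = {u. f = 0 \<or> (\<exists>m1\<in>Poly_Mapping.keys f. \<exists>m2\<in>Poly_Mapping.keys f. m1 \<noteq> m2 \<and>
     wt N f m1 u = wt N f m2 u \<and> (\<forall>m\<in>Poly_Mapping.keys f. wt N f m1 u \<le> wt N f m u))}"

definition trop_set :: "('k::field \<Rightarrow> real) \<Rightarrow> ('k, 'n::finite) laurent set \<Rightarrow> (real ^ 'n) set" where
  "trop_set N P = (\<Inter>f\<in>P. trop N f)"

definition fibre :: "(real ^ 'n::finite) set \<Rightarrow> (int ^ 'n) set \<Rightarrow> real ^ 'n \<Rightarrow> (real ^ 'n) set" where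
  "fibre Q G u = {u'\<in>Q. \<forall>m\<in>G. rdot m u' = rdot m u}"

section \<open>Noether normalization on tori\<close>

text \<open>The projection to the torus with character lattice \<open>lat e S\<close> is finite on the variety of \<open>P\<close>, and it
  has fibres of bounded size on the tropical variety.\<close>

definition finite_proj ::
  "('k::field \<Rightarrow> real) \<Rightarrow> ('k, 'n::finite) laurent set \<Rightarrow> ('n \<Rightarrow> int ^ 'n) \<Rightarrow> ('n \<Rightarrow> int ^ 'n) \<Rightarrow> 'n set \<Rightarrow> bool"
where
  "finite_proj N P b e S \<longleftrightarrow> dual b e \<and> (\<exists>E. finite_mod (supp_in (lat e S)) E P) \<and>
     (\<exists>M. \<forall>u. finite (fibre (trop_set N P) (lat e S) u) \<and> card (fibre (trop_set N P) (lat e S) u) \<le> M)"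

lemma finite_mod_trans:
  assumes P: "is_ideal P" and B: "finite_mod B E P" and B': "is_subring B'"
    and y: "\<And>g. g \<in> B \<Longrightarrow> \<exists>c. (\<forall>k<W. c k \<in> B') \<and> g - (\<Sum>k<W. c k * y k) \<in> P"
  shows "finite_mod B' ((\<lambda>(x, k). x * y k) ` (E \<times> {..<W::nat})) P"
  unfolding finite_mod_def
proof (intro conjI allI)
  let ?I = "E \<times> {..<W}" and ?h = "\<lambda>(x, k). x * y k"
  have finE: "finite E" using B by (simp add: finite_mod_def)
  then show fin: "finite (?h ` ?I)" by simp
  fix g
  obtain c where c: "\<forall>x\<in>E. c x \<in> B" "g - (\<Sum>x\<in>E. c x * x) \<in> P"
    using B unfolding finite_mod_def by blast
  have "\<forall>x\<in>E. \<exists>d. (\<forall>k<W. d k \<in> B') \<and> c x - (\<Sum>k<W. d k * y k) \<in> P" using c y by blast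
  then obtain d where d: "\<And>x k. x \<in> E \<Longrightarrow> k < W \<Longrightarrow> d x k \<in> B'"
    "\<And>x. x \<in> E \<Longrightarrow> c x - (\<Sum>k<W. d x k * y k) \<in> P" by metis
  \<comment> \<open>several products \<open>x * y k\<close> may coincide, so their coefficients are collected\<close>
  define a where "a z = (\<Sum>p\<in>{p\<in>?I. ?h p = z}. d (fst p) (snd p))" for z
  have "(\<Sum>z\<in>?h ` ?I. a z * z) = (\<Sum>z\<in>?h ` ?I. \<Sum>p\<in>{p\<in>?I. ?h p = z}. d (fst p) (snd p) * ?h p)"
    unfolding a_def sum_distrib_right by (intro sum.cong) auto
  also have "\<dots> = (\<Sum>p\<in>?I. d (fst p) (snd p) * ?h p)"
    using finE by (intro sum.image_gen[symmetric]) auto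
  also have "\<dots> = (\<Sum>x\<in>E. \<Sum>k<W. d x k * (x * y k))"
    by (simp add: sum.cartesian_product case_prod_unfold)
  finally have 1: "(\<Sum>z\<in>?h ` ?I. a z * z) = (\<Sum>x\<in>E. \<Sum>k<W. d x k * (x * y k))" .
  have "(\<Sum>x\<in>E. (c x - (\<Sum>k<W. d x k * y k)) * x) = (\<Sum>x\<in>E. c x * x) - (\<Sum>x\<in>E. \<Sum>k<W. d x k * (x * y k))"
    unfolding left_diff_distrib sum_subtractf sum_distrib_right by (simp add: mult_ac)
  then have "g - (\<Sum>z\<in>?h ` ?I. a z * z) =
      (g - (\<Sum>x\<in>E. c x * x)) + (\<Sum>x\<in>E. (c x - (\<Sum>k<W. d x k * y k)) * x)"
    unfolding 1 by simp
  also have "\<dots> \<in> P" using c d by (intro ideal_add ideal_sum ideal_mult2 P) auto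
  finally have "g - (\<Sum>z\<in>?h ` ?I. a z * z) \<in> P" .
  moreover have "a z \<in> B'" for z unfolding a_def using d by (intro subring_sum[OF B']) auto
  ultimately show "\<exists>c. (\<forall>x\<in>?h ` ?I. c x \<in> B') \<and> g - (\<Sum>x\<in>?h ` ?I. c x * x) \<in> P" by blast
qed

text \<open>Sorting the terms of \<open>g\<close> by their \<open>e i\<close>-degree writes \<open>g\<close> as a polynomial in the monomial with exponent
  \<open>b i\<close>.\<close>

lemma lat_slice_sum:
  fixes g :: "('k::field, 'n::finite) laurent"
  assumes d: "dual b e" and "i \<in> S" and g: "g \<in> supp_in (lat e S)"
    and W: "\<And>m. m \<in> Poly_Mapping.keys g \<Longrightarrow> 0 \<le> idot (e i) m \<and> idot (e i) m < int W"
  obtains c where "\<And>k. c k \<in> supp_in (lat e (S - {i}))" "g = (\<Sum>k<W. c k * lmon (int k *s b i))"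
proof -
  let ?K = "Poly_Mapping.keys g"
  define c where "c k = (\<Sum>m\<in>{m\<in>?K. nat (idot (e i) m) = k}.
      Poly_Mapping.single (m - int k *s b i) (Poly_Mapping.lookup g m))" for k
  have "c k \<in> supp_in (lat e (S - {i}))" for k
    unfolding c_def
  proof (rule subring_sum[OF subring_lat], unfold single_supp_in, rule disjI2)
    fix m assume "m \<in> {m\<in>?K. nat (idot (e i) m) = k}"
    then have m: "m \<in> ?K" "idot (e i) m = int k" using W by auto
    then have "m \<in> lat e (insert i (S - {i}))" using g \<open>i \<in> S\<close> by (auto simp: supp_in_def insert_absorb)
    from lat_split[OF d this] m show "m - int k *s b i \<in> lat e (S - {i})" by simp
  qed
  moreover have "g = (\<Sum>k<W. c k * lmon (int k *s b i))"
  proof -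
    have "(\<Sum>k<W. c k * lmon (int k *s b i)) =
        (\<Sum>k<W. \<Sum>m\<in>{m\<in>?K. nat (idot (e i) m) = k}. Poly_Mapping.single m (Poly_Mapping.lookup g m))"
      unfolding c_def sum_distrib_right by (intro sum.cong) (auto simp: lmon_def mult_single)
    also have "\<dots> = (\<Sum>m\<in>?K. Poly_Mapping.single m (Poly_Mapping.lookup g m))"
    proof (intro sum.group)
      show "(\<lambda>m. nat (idot (e i) m)) ` ?K \<subseteq> {..<W}"
        using W by (auto simp: nat_less_iff)
    qed auto
    also have "\<dots> = g" using laurent_expand[of ?K g] by simp
    finally show ?thesis by simp
  qed
  ultimately show thesis using that by blast
qed

text \<open>One elimination step.  In a direction that is injective on the exponents of a nonzero
  \<open>f \<in> P\<close> every power of the eliminated variable occurs in \<open>f\<close> with a monomial coefficient.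
  Hence the projection is finite, and over a point the tropical equation of \<open>f\<close> leaves finitely
  many values for the eliminated coordinate.\<close>

lemma elimination_step:
  fixes P :: "('k::field, 'n::finite) laurent set"
  assumes P: "is_prime P" and fp: "finite_proj N P b e S"
    and f: "f \<in> P" "f \<in> supp_in (lat e S)" "f \<noteq> 0"
  obtains i b' e' where "i \<in> S" "finite_proj N P b' e' (S - {i})"
proof -
  let ?K = "Poly_Mapping.keys f"
  have d: "dual b e" using fp by (simp add: finite_proj_def)
  obtain E where E: "finite_mod (supp_in (lat e S)) E P" using fp by (auto simp: finite_proj_def)
  obtain M where M: "\<And>u. finite (fibre (trop_set N P) (lat e S) u)"
    "\<And>u. card (fibre (trop_set N P) (lat e S) u) \<le> M" using fp by (auto simp: finite_proj_def)
  have "S \<noteq> {}"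
  proof
    assume "S = {}"
    have "m = 0" if "m \<in> ?K" for m
    proof -
      have "\<forall>j. idot (e j) m = 0" using that f(2) \<open>S = {}\<close> by (auto simp: supp_in_def lat_def)
      then show ?thesis using dualD(2)[OF d, of m] by simp
    qed
    then have "f = Poly_Mapping.single 0 (Poly_Mapping.lookup f 0)"
      using laurent_expand[of "{0}" f] by auto
    moreover from this have "Poly_Mapping.lookup f 0 \<noteq> 0" using f(3) by (metis single_zero)
    ultimately show False using single_not_in_prime[OF P] f(1) by metis
  qed
  then obtain i where i: "i \<in> S" by blast
  obtain c where c: "c i = 1" "inj_on (idot (\<Sum>j\<in>S. c j *s e j)) ?K"
    using generic_direction[OF d i, of ?K] f(2) by (auto simp: supp_in_def)
  define e' where "e' = e(i := \<Sum>j\<in>S. c j *s e j)"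
  define b' where "b' = (\<lambda>j. if j \<in> S \<and> j \<noteq> i then b j - c j *s b i else b j)"
  have d': "dual b' e'" unfolding e'_def b'_def using dual_shear[of b e i S c] d i c(1) by simp
  have inj: "inj_on (idot (e' i)) ?K" using c(2) by (simp add: e'_def)
  have latS: "lat e' S = lat e S"
  proof -
    have "j \<noteq> i" if "j \<notin> S" for j using i that by auto
    then show ?thesis by (auto simp: lat_def e'_def)
  qed
  obtain mt mb where ext: "extreme_terms (e' i) f mt mb" using extreme_terms_exist[OF f(3) inj] .
  define W where "W = nat (idot (e' i) mt - idot (e' i) mb)"
  have Wi: "int W = idot (e' i) mt - idot (e' i) mb"
  proof -
    have "idot (e' i) mb \<le> idot (e' i) mt" using extreme_terms_bounds(5)[OF ext] .
    then show ?thesis by (simp add: W_def)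
  qed
  let ?B' = "supp_in (lat e' (S - {i})) :: ('k, 'n) laurent set"
  have "\<exists>c. (\<forall>k<W. c k \<in> ?B') \<and> g - (\<Sum>k<W. c k * lmon (int k *s b' i)) \<in> P"
    if g: "g \<in> supp_in (lat e S)" for g
  proof -
    obtain \<kappa> where k: "\<kappa> \<in> supp_in (lat e S)"
      "\<And>m. m \<in> Poly_Mapping.keys (g - \<kappa> * f) \<Longrightarrow> 0 \<le> idot (e' i) m \<and> idot (e' i) m < 0 + (idot (e' i) mt - idot (e' i) mb)"
      using laurent_division[OF ext lattice_lat f(2) g, where D = 0] by metis
    have rem: "g - \<kappa> * f \<in> supp_in (lat e' S)"
      unfolding latS using g k f(2) by (intro subring_diff subring_mult subring_lat)
    obtain c where "\<And>k. c k \<in> ?B'" "g - \<kappa> * f = (\<Sum>k<W. c k * lmon (int k *s b' i))"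
      using lat_slice_sum[OF d' i rem, of W] k(2) Wi by auto
    moreover have "\<kappa> * f \<in> P" using ideal_mult[OF prime_ideal[OF P] f(1)] .
    ultimately show ?thesis by (intro exI[of _ c]) (auto simp: algebra_simps)
  qed
  then have fm: "finite_mod ?B' ((\<lambda>(x, k). x * lmon (int k *s b' i)) ` (E \<times> {..<W})) P"
    by (intro finite_mod_trans[OF prime_ideal[OF P] E subring_lat])
  let ?G' = "lat e' (S - {i})" and ?T = "trop_set N P"
  have fib: "finite (fibre ?T ?G' u) \<and> card (fibre ?T ?G' u) \<le> card (?K \<times> ?K) * M" for u
  proof -
    have split: "rdot m u' = rdot (m - idot (e' i) m *s b' i) u + of_int (idot (e' i) m) * rdot (b' i) u'"
      if "u' \<in> fibre ?T ?G' u" "m \<in> lat e S" for u' m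
    proof -
      have "m \<in> lat e' (insert i (S - {i}))" using that i by (simp add: latS insert_absorb)
      then have "m - idot (e' i) m *s b' i \<in> ?G'" by (rule lat_split[OF d'])
      then have "rdot (m - idot (e' i) m *s b' i) u' = rdot (m - idot (e' i) m *s b' i) u"
        using that by (auto simp: fibre_def)
      then show ?thesis by (simp add: rdot_linear)
    qed
    \<comment> \<open>the value of the eliminated coordinate at which the terms \<open>m1\<close> and \<open>m2\<close> balance\<close>
    define \<rho> where "\<rho> p = (case p of (m1, m2) \<Rightarrow>
      (ln (N (Poly_Mapping.lookup f m1)) - rdot (m1 - idot (e' i) m1 *s b' i) u
       - (ln (N (Poly_Mapping.lookup f m2)) - rdot (m2 - idot (e' i) m2 *s b' i) u))
      / of_int (idot (e' i) m1 - idot (e' i) m2))" for p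
    let ?F = "\<lambda>r. {u' \<in> fibre ?T ?G' u. rdot (b' i) u' = r}"
    have cover: "fibre ?T ?G' u \<subseteq> (\<Union>p\<in>?K \<times> ?K. ?F (\<rho> p))"
    proof
      fix u' assume u': "u' \<in> fibre ?T ?G' u"
      then have "u' \<in> trop N f" using f(1) by (auto simp: fibre_def trop_set_def)
      then obtain m1 m2 where m: "m1 \<in> ?K" "m2 \<in> ?K" "m1 \<noteq> m2" "wt N f m1 u' = wt N f m2 u'"
        using f(3) by (auto simp: trop_def)
      then have ne: "idot (e' i) m1 \<noteq> idot (e' i) m2" using inj by (auto simp: inj_on_def)
      have l: "m1 \<in> lat e S" "m2 \<in> lat e S" using m f(2) by (auto simp: supp_in_def)
      have "rdot (b' i) u' = \<rho> (m1, m2)"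
        using m(4) ne unfolding wt_def split[OF u' l(1)] split[OF u' l(2)]
        by (simp add: \<rho>_def field_simps)
      then show "u' \<in> (\<Union>p\<in>?K \<times> ?K. ?F (\<rho> p))" using u' m by blast
    qed
    have one: "finite (?F r) \<and> card (?F r) \<le> M" for r
    proof (cases "?F r = {}")
      case False
      then obtain u0 where u0: "u0 \<in> ?F r" by blast
      have "?F r \<subseteq> fibre ?T (lat e S) u0"
      proof
        fix u' assume u': "u' \<in> ?F r"
        have "rdot m u' = rdot m u0" if "m \<in> lat e S" for m
          using split[of u' m] split[of u0 m] that u' u0 by auto
        then show "u' \<in> fibre ?T (lat e S) u0" using u' by (auto simp: fibre_def)
      qed
      then show ?thesis using M[of u0] card_mono finite_subset by (meson order.trans)
    next
      case True
      show ?thesis unfolding True by simp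
    qed
    have fin: "finite (\<Union>p\<in>?K \<times> ?K. ?F (\<rho> p))" using one by auto
    have "card (fibre ?T ?G' u) \<le> card (\<Union>p\<in>?K \<times> ?K. ?F (\<rho> p))" by (rule card_mono[OF fin cover])
    also have "\<dots> \<le> (\<Sum>p\<in>?K \<times> ?K. card (?F (\<rho> p)))" by (rule card_UN_le) simp
    also have "\<dots> \<le> (\<Sum>p\<in>?K \<times> ?K. M)" using one by (intro sum_mono) auto
    finally show ?thesis using finite_subset[OF cover fin] by simp
  qed
  have "finite_proj N P b' e' (S - {i})"
    unfolding finite_proj_def using d' fm fib by blast
  then show thesis using that i by blast
qed

lemma finite_proj_trivial:
  fixes P :: "('k::field, 'n::finite) laurent set"
  assumes "is_ideal P"
  shows "finite_proj N P (\<lambda>i. axis i 1) (\<lambda>i. axis i 1) UNIV"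
  unfolding finite_proj_def
proof (intro conjI exI allI)
  show "dual (\<lambda>i. axis i 1) (\<lambda>i. axis i 1)" by (rule dual_axis)
  show "finite_mod (supp_in (lat (\<lambda>i. axis i 1) UNIV)) {1} P"
    unfolding finite_mod_def
  proof (intro conjI allI)
    fix g :: "('k, 'n) laurent"
    show "\<exists>c. (\<forall>x\<in>{1}. c x \<in> supp_in (lat (\<lambda>i. axis i 1) UNIV)) \<and> g - (\<Sum>x\<in>{1}. c x * x) \<in> P"
      using ideal_0[OF assms] by (intro exI[of _ "\<lambda>_. g"]) simp
  qed simp
  fix u :: "real ^ 'n"
  have sub: "fibre (trop_set N P) (lat (\<lambda>i. axis i 1) UNIV) u \<subseteq> {u}"
    unfolding fibre_def lat_UNIV by (auto simp: vec_eq_iff simp flip: rdot_axis)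
  then show "finite (fibre (trop_set N P) (lat (\<lambda>i. axis i 1) UNIV) u)" using finite_subset by blast
  show "card (fibre (trop_set N P) (lat (\<lambda>i. axis i 1) UNIV) u) \<le> 1"
    using card_mono[OF _ sub] by simp
qed

lemma finite_proj_mono:
  assumes "finite_proj N P b e S" "P \<subseteq> P'"
  shows "finite_proj N P' b e S"
proof -
  have T: "trop_set N P' \<subseteq> trop_set N P" using assms(2) by (auto simp: trop_set_def)
  have sub: "fibre (trop_set N P') G u \<subseteq> fibre (trop_set N P) G u" for G u
    using T by (auto simp: fibre_def)
  obtain M where "\<And>u. finite (fibre (trop_set N P) (lat e S) u)"
    "\<And>u. card (fibre (trop_set N P) (lat e S) u) \<le> M" using assms(1) by (auto simp: finite_proj_def)
  then have "\<forall>u. finite (fibre (trop_set N P') (lat e S) u) \<and> card (fibre (trop_set N P') (lat e S) u) \<le> M"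
    using sub by (meson card_mono finite_subset order.trans)
  then show ?thesis using assms finite_mod_mono[of _ _ P _ P'] unfolding finite_proj_def by blast
qed

text \<open>The finite projection is dominant as well: no equation holds between the base monomials.\<close>

definition noether ::
  "('k::field \<Rightarrow> real) \<Rightarrow> ('k, 'n::finite) laurent set \<Rightarrow> ('n \<Rightarrow> int ^ 'n) \<Rightarrow> ('n \<Rightarrow> int ^ 'n) \<Rightarrow> 'n set \<Rightarrow> bool"
where
  "noether N P b e S \<longleftrightarrow> finite_proj N P b e S \<and> P \<inter> supp_in (lat e S) = {0}"

text \<open>Elimination is repeated as long as the base coordinates satisfy an equation.  That at least one
  step takes place when they do is what makes the rank drop along chains of primes.\<close>

lemma noether_exists:
  assumes P: "is_prime P" and "finite_proj N P b e S"
  shows "\<exists>b' e' S'. noether N P b' e' S' \<and> card S' \<le> card S \<and>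
     (P \<inter> supp_in (lat e S) \<noteq> {0} \<longrightarrow> card S' < card S)"
  using assms(2)
proof (induction "card S" arbitrary: b e S rule: less_induct)
  case less
  have 0: "0 \<in> P \<inter> supp_in (lat e S)"
    using ideal_0[OF prime_ideal[OF P]] subring_0[OF subring_lat] by blast
  show ?case
  proof (cases "P \<inter> supp_in (lat e S) = {0}")
    case True
    then show ?thesis using less.prems unfolding noether_def by blast
  next
    case False
    then obtain f where f: "f \<in> P" "f \<in> supp_in (lat e S)" "f \<noteq> 0" using 0 by blast
    obtain i b' e' where i: "i \<in> S" "finite_proj N P b' e' (S - {i})"
      using elimination_step[OF P less.prems f] .
    have "card (S - {i}) < card S" using i(1) by (intro psubset_card_mono) auto
    then show ?thesis using less.hyps[OF _ i(2)] by (meson less_imp_le order.strict_trans1)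
  qed
qed

section \<open>Polynomials over a subring\<close>

definition is_hom :: "('a::comm_ring_1 \<Rightarrow> 'b::comm_ring_1) \<Rightarrow> bool" where
  "is_hom \<phi> \<longleftrightarrow> \<phi> 0 = 0 \<and> \<phi> 1 = 1 \<and> (\<forall>x y. \<phi> (x + y) = \<phi> x + \<phi> y) \<and> (\<forall>x y. \<phi> (x * y) = \<phi> x * \<phi> y)"

lemma hom_lift: "lift_data c \<psi> \<Longrightarrow> is_hom (lift c \<psi>)"
  by (simp add: is_hom_def lift_0 lift_1 lift_add lift_mult)

lemma
  assumes "is_hom \<phi>"
  shows hom_0: "\<phi> 0 = 0" and hom_1: "\<phi> 1 = 1" and hom_add: "\<phi> (x + y) = \<phi> x + \<phi> y"
    and hom_mult: "\<phi> (x * y) = \<phi> x * \<phi> y"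
  using assms by (simp_all add: is_hom_def)

lemma hom_uminus: "is_hom \<phi> \<Longrightarrow> \<phi> (- x) = - \<phi> x"
  using hom_add[of \<phi> x "- x"] hom_0[of \<phi>] by (simp add: eq_neg_iff_add_eq_0 add.commute)

lemma hom_diff: "is_hom \<phi> \<Longrightarrow> \<phi> (x - y) = \<phi> x - \<phi> y"
  using hom_add[of \<phi> x "- y"] by (simp add: hom_uminus)

lemma hom_sum: "is_hom \<phi> \<Longrightarrow> \<phi> (sum f A) = (\<Sum>x\<in>A. \<phi> (f x))"
  by (induction A rule: infinite_finite_induct) (simp_all add: hom_0 hom_add)

lemma hom_power: "is_hom \<phi> \<Longrightarrow> \<phi> (x ^ n) = \<phi> x ^ n"
  by (induction n) (simp_all add: hom_1 hom_mult)

lemma prime_in_kernel: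
  fixes \<phi> :: "'a::comm_ring_1 \<Rightarrow> 'b::idom"
  assumes "is_hom \<phi>" "is_subring B"
  shows "prime_in B {g\<in>B. \<phi> g = 0}"
  using subring_0[OF assms(2)] subring_add[OF assms(2)] subring_mult[OF assms(2)]
  unfolding prime_in_def by (auto simp: hom_0[OF assms(1)] hom_1[OF assms(1)] hom_add[OF assms(1)] hom_mult[OF assms(1)])

lemma map_poly_mult_hom:
  "is_hom \<phi> \<Longrightarrow> map_poly \<phi> (F * G) = map_poly \<phi> F * map_poly \<phi> G"
  by (rule poly_eqI) (simp add: coeff_map_poly hom_0 coeff_mult hom_sum hom_mult)

lemma map_poly_add_hom:
  "is_hom \<phi> \<Longrightarrow> map_poly \<phi> (F + G) = map_poly \<phi> F + map_poly \<phi> G"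
  by (rule poly_eqI) (simp add: coeff_map_poly hom_0 hom_add)

lemma map_poly_smult_hom:
  "is_hom \<phi> \<Longrightarrow> map_poly \<phi> (Polynomial.smult c G) = Polynomial.smult (\<phi> c) (map_poly \<phi> G)"
  by (rule poly_eqI) (simp add: coeff_map_poly hom_0 hom_mult)

lemma poly_hom: "is_hom \<phi> \<Longrightarrow> \<phi> (poly F z) = poly (map_poly \<phi> F) (\<phi> z)"
  by (induction F) (simp_all add: hom_0 hom_add hom_mult map_poly_pCons)

definition polys_over :: "'a::comm_ring_1 set \<Rightarrow> 'a poly set" where
  "polys_over B = {F. \<forall>i. coeff F i \<in> B}"

lemma subring_polys_over:
  assumes B: "is_subring B"
  shows "is_subring (polys_over B)"
  unfolding is_subring_def
proof (intro conjI ballI)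
  show "1 \<in> polys_over B"
    using subring_0[OF B] subring_1[OF B] by (simp add: polys_over_def coeff_1)
  fix F G assume "F \<in> polys_over B" "G \<in> polys_over B"
  then show "F - G \<in> polys_over B" "F * G \<in> polys_over B"
    by (auto simp: polys_over_def intro: subring_diff[OF B] coeff_mult_subring[OF B])
qed

lemma smult_polys_over: "is_subring B \<Longrightarrow> c \<in> B \<Longrightarrow> F \<in> polys_over B \<Longrightarrow> Polynomial.smult c F \<in> polys_over B"
  by (auto simp: polys_over_def subring_mult)

lemma monom_polys_over: "is_subring B \<Longrightarrow> c \<in> B \<Longrightarrow> Polynomial.monom c n \<in> polys_over B"
  by (auto simp: polys_over_def coeff_monom subring_0)

lemma pseudo_division:
  fixes F :: "'a::comm_ring_1 poly"
  assumes B: "is_subring B" and F: "F \<in> polys_over B" and "G \<in> polys_over B"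
  shows "\<exists>n \<kappa> R. \<kappa> \<in> polys_over B \<and> R \<in> polys_over B \<and>
    Polynomial.smult (lead_coeff F ^ n) G = \<kappa> * F + R \<and> (R = 0 \<or> degree R < degree F)"
  using assms(3)
proof (induction "if G = 0 then 0 else Suc (degree G)" arbitrary: G rule: less_induct)
  case less
  note BP = subring_polys_over[OF B]
  have lc: "lead_coeff F \<in> B" "lead_coeff G \<in> B" using F less.prems by (auto simp: polys_over_def)
  show ?case
  proof (cases "G = 0 \<or> degree G < degree F")
    case True
    then show ?thesis using less.prems subring_0[OF BP]
      by (intro exI[of _ 0] exI[of _ G]) auto
  next
    case False
    define H where "H = Polynomial.monom (lead_coeff G) (degree G - degree F)"
    define G1 where "G1 = Polynomial.smult (lead_coeff F) G - H * F"
    have H: "H \<in> polys_over B" unfolding H_def using lc by (intro monom_polys_over[OF B])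
    have G1: "G1 \<in> polys_over B" unfolding G1_def
      using H lc F less.prems by (intro subring_diff[OF BP] subring_mult[OF BP] smult_polys_over[OF B])
    have "coeff G1 i = 0" if "i \<ge> degree G" for i
    proof (cases "i = degree G")
      case True
      then show ?thesis using False by (simp add: G1_def H_def coeff_monom_mult)
    next
      case ne: False
      then have "i > degree G" using that by simp
      moreover from this have "i - (degree G - degree F) > degree F" using False by auto
      ultimately show ?thesis by (simp add: G1_def H_def coeff_monom_mult coeff_eq_0)
    qed
    then have "G1 = 0 \<or> degree G1 < degree G"
      by (metis leading_coeff_0_iff not_le_imp_less)
    then have "(if G1 = 0 then 0 else Suc (degree G1)) < (if G = 0 then 0 else Suc (degree G))"
      using False by auto
    from less.hyps[OF this G1] obtain n \<kappa> R where *: "\<kappa> \<in> polys_over B" "R \<in> polys_over B"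
      "Polynomial.smult (lead_coeff F ^ n) G1 = \<kappa> * F + R" "R = 0 \<or> degree R < degree F" by blast
    have "Polynomial.smult (lead_coeff F ^ Suc n) G =
        Polynomial.smult (lead_coeff F ^ n) G1 + Polynomial.smult (lead_coeff F ^ n) H * F"
      by (simp add: G1_def smult_diff_right mult.commute)
    also have "\<dots> = (\<kappa> + Polynomial.smult (lead_coeff F ^ n) H) * F + R"
      using * by (simp add: algebra_simps)
    finally have eq: "Polynomial.smult (lead_coeff F ^ Suc n) G = (\<kappa> + Polynomial.smult (lead_coeff F ^ n) H) * F + R" .
    have "\<kappa> + Polynomial.smult (lead_coeff F ^ n) H \<in> polys_over B"
      using * H lc by (intro subring_add[OF BP] smult_polys_over[OF B] subring_power[OF B])
    then show ?thesis using eq * by blast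
  qed
qed

section \<open>Lifting points along finite projections\<close>

text \<open>Multiplication by a power of the monomial with exponent \<open>b j\<close>, a unit, clears its negative powers.\<close>

lemma slice_poly:
  fixes g :: "('k::field, 'n::finite) laurent"
  assumes d: "dual b e" and j: "j \<notin> T" and g: "g \<in> supp_in (lat e (insert j T))"
  obtains n F where "F \<in> polys_over (supp_in (lat e T))" "poly F (lmon (b j)) = lmon (int n *s b j) * g"
proof -
  let ?K = "Poly_Mapping.keys g"
  obtain A where A: "\<And>m. m \<in> ?K \<Longrightarrow> \<bar>idot (e j) m\<bar> < int A"
  proof -
    let ?s = "\<Sum>m\<in>?K. \<bar>idot (e j) m\<bar>"
    have "\<bar>idot (e j) m\<bar> \<le> ?s" if "m \<in> ?K" for m
      using that by (intro member_le_sum) auto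
    moreover have "0 \<le> ?s" by (intro sum_nonneg) auto
    ultimately show ?thesis using that[of "nat (1 + ?s)"] by force
  qed
  let ?z = "lmon (int A *s b j) :: ('k, 'n) laurent"
  have keys: "Poly_Mapping.keys (?z * g) \<subseteq> (\<lambda>m. int A *s b j + m) ` ?K"
    using keys_mult[of ?z g] by (auto simp: lmon_def)
  have bj: "b j \<in> lat e (insert j T)" using dual_in_lat[OF d] by simp
  have "int A *s b j \<in> lat e (insert j T)" using bj by (auto simp: lat_def idot_scale_right)
  then have zg: "?z * g \<in> supp_in (lat e (insert j T))"
    using g by (intro subring_mult subring_lat) auto
  have W: "0 \<le> idot (e j) m \<and> idot (e j) m < int (2 * A)" if "m \<in> Poly_Mapping.keys (?z * g)" for m
  proof -
    have "m \<in> (\<lambda>m. int A *s b j + m) ` ?K" using keys that by (rule subsetD)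
    then obtain m' where "m' \<in> ?K" "m = int A *s b j + m'" by (rule imageE)
    then show ?thesis using A[of m'] by (auto simp: idot_linear_right dualD(1)[OF d])
  qed
  have jT: "insert j T - {j} = T" using j by auto
  obtain c where c: "\<And>k. c k \<in> supp_in (lat e T)" "?z * g = (\<Sum>k<2*A. c k * lmon (int k *s b j))"
    using lat_slice_sum[OF d _ zg W] unfolding jT by blast
  define F where "F = (\<Sum>k<2*A. Polynomial.monom (c k) k)"
  have "F \<in> polys_over (supp_in (lat e T))"
    unfolding F_def using c by (intro subring_sum subring_polys_over monom_polys_over subring_lat)
  moreover have "poly F (lmon (b j)) = ?z * g"
    by (simp add: F_def poly_sum poly_monom c(2) lmon_power)
  ultimately show thesis using that by blast
qed

lemma hom_eval: "a \<in> torus \<Longrightarrow> is_hom (\<lambda>f. laurent_eval f a)"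
  unfolding laurent_eval_lift by (intro hom_lift lift_data_eval)

lemma eval_lmon: "a \<in> torus \<Longrightarrow> laurent_eval (lmon m) a = tmon a m"
  unfolding laurent_eval_lift by (intro lift_lmon lift_data_eval)

lemma eval_cong:
  assumes "f \<in> supp_in G" "\<And>m. m \<in> G \<Longrightarrow> tmon a m = tmon a' m"
  shows "laurent_eval f a = laurent_eval f a'"
  unfolding laurent_eval_lift lift_def using assms by (intro sum.cong) (auto simp: supp_in_def)

lemma tmon_translate_lat:
  assumes "m \<in> lat e T" "j \<notin> T" "t \<noteq> 0"
  shows "tmon (translate a (e j) t) m = tmon a m"
  using assms by (simp add: tmon_translate lat_def)

text \<open>A point of the base extends to one further coordinate, because the projection is finite.
  A prime \<open>Q\<close> over the kernel of the evaluation at \<open>a\<close> serves to find the new coordinate \<open>\<theta>\<close>: it is a root of an equation modulo \<open>Q\<close> whose image under the evaluation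
  has least degree, and pseudo-division shows that every other equation has this root.\<close>

lemma point_extension_step:
  fixes P :: "('k::field, 'n::finite) laurent set" and a :: "'k alg_closure ^ 'n"
  assumes a: "a \<in> torus" and d: "dual b e" and j: "j \<notin> T"
    and fin: "finite_mod (supp_in (lat e T)) E P" and P: "is_ideal P"
    and van: "\<And>g. g \<in> P \<Longrightarrow> g \<in> supp_in (lat e T) \<Longrightarrow> laurent_eval g a = 0"
  obtains t where "t \<noteq> 0"
    "\<And>g. g \<in> P \<Longrightarrow> g \<in> supp_in (lat e (insert j T)) \<Longrightarrow> laurent_eval g (translate a (e j) t) = 0"
proof -
  let ?B = "supp_in (lat e T) :: ('k, 'n) laurent set"
  let ?ev = "\<lambda>f :: ('k, 'n) laurent. laurent_eval f a"
  have B: "is_subring ?B" by simp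
  note BP = subring_polys_over[OF B]
  have ev: "is_hom ?ev" using a by (rule hom_eval)
  define \<mm> where "\<mm> = {g\<in>?B. ?ev g = 0}"
  have pm: "prime_in ?B \<mm>" unfolding \<mm>_def by (rule prime_in_kernel[OF ev B])
  have PB: "P \<inter> ?B \<subseteq> \<mm>" unfolding \<mm>_def using van by blast
  obtain Q where Q: "is_prime Q" "P \<subseteq> Q" "Q \<inter> ?B = \<mm>" using lying_over[OF B P fin pm PB] .
  note Qi = prime_ideal[OF Q(1)]
  have QB: "g \<in> Q \<longleftrightarrow> ?ev g = 0" if "g \<in> ?B" for g using Q(3) that unfolding \<mm>_def by blast
  define z where "z = (lmon (b j) :: ('k, 'n) laurent)"
  define evp where "evp F = map_poly ?ev F" for F
  have cevp: "coeff (evp F) i = ?ev (coeff F i)" for F i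
    unfolding evp_def by (simp add: coeff_map_poly hom_0[OF ev])
  let ?Q = "{F\<in>polys_over ?B. poly F z \<in> Q}"
  let ?S = "\<lambda>n. \<exists>F\<in>?Q. evp F \<noteq> 0 \<and> degree (evp F) = n"
  have "\<exists>n. ?S n"
  proof -
    obtain F where F: "lead_coeff F = 1" "\<And>i. coeff F i \<in> ?B" "poly F z \<in> P"
      using finite_mod_integral[OF B P fin] by blast
    have "coeff (evp F) (degree F) = 1" using F(1) by (simp add: cevp hom_1[OF ev])
    then have "evp F \<noteq> 0" by auto
    then show ?thesis using F Q(2) by (auto simp: polys_over_def)
  qed
  then obtain n where n: "?S n" and min: "\<And>k. k < n \<Longrightarrow> \<not> ?S k"
    using exists_least_iff[of ?S] by blast
  then obtain F0 where F0: "F0 \<in> polys_over ?B" "poly F0 z \<in> Q" "evp F0 \<noteq> 0" "degree (evp F0) = n" by blast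
  \<comment> \<open>the coefficients above the degree of the image lie in \<open>Q\<close> and may be dropped\<close>
  define F where "F = poly_cutoff (Suc n) F0"
  have cF: "coeff F i = (if i \<le> n then coeff F0 i else 0)" for i
    by (simp add: F_def coeff_poly_cutoff less_Suc_eq_le)
  have FB: "F \<in> polys_over ?B" using F0 subring_0[OF B] by (auto simp: polys_over_def cF)
  have evF: "evp F = evp F0"
  proof (rule poly_eqI)
    fix i
    show "coeff (evp F) i = coeff (evp F0) i"
    proof (cases "i \<le> n")
      case True then show ?thesis by (simp add: cevp cF)
    next
      case False
      then have "coeff (evp F0) i = 0" using F0(4) by (simp add: coeff_eq_0)
      then show ?thesis using False by (simp add: cevp[of F] cF hom_0[OF ev])
    qed
  qed
  have "poly (F0 - F) z \<in> Q"
    unfolding poly_altdef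
  proof (intro ideal_sum[OF Qi] ideal_mult2[OF Qi])
    fix i
    have "coeff (F0 - F) i \<in> ?B" using F0 FB by (auto simp: polys_over_def intro: subring_diff[OF B])
    moreover have "?ev (coeff (F0 - F) i) = 0"
      using evF by (simp add: hom_diff[OF ev] flip: cevp)
    ultimately show "coeff (F0 - F) i \<in> Q" using QB by blast
  qed
  then have FQ: "poly F z \<in> Q" using ideal_diff[OF Qi F0(2)] by force
  have lcn: "coeff (evp F) n \<noteq> 0" using F0 evF by auto
  then have "coeff F n \<noteq> 0" by (auto simp: cevp hom_0[OF ev])
  then have degF: "degree F = n"
    by (intro le_antisym) (auto intro!: degree_le le_degree simp: cF)
  have coB: "coeff F i \<in> ?B" for i using FB by (simp add: polys_over_def)
  have n0: "n \<noteq> 0"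
  proof
    assume "n = 0"
    then obtain f0 where f0: "F = [:f0:]" using degF degree_eq_zeroE by blast
    then show False using FQ lcn \<open>n = 0\<close> QB coB[of 0] by (simp add: cevp)
  qed
  have "degree (evp F) > 0" using evF F0 n0 by simp
  then obtain \<theta> where th: "poly (evp F) \<theta> = 0" using alg_closed_imp_poly_has_root by blast
  have th0: "\<theta> \<noteq> 0"
  proof
    assume "\<theta> = 0"
    obtain f0 F1 where F1: "F = pCons f0 F1" by (cases F)
    have "?ev f0 = 0" using th \<open>\<theta> = 0\<close> cevp[of F 0] F1 by (simp add: poly_0_coeff_0)
    then have "f0 \<in> Q" using QB coB[of 0] F1 by simp
    then have "z * poly F1 z \<in> Q" using FQ F1 ideal_diff[OF Qi, of "f0 + z * poly F1 z" f0] by simp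
    then have "poly F1 z \<in> Q" using prime_multD[OF Q(1)] lmon_not_in_prime[OF Q(1)] z_def by blast
    moreover have "F1 \<in> polys_over ?B" using FB F1 by (auto simp: polys_over_def) (metis coeff_pCons_Suc)
    moreover have c1: "coeff (evp F1) i = coeff (evp F) (Suc i)" for i by (simp add: cevp F1)
    have "evp F1 \<noteq> 0" using lcn n0 c1[of "n - 1"] by auto
    moreover have "degree (evp F1) < n"
    proof -
      have "degree (evp F1) \<le> n - 1"
        by (rule degree_le) (use F0(4) evF in \<open>auto simp: c1 coeff_eq_0\<close>)
      then show ?thesis using n0 by simp
    qed
    ultimately show False using min by blast
  qed
  have root: "poly (evp G) \<theta> = 0" if G: "G \<in> polys_over ?B" "poly G z \<in> Q" for G
  proof -
    obtain k \<kappa> R where *: "\<kappa> \<in> polys_over ?B" "R \<in> polys_over ?B"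
      "Polynomial.smult (lead_coeff F ^ k) G = \<kappa> * F + R" "R = 0 \<or> degree R < degree F"
      using pseudo_division[OF B FB G(1)] by blast
    have "poly R z = lead_coeff F ^ k * poly G z - poly \<kappa> z * poly F z"
      using arg_cong[OF *(3), of "\<lambda>p. poly p z"] by (simp add: algebra_simps)
    also have "\<dots> \<in> Q" using G FQ by (intro ideal_diff[OF Qi] ideal_mult[OF Qi])
    finally have "poly R z \<in> Q" .
    have "evp R = 0"
    proof (rule ccontr)
      assume ne: "evp R \<noteq> 0"
      then have "R \<noteq> 0" by (auto simp: evp_def)
      then have "degree R < n" using * degF by auto
      then have "degree (evp R) < n"
        using degree_le[of "degree R" "evp R"] by (simp add: cevp coeff_eq_0 hom_0[OF ev] le_less_trans)
      then show False using min ne *(2) \<open>poly R z \<in> Q\<close> by blast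
    qed
    have "Polynomial.smult (?ev (lead_coeff F) ^ k) (evp G) = evp \<kappa> * evp F + evp R"
      using arg_cong[OF *(3), of evp] unfolding evp_def
      by (simp add: map_poly_smult_hom[OF ev] map_poly_add_hom[OF ev] map_poly_mult_hom[OF ev] hom_power[OF ev])
    then have "?ev (lead_coeff F) ^ k * poly (evp G) \<theta> = 0"
      using \<open>evp R = 0\<close> th by (metis add.right_neutral mult_zero_right poly_mult poly_smult)
    moreover have "?ev (lead_coeff F) \<noteq> 0" using lcn degF by (simp add: cevp)
    ultimately show ?thesis by simp
  qed
  define t where "t = \<theta> / tmon a (b j)"
  have t: "t \<noteq> 0" using th0 tmon_nonzero[OF a] by (simp add: t_def)
  define a' where "a' = translate a (e j) t"
  have a': "a' \<in> torus" unfolding a'_def using a t by (rule translate_torus)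
  have ev': "is_hom (\<lambda>f :: ('k, 'n) laurent. laurent_eval f a')" using a' by (rule hom_eval)
  have zth: "laurent_eval z a' = \<theta>"
    unfolding z_def eval_lmon[OF a'] unfolding a'_def using t tmon_nonzero[OF a]
    by (simp add: tmon_translate dualD(1)[OF d] t_def)
  have "laurent_eval g a' = 0" if g: "g \<in> P" "g \<in> supp_in (lat e (insert j T))" for g
  proof -
    obtain k G where G: "G \<in> polys_over ?B" "poly G (lmon (b j)) = lmon (int k *s b j) * g"
      using slice_poly[OF d j g(2)] .
    have "poly G z \<in> Q" using G(2) g Q(2) ideal_mult[OF Qi] by (auto simp: z_def)
    then have "poly (evp G) \<theta> = 0" using root G(1) by blast
    moreover have "map_poly (\<lambda>f. laurent_eval f a') G = evp G"
    proof (rule poly_eqI)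
      fix i
      have "laurent_eval (coeff G i) a' = ?ev (coeff G i)"
        by (rule eval_cong[of _ "lat e T"])
           (use G(1) t j in \<open>auto simp: polys_over_def a'_def tmon_translate_lat\<close>)
      then show "coeff (map_poly (\<lambda>f. laurent_eval f a') G) i = coeff (evp G) i"
        by (simp add: cevp coeff_map_poly hom_0[OF ev'])
    qed
    ultimately have "laurent_eval (poly G z) a' = 0"
      using poly_hom[OF ev', of G z] zth by simp
    then have "tmon a' (int k *s b j) * laurent_eval g a' = 0"
      using G(2) hom_mult[OF ev'] eval_lmon[OF a'] by (simp add: z_def)
    then show ?thesis using tmon_nonzero[OF a'] by simp
  qed
  then show thesis using that t unfolding a'_def by blast
qed

lemma point_extension:
  fixes P :: "('k::field, 'n::finite) laurent set" and a :: "'k alg_closure ^ 'n"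
  assumes d: "dual b e" and P: "is_ideal P"
    and "a \<in> torus" "finite_mod (supp_in (lat e T)) E P"
    and "\<And>g. g \<in> P \<Longrightarrow> g \<in> supp_in (lat e T) \<Longrightarrow> laurent_eval g a = 0"
  shows "\<exists>a'\<in>torus. (\<forall>m\<in>lat e T. tmon a' m = tmon a m) \<and> (\<forall>g\<in>P. laurent_eval g a' = 0)"
  using assms(3-5)
proof (induction "card (- T)" arbitrary: T a)
  case 0
  then have "T = UNIV" by auto
  then show ?case using 0 by auto
next
  case (Suc k)
  then have "- T \<noteq> {}" by force
  then obtain j where j: "j \<notin> T" by blast
  obtain t where t: "t \<noteq> 0"
    "\<And>g. g \<in> P \<Longrightarrow> g \<in> supp_in (lat e (insert j T)) \<Longrightarrow> laurent_eval g (translate a (e j) t) = 0"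
    using point_extension_step[OF Suc.prems(1) d j Suc.prems(2) P Suc.prems(3)] by blast
  have "- insert j T = - T - {j}" by auto
  then have c: "k = card (- insert j T)" using Suc.hyps(2) j by simp
  have fm: "finite_mod (supp_in (lat e (insert j T))) E P"
    by (rule finite_mod_mono[OF Suc.prems(2)]) (auto intro!: supp_in_mono lat_mono)
  obtain a' where a': "a' \<in> torus" "\<forall>m\<in>lat e (insert j T). tmon a' m = tmon (translate a (e j) t) m"
    "\<forall>g\<in>P. laurent_eval g a' = 0"
    using Suc.hyps(1)[OF c translate_torus[OF Suc.prems(1) t(1)] fm t(2)] by blast
  have "tmon a' m = tmon a m" if "m \<in> lat e T" for m
  proof -
    have "m \<in> lat e (insert j T)" using that lat_mono[of T "insert j T" e] by blast
    then show ?thesis using a'(2) tmon_translate_lat[OF that j t(1), of a] by simp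
  qed
  then show ?case using a' by blast
qed

section \<open>Restriction to one-parameter curves\<close>

text \<open>The restriction of \<open>f\<close> to the curve \<open>t \<mapsto> translate a \<delta> t\<close>.  The factor \<open>t powi lo\<close> is split off to obtain
  a polynomial.\<close>

definition curve_poly ::
  "'k alg_closure ^ 'n::finite \<Rightarrow> int ^ 'n \<Rightarrow> int \<Rightarrow> ('k::field, 'n) laurent \<Rightarrow> 'k alg_closure poly" where
  "curve_poly a \<delta> lo f = (\<Sum>m\<in>Poly_Mapping.keys f.
     Polynomial.monom (to_ac (Poly_Mapping.lookup f m) * tmon a m) (nat (idot \<delta> m - lo)))"

lemma poly_curve_poly:
  assumes a: "a \<in> torus" and t: "t \<noteq> 0" and lo: "\<And>m. m \<in> Poly_Mapping.keys f \<Longrightarrow> lo \<le> idot \<delta> m"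
  shows "laurent_eval f (translate a \<delta> t) = t powi lo * poly (curve_poly a \<delta> lo f) t"
  unfolding curve_poly_def laurent_eval_lift lift_def poly_sum sum_distrib_left
proof (intro sum.cong refl)
  fix m assume "m \<in> Poly_Mapping.keys f"
  then have "t powi (idot \<delta> m) = t powi lo * t ^ nat (idot \<delta> m - lo)"
    using lo[of m] t by (simp flip: power_int_of_nat power_int_add)
  then show "to_ac (Poly_Mapping.lookup f m) * tmon (translate a \<delta> t) m =
      t powi lo * poly (Polynomial.monom (to_ac (Poly_Mapping.lookup f m) * tmon a m) (nat (idot \<delta> m - lo))) t"
    using t by (simp add: tmon_translate poly_monom algebra_simps)
qed

lemma coeff_curve_poly:
  assumes lo: "\<And>m. m \<in> Poly_Mapping.keys f \<Longrightarrow> lo \<le> idot \<delta> m"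
    and inj: "inj_on (idot \<delta>) (Poly_Mapping.keys f)"
  shows "m \<in> Poly_Mapping.keys f \<Longrightarrow>
      coeff (curve_poly a \<delta> lo f) (nat (idot \<delta> m - lo)) = to_ac (Poly_Mapping.lookup f m) * tmon a m"
    and "k \<notin> (\<lambda>m. nat (idot \<delta> m - lo)) ` Poly_Mapping.keys f \<Longrightarrow> coeff (curve_poly a \<delta> lo f) k = 0"
proof -
  show "k \<notin> (\<lambda>m. nat (idot \<delta> m - lo)) ` Poly_Mapping.keys f \<Longrightarrow> coeff (curve_poly a \<delta> lo f) k = 0"
    unfolding curve_poly_def coeff_sum by (intro sum.neutral) (auto simp: coeff_monom)
  assume m: "m \<in> Poly_Mapping.keys f"
  have "coeff (curve_poly a \<delta> lo f) (nat (idot \<delta> m - lo)) =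
     (\<Sum>m'\<in>Poly_Mapping.keys f. if m' = m then to_ac (Poly_Mapping.lookup f m) * tmon a m else 0)"
    unfolding curve_poly_def coeff_sum
  proof (intro sum.cong refl)
    fix m' assume m': "m' \<in> Poly_Mapping.keys f"
    have "nat (idot \<delta> m' - lo) = nat (idot \<delta> m - lo) \<longleftrightarrow> m' = m"
      using lo[OF m] lo[OF m'] inj m m' by (auto simp: inj_on_def)
    then show "coeff (Polynomial.monom (to_ac (Poly_Mapping.lookup f m') * tmon a m') (nat (idot \<delta> m' - lo)))
        (nat (idot \<delta> m - lo)) = (if m' = m then to_ac (Poly_Mapping.lookup f m) * tmon a m else 0)"
      by (auto simp: coeff_monom)
  qed
  then show "coeff (curve_poly a \<delta> lo f) (nat (idot \<delta> m - lo)) = to_ac (Poly_Mapping.lookup f m) * tmon a m"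
    using m by simp
qed

lemma infinite_alg_closure: "infinite (UNIV :: 'k::field alg_closure set)"
proof
  assume fin: "finite (UNIV :: 'k alg_closure set)"
  define p where "p = 1 + (\<Prod>x\<in>UNIV. [:- x, 1:] :: 'k alg_closure poly)"
  have "degree (\<Prod>x\<in>UNIV. [:- x, 1:] :: 'k alg_closure poly) = card (UNIV :: 'k alg_closure set)"
    by (subst degree_prod_sum_eq) auto
  moreover have "card (UNIV :: 'k alg_closure set) > 0" using fin by (simp add: card_gt_0_iff)
  ultimately have "degree p > 0" unfolding p_def by (subst degree_add_eq_right) auto
  then obtain x where "poly p x = 0" using alg_closed_imp_poly_has_root by blast
  moreover have "(\<Prod>y\<in>UNIV. poly [:- y, 1:] x) = 0" using fin by (intro prod_zero bexI[of _ x]) auto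
  ultimately show False by (simp add: p_def poly_prod)
qed

lemma poly_zero_off_0:
  fixes p :: "'k::field alg_closure poly"
  assumes "\<And>t. t \<noteq> 0 \<Longrightarrow> poly p t = 0"
  shows "p = 0"
proof (rule ccontr)
  assume "p \<noteq> 0"
  then have "finite {t. poly p t = 0}" by (rule poly_roots_finite)
  moreover have "UNIV - {0} \<subseteq> {t. poly p t = 0}" using assms by auto
  ultimately have "finite (UNIV - {0 :: 'k alg_closure})" using finite_subset by blast
  then show False using infinite_alg_closure[where 'k = 'k] by simp
qed

lemma inj_direction_exists:
  fixes K :: "(int ^ 'n::finite) set"
  assumes "finite K"
  obtains \<delta> where "inj_on (idot \<delta>) K"
  using generic_direction[OF dual_axis, of undefined UNIV K] assms by auto

lemma lower_degree_bound:
  obtains lo where "\<And>m. m \<in> Poly_Mapping.keys f \<Longrightarrow> lo \<le> idot \<delta> m"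
proof (cases "Poly_Mapping.keys f = {}")
  case True
  then show ?thesis using that[of 0] by auto
next
  case False
  then show ?thesis using that[of "Min (idot \<delta> ` Poly_Mapping.keys f)"] by auto
qed

lemma laurent_zero_if_vanishes:
  fixes f :: "('k::field, 'n::finite) laurent"
  assumes "\<And>a. a \<in> torus \<Longrightarrow> laurent_eval f a = 0"
  shows "f = 0"
proof -
  obtain \<delta> where inj: "inj_on (idot \<delta>) (Poly_Mapping.keys f)"
    using inj_direction_exists[of "Poly_Mapping.keys f"] by auto
  obtain lo where lo: "\<And>m. m \<in> Poly_Mapping.keys f \<Longrightarrow> lo \<le> idot \<delta> m" using lower_degree_bound by blast
  define a :: "'k alg_closure ^ 'n" where "a = (\<chi> i. 1)"
  have a: "a \<in> torus" by (simp add: a_def torus_def)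
  have "curve_poly a \<delta> lo f = 0"
  proof (rule poly_zero_off_0)
    fix t :: "'k alg_closure" assume t: "t \<noteq> 0"
    have "t powi lo * poly (curve_poly a \<delta> lo f) t = 0"
      using assms[OF translate_torus[OF a t, of \<delta>]] poly_curve_poly[OF a t lo] by simp
    then show "poly (curve_poly a \<delta> lo f) t = 0" using t by (simp add: power_int_eq_0_iff)
  qed
  then have "to_ac (Poly_Mapping.lookup f m) * tmon a m = 0" if "m \<in> Poly_Mapping.keys f" for m
    using coeff_curve_poly(1)[OF lo inj that, of a] by simp
  then have "Poly_Mapping.lookup f m = 0" for m
    using tmon_nonzero[OF a, of m] by (cases "m \<in> Poly_Mapping.keys f") (auto simp: in_keys_iff)
  then show ?thesis by (intro poly_mapping_eqI) simp
qed

text \<open>Integer powers of a unit \<open>u\<close> with inverse \<open>v\<close>, for rings such as the formal power series that are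
  not fields.\<close>

definition unit_powi :: "'r::comm_ring_1 \<Rightarrow> 'r \<Rightarrow> int \<Rightarrow> 'r" where
  "unit_powi u v k = u ^ nat k * v ^ nat (- k)"

lemma unit_powi_shift:
  fixes u v :: "'r::comm_ring_1"
  assumes "u * v = 1" "p + s = r + q"
  shows "u ^ p * v ^ q = u ^ r * v ^ s"
proof -
  have 1: "u ^ n * v ^ n = 1" for n using assms(1) by (simp flip: power_mult_distrib)
  have "u ^ p * v ^ q = (u ^ p * v ^ q) * (u ^ s * v ^ s)" by (simp add: 1)
  also have "\<dots> = u ^ (p + s) * v ^ q * v ^ s" by (simp add: power_add mult_ac)
  also have "\<dots> = (u ^ r * v ^ s) * (u ^ q * v ^ q)" unfolding assms(2) by (simp add: power_add mult_ac)
  finally show ?thesis by (simp add: 1)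
qed

lemma unit_powi_add:
  assumes "u * v = 1"
  shows "unit_powi u v (k + l) = unit_powi u v k * unit_powi u v l"
proof -
  have "unit_powi u v k * unit_powi u v l = u ^ (nat k + nat l) * v ^ (nat (- k) + nat (- l))"
    by (simp add: unit_powi_def power_add mult_ac)
  also have "\<dots> = u ^ nat (k + l) * v ^ nat (- (k + l))"
    using assms by (rule unit_powi_shift) linarith
  finally show ?thesis by (simp add: unit_powi_def)
qed

lemma unit_powi_unit: "u * v = 1 \<Longrightarrow> unit_powi u v k dvd 1"
  using unit_powi_add[of u v k "- k"] by (metis add.right_inverse dvd_triv_left mult.right_neutral
      nat_zero_as_int neg_equal_zero power_0 unit_powi_def)

text \<open>The germ at \<open>t = \<beta>\<close> of the curve through \<open>a\<close> in the direction \<open>\<delta>\<close>, as a homomorphism to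
  formal power series.  For \<open>\<beta> \<noteq> 0\<close> the parameter \<open>t\<close> is a unit there, as the monomials require, and
  Gauss's lemma applies over this ring.\<close>

definition germ ::
  "'k alg_closure ^ 'n::finite \<Rightarrow> int ^ 'n \<Rightarrow> 'k alg_closure \<Rightarrow> ('k::field, 'n) laurent \<Rightarrow> 'k alg_closure fps" where
  "germ a \<delta> \<beta> = lift (\<lambda>x. fps_const (to_ac x))
     (\<lambda>m. fps_const (tmon a m) *
        unit_powi (fps_of_poly [:\<beta>, 1:]) (inverse (fps_of_poly [:\<beta>, 1:])) (idot \<delta> m))"

lemma germ_unit: "\<beta> \<noteq> 0 \<Longrightarrow> fps_of_poly [:\<beta>, 1:] * inverse (fps_of_poly [:\<beta>, 1 :: 'c::field:]) = 1"
  by (intro inverse_mult_eq_1') simp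

lemma hom_germ:
  assumes "a \<in> torus" "\<beta> \<noteq> 0"
  shows "is_hom (germ a \<delta> \<beta>)"
  unfolding germ_def
  by (intro hom_lift)
     (use assms in \<open>simp add: lift_data_def tmon_add idot_add_right unit_powi_add[OF germ_unit] mult_ac
        fps_const_add[symmetric] fps_const_mult[symmetric] del: fps_const_add fps_const_mult\<close>,
      simp add: unit_powi_def)

lemma germ_curve_poly:
  assumes a: "a \<in> torus" and b: "\<beta> \<noteq> 0" and lo: "\<And>m. m \<in> Poly_Mapping.keys f \<Longrightarrow> lo \<le> idot \<delta> m"
  shows "germ a \<delta> \<beta> f =
    unit_powi (fps_of_poly [:\<beta>, 1:]) (inverse (fps_of_poly [:\<beta>, 1:])) lo *
    fps_of_poly (pcompose (curve_poly a \<delta> lo f) [:\<beta>, 1:])"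
  unfolding curve_poly_def germ_def lift_def pcompose_sum fps_of_poly_sum sum_distrib_left
proof (intro sum.cong refl)
  fix m assume "m \<in> Poly_Mapping.keys f"
  then have "lo \<le> idot \<delta> m" by (rule lo)
  then have "idot \<delta> m = lo + int (nat (idot \<delta> m - lo))" by simp
  let ?u = "fps_of_poly [:\<beta>, 1:]"
  have "unit_powi ?u (inverse ?u) (idot \<delta> m) =
      unit_powi ?u (inverse ?u) lo * unit_powi ?u (inverse ?u) (int (nat (idot \<delta> m - lo)))"
    using \<open>idot \<delta> m = _\<close> unit_powi_add[OF germ_unit[OF b]] by metis
  also have "unit_powi ?u (inverse ?u) (int k) = ?u ^ k" for k by (simp add: unit_powi_def)
  finally have 1: "unit_powi ?u (inverse ?u) (idot \<delta> m) = unit_powi ?u (inverse ?u) lo * ?u ^ nat (idot \<delta> m - lo)" .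
  have 2: "pcompose (Polynomial.monom c k) [:\<beta>, 1:] = Polynomial.smult c ([:\<beta>, 1:] ^ k)" for c :: "'a alg_closure" and k
  proof -
    have "pcompose ([:0, 1:] ^ k) [:\<beta>, 1:] = [:\<beta>, 1:] ^ k"
      by (induction k) (simp_all only: power_0 power_Suc pcompose_mult pcompose_1, simp add: pcompose_pCons)
    then show ?thesis by (simp add: monom_altdef pcompose_smult)
  qed
  show "fps_const (to_ac (Poly_Mapping.lookup f m)) * (fps_const (tmon a m) * unit_powi ?u (inverse ?u) (idot \<delta> m)) =
     unit_powi ?u (inverse ?u) lo * fps_of_poly (pcompose (Polynomial.monom (to_ac (Poly_Mapping.lookup f m) * tmon a m)
        (nat (idot \<delta> m - lo))) [:\<beta>, 1:])"
    unfolding 1 2 by (simp add: fps_of_poly_smult fps_of_poly_power mult_ac flip: fps_const_mult)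
qed

text \<open>The germs at a root \<open>\<beta>\<close> of \<open>p\<close> show that \<open>\<beta>\<close> is a root of \<open>q\<close>, and the common linear factor cancels.
  The roots are nonzero, so germs at the points of the torus suffice.\<close>

lemma dvd_if_germs_dvd:
  fixes p q :: "'c::alg_closed_field poly"
  assumes "p \<noteq> 0" "poly p 0 \<noteq> 0"
    and "\<And>\<beta>. \<beta> \<noteq> 0 \<Longrightarrow> fps_of_poly (pcompose p [:\<beta>, 1:]) dvd fps_of_poly (pcompose q [:\<beta>, 1:])"
  shows "p dvd q"
  using assms
proof (induction "degree p" arbitrary: p q)
  case 0
  then have "is_unit p" by (simp add: is_unit_iff_degree)
  then show ?case by (rule unit_imp_dvd)
next
  case (Suc k)
  then obtain \<beta> where \<beta>: "poly p \<beta> = 0" using alg_closed_imp_poly_has_root[of p] by auto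
  then have b0: "\<beta> \<noteq> 0" using Suc.prems by auto
  obtain p' where p': "p = [:- \<beta>, 1:] * p'" using \<beta> by (auto simp: poly_eq_0_iff_dvd)
  have "poly q \<beta> = 0"
  proof -
    obtain s where "fps_of_poly (pcompose q [:\<beta>, 1:]) = fps_of_poly (pcompose p [:\<beta>, 1:]) * s"
      using Suc.prems(3)[OF b0] by (auto elim: dvdE)
    then have "fps_nth (fps_of_poly (pcompose q [:\<beta>, 1:])) 0 = fps_nth (fps_of_poly (pcompose p [:\<beta>, 1:])) 0 * fps_nth s 0"
      by simp
    then show ?thesis using \<beta> by (simp add: poly_pcompose flip: poly_0_coeff_0)
  qed
  then obtain q' where q': "q = [:- \<beta>, 1:] * q'" by (auto simp: poly_eq_0_iff_dvd)
  have "p' \<noteq> 0" "poly p' 0 \<noteq> 0" using Suc.prems p' by auto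
  moreover have "k = degree p'" using Suc.hyps(2) \<open>p' \<noteq> 0\<close> degree_mult_eq[of "[:- \<beta>, 1:]" p'] unfolding p' by simp
  moreover have "fps_of_poly (pcompose p' [:\<gamma>, 1:]) dvd fps_of_poly (pcompose q' [:\<gamma>, 1:])" if "\<gamma> \<noteq> 0" for \<gamma>
  proof -
    let ?l = "pcompose [:- \<beta>, 1:] [:\<gamma>, 1:]"
    have "?l \<noteq> 0" by (simp add: pcompose_pCons)
    then have "fps_of_poly ?l \<noteq> 0" by simp
    moreover have "fps_of_poly ?l * fps_of_poly (pcompose p' [:\<gamma>, 1:]) dvd fps_of_poly ?l * fps_of_poly (pcompose q' [:\<gamma>, 1:])"
      using Suc.prems(3)[OF that] unfolding p' q' pcompose_mult fps_of_poly_mult .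
    ultimately show ?thesis by (simp only: dvd_mult_cancel_left) simp
  qed
  ultimately have "p' dvd q'" using Suc.hyps(1) by blast
  then show ?case unfolding p' q' by (rule mult_dvd_mono[OF dvd_refl])
qed

text \<open>Gauss's lemma: contents multiply and the monic \<open>h\<close> has content one, so the contents of \<open>\<kappa>\<close> and
  \<open>F\<close> multiply to the same power of the leading coefficient of \<open>F\<close> as the leading coefficients do.
  Hence each leading coefficient is the content up to a unit.\<close>

lemma gauss_lead_coeff_dvd:
  fixes F \<kappa> h :: "'d::{factorial_semiring, semiring_gcd, normalization_semidom_multiplicative, idom} poly"
  assumes eq: "Polynomial.smult (lead_coeff F ^ n) h = \<kappa> * F" and h: "lead_coeff h = 1" and F: "F \<noteq> 0"
  shows "lead_coeff F dvd coeff F i"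
proof -
  let ?c = "lead_coeff F"
  have c: "?c \<noteq> 0" using F by simp
  have "content h dvd 1" using content_dvd_coeff[of h "degree h"] h by simp
  then have ch: "content h = 1" by simp
  have "normalize (?c ^ n) = content \<kappa> * content F"
    using arg_cong[OF eq, of content] by (simp add: content_mult ch)
  moreover have lck: "?c ^ n = lead_coeff \<kappa> * ?c"
    using arg_cong[OF eq, of lead_coeff] h F by (simp add: lead_coeff_mult)
  moreover obtain x where x: "lead_coeff \<kappa> = content \<kappa> * x" using content_dvd_coeff by (rule dvdE)
  moreover obtain y where y: "?c = content F * y" using content_dvd_coeff by (rule dvdE)
  ultimately have "lead_coeff \<kappa> * ?c dvd content \<kappa> * content F"
    by (metis dvd_refl normalize_dvd_iff)
  then have "(content \<kappa> * content F) * (x * y) dvd (content \<kappa> * content F) * 1"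
    using x y by (metis mult.assoc mult.left_commute mult.right_neutral)
  moreover have "content \<kappa> * content F \<noteq> 0"
    using c lck x y by (metis mult_eq_0_iff power_not_zero)
  ultimately have "x * y dvd 1" by (subst (asm) dvd_mult_cancel_left) simp
  then have "y dvd 1" by (rule dvd_mult_right)
  then have "?c dvd content F" using y by (metis dvd_refl mult_unit_dvd_iff)
  then show ?thesis using content_dvd_coeff dvd_trans by blast
qed

lemma curve_poly_not_0:
  assumes a: "a \<in> torus" and ext: "extreme_terms \<delta> c mt mb" and inj: "inj_on (idot \<delta>) (Poly_Mapping.keys c)"
  shows "degree (curve_poly a \<delta> (idot \<delta> mb) c) = nat (idot \<delta> mt - idot \<delta> mb)"
    and "poly (curve_poly a \<delta> (idot \<delta> mb) c) 0 \<noteq> 0"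
proof -
  note e = extreme_terms_bounds[OF ext]
  let ?p = "curve_poly a \<delta> (idot \<delta> mb) c"
  have co: "coeff ?p (nat (idot \<delta> m - idot \<delta> mb)) \<noteq> 0" if "m \<in> Poly_Mapping.keys c" for m
    using coeff_curve_poly(1)[OF e(2) inj that] that tmon_nonzero[OF a] by (simp add: in_keys_iff)
  show "poly ?p 0 \<noteq> 0" using co[OF e(7)] by (simp add: poly_0_coeff_0)
  show "degree ?p = nat (idot \<delta> mt - idot \<delta> mb)"
  proof (rule antisym)
    show "nat (idot \<delta> mt - idot \<delta> mb) \<le> degree ?p" using co[OF e(6)] by (rule le_degree)
    show "degree ?p \<le> nat (idot \<delta> mt - idot \<delta> mb)"
    proof (rule degree_le, intro allI impI)
      fix i assume i: "nat (idot \<delta> mt - idot \<delta> mb) < i"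
      have "i \<notin> (\<lambda>m. nat (idot \<delta> m - idot \<delta> mb)) ` Poly_Mapping.keys c"
        using i e(1) by (force simp: nat_less_iff)
      then show "coeff ?p i = 0" by (intro coeff_curve_poly(2)[OF e(2) inj])
    qed
  qed
qed

text \<open>In a direction \<open>\<delta>\<close> that separates the exponents of \<open>c\<close> division with remainder is possible.  On every
  curve in this direction the remainder restricts to a multiple of \<open>c\<close> of smaller degree, that
  is to zero.\<close>

lemma laurent_dvd_if_germs_dvd:
  fixes c f :: "('k::field, 'n::finite) laurent"
  assumes c: "c \<noteq> 0" "c \<in> supp_in G" and f: "f \<in> supp_in G" and G: "lattice G"
    and inj: "inj_on (idot \<delta>) (Poly_Mapping.keys c)"
    and dvd: "\<And>a \<beta>. a \<in> torus \<Longrightarrow> \<beta> \<noteq> 0 \<Longrightarrow> germ a \<delta> \<beta> c dvd germ a \<delta> \<beta> f"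
  obtains q where "q \<in> supp_in G" "f = q * c"
proof -
  obtain mt mb where ext: "extreme_terms \<delta> c mt mb" using extreme_terms_exist[OF c(1) inj] .
  note e = extreme_terms_bounds[OF ext]
  obtain \<kappa> where k: "\<kappa> \<in> supp_in G"
    "\<And>m. m \<in> Poly_Mapping.keys (f - \<kappa> * c) \<Longrightarrow> 0 \<le> idot \<delta> m \<and> idot \<delta> m < 0 + (idot \<delta> mt - idot \<delta> mb)"
    using laurent_division[OF ext G c(2) f, where D = 0] by blast
  define \<rho> where "\<rho> = f - \<kappa> * c"
  have r0: "\<And>m. m \<in> Poly_Mapping.keys \<rho> \<Longrightarrow> 0 \<le> idot \<delta> m" using k(2) unfolding \<rho>_def by auto
  have "laurent_eval \<rho> a = 0" if a: "a \<in> torus" for a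
  proof -
    let ?p = "curve_poly a \<delta> (idot \<delta> mb) c" and ?q = "curve_poly a \<delta> 0 \<rho>"
    have p: "degree ?p = nat (idot \<delta> mt - idot \<delta> mb)" "poly ?p 0 \<noteq> 0"
      using curve_poly_not_0[OF a ext inj] by auto
    have "?p dvd ?q"
    proof (rule dvd_if_germs_dvd)
      show "?p \<noteq> 0" "poly ?p 0 \<noteq> 0" using p(2) by auto
      fix \<beta> :: "'k alg_closure" assume b: "\<beta> \<noteq> 0"
      note h = hom_germ[OF a b, of \<delta>]
      let ?U = "unit_powi (fps_of_poly [:\<beta>, 1:]) (inverse (fps_of_poly [:\<beta>, 1:]))"
      have "germ a \<delta> \<beta> c dvd germ a \<delta> \<beta> \<rho>"
        unfolding \<rho>_def hom_diff[OF h] hom_mult[OF h] using dvd[OF a b] by auto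
      then have "?U (idot \<delta> mb) * fps_of_poly (pcompose ?p [:\<beta>, 1:]) dvd ?U 0 * fps_of_poly (pcompose ?q [:\<beta>, 1:])"
        using germ_curve_poly[OF a b e(2)] germ_curve_poly[OF a b r0] by simp
      then show "fps_of_poly (pcompose ?p [:\<beta>, 1:]) dvd fps_of_poly (pcompose ?q [:\<beta>, 1:])"
        using unit_powi_unit[OF germ_unit[OF b]] by (metis dvd_mult_unit_iff' dvd_mult_right)
    qed
    moreover have "?q = 0 \<or> degree ?q < degree ?p"
    proof (cases "Poly_Mapping.keys \<rho> = {}")
      case True
      then show ?thesis by (simp add: curve_poly_def)
    next
      case False
      then have W: "idot \<delta> mt - idot \<delta> mb > 0" using k(2) unfolding \<rho>_def by fastforce
      have "degree ?q \<le> nat (idot \<delta> mt - idot \<delta> mb) - 1"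
        unfolding curve_poly_def
      proof (intro degree_sum_le)
        fix m assume "m \<in> Poly_Mapping.keys \<rho>"
        then have "idot \<delta> m < idot \<delta> mt - idot \<delta> mb" using k(2) unfolding \<rho>_def by auto
        then have "nat (idot \<delta> m - 0) \<le> nat (idot \<delta> mt - idot \<delta> mb) - 1" by linarith
        then show "degree (Polynomial.monom (to_ac (Poly_Mapping.lookup \<rho> m) * tmon a m) (nat (idot \<delta> m - 0)))
            \<le> nat (idot \<delta> mt - idot \<delta> mb) - 1"
          using degree_monom_le order.trans by blast
      qed simp
      then show ?thesis using p(1) W by linarith
    qed
    ultimately have "?q = 0" using dvd_imp_degree_le leD by blast
    moreover have "translate a \<delta> 1 = a" by (simp add: translate_def vec_eq_iff)
    ultimately show ?thesis using poly_curve_poly[OF a one_neq_zero r0] by simp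
  qed
  then have "\<rho> = 0" by (rule laurent_zero_if_vanishes)
  then show thesis using that k(1) unfolding \<rho>_def by simp
qed

section \<open>Hypersurface projections\<close>

text \<open>For one further coordinate \<open>z\<close> on a variety that is finite over the torus with character
  lattice \<open>lat e S\<close>, the ideal of relations between \<open>z\<close> and that torus is generated by a
  polynomial that is monic in \<open>z\<close>, because Laurent polynomial rings are normal: a relation of least
  degree divides a multiple of a monic one, so on every germ its leading coefficient divides
  all the others.\<close>

lemma monic_relation:
  fixes P :: "('k::field, 'n::finite) laurent set"
  assumes no: "noether N P b e S" and P: "is_prime P"
  obtains F where "F \<in> polys_over (supp_in (lat e S))" "lead_coeff F = 1" "poly F z \<in> P"
    "\<And>G. G \<in> polys_over (supp_in (lat e S)) \<Longrightarrow> poly G z \<in> P \<Longrightarrow> \<exists>\<kappa>. G = \<kappa> * F"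
proof -
  let ?B = "supp_in (lat e S) :: ('k, 'n) laurent set"
  have B: "is_subring ?B" by simp
  note BP = subring_polys_over[OF B]
  note Pi = prime_ideal[OF P]
  have d: "dual b e" and PB: "P \<inter> ?B = {0}" using no by (auto simp: noether_def finite_proj_def)
  obtain E where E: "finite_mod ?B E P" using no by (auto simp: noether_def finite_proj_def)
  let ?P = "{F\<in>polys_over ?B. poly F z \<in> P}"
  obtain h where h: "lead_coeff h = 1" "h \<in> ?P"
    using finite_mod_integral[OF B Pi E, of z] by (auto simp: polys_over_def)
  let ?S = "\<lambda>n. \<exists>F\<in>?P. F \<noteq> 0 \<and> degree F = n"
  have "?S (degree h)" using h by force
  then obtain n where n: "?S n" and min: "\<And>k. k < n \<Longrightarrow> \<not> ?S k"
    using exists_least_iff[of ?S] by blast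
  then obtain F where F: "F \<in> polys_over ?B" "poly F z \<in> P" "F \<noteq> 0" "degree F = n" by blast
  let ?c = "lead_coeff F"
  have cB: "coeff F i \<in> ?B" for i using F(1) by (simp add: polys_over_def)
  have c0: "?c \<noteq> 0" using F(3) by simp
  have cP: "?c \<notin> P" using c0 PB cB[of "degree F"] by blast
  have red: "\<exists>m \<kappa>. \<kappa> \<in> polys_over ?B \<and> Polynomial.smult (lead_coeff F' ^ m) G = \<kappa> * F'"
    if G: "G \<in> ?P" and F': "F' \<in> ?P" "degree F' = n" for G F'
  proof -
    obtain m \<kappa> R where *: "\<kappa> \<in> polys_over ?B" "R \<in> polys_over ?B"
      "Polynomial.smult (lead_coeff F' ^ m) G = \<kappa> * F' + R" "R = 0 \<or> degree R < degree F'"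
      using pseudo_division[OF B, of F' G] G F' by blast
    have "poly R z = lead_coeff F' ^ m * poly G z - poly \<kappa> z * poly F' z"
      using arg_cong[OF *(3), of "\<lambda>p. poly p z"] by (simp add: algebra_simps)
    also have "\<dots> \<in> P" using G F' by (intro ideal_diff[OF Pi] ideal_mult[OF Pi]) auto
    finally have "R = 0" using min * F' by blast
    then show ?thesis using * by auto
  qed
  obtain m \<kappa> where \<kappa>: "Polynomial.smult (?c ^ m) h = \<kappa> * F" using red[OF h(2)] F by blast
  obtain \<delta> where inj: "inj_on (idot \<delta>) (Poly_Mapping.keys ?c)"
    using inj_direction_exists[of "Poly_Mapping.keys ?c"] by auto
  have dvd: "germ a \<delta> \<beta> ?c dvd germ a \<delta> \<beta> (coeff F i)" if a: "a \<in> torus" and b: "\<beta> \<noteq> 0" for a \<beta> i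
  proof -
    let ?g = "germ a \<delta> \<beta>"
    note g = hom_germ[OF a b, of \<delta>]
    have cg: "coeff (map_poly ?g G) i = ?g (coeff G i)" for G i by (simp add: coeff_map_poly hom_0[OF g])
    obtain mt mb where ext: "extreme_terms \<delta> ?c mt mb" using extreme_terms_exist[OF c0 inj] .
    have "curve_poly a \<delta> (idot \<delta> mb) ?c \<noteq> 0" using curve_poly_not_0(2)[OF a ext inj] by auto
    then have "fps_of_poly (pcompose (curve_poly a \<delta> (idot \<delta> mb) ?c) [:\<beta>, 1:]) \<noteq> 0"
      by (simp add: pcompose_eq_0_iff)
    then have gc: "?g ?c \<noteq> 0"
      using germ_curve_poly[OF a b extreme_terms_bounds(2)[OF ext]] unit_powi_unit[OF germ_unit[OF b]]
      by (metis dvd_0_left mult_eq_0_iff zero_neq_one)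
    have deg: "degree (map_poly ?g F) = n"
      using gc F(4) by (intro antisym le_degree degree_le) (auto simp: cg coeff_eq_0 hom_0[OF g])
    have hg: "lead_coeff (map_poly ?g h) = 1"
    proof -
      have "degree (map_poly ?g h) = degree h"
        using h(1) by (intro antisym le_degree degree_le) (auto simp: cg coeff_eq_0 hom_0[OF g] hom_1[OF g])
      then show ?thesis using h(1) by (simp add: cg hom_1[OF g])
    qed
    have lcg: "lead_coeff (map_poly ?g F) = ?g ?c" using deg F(4) by (simp add: cg)
    have "map_poly ?g (Polynomial.smult (?c ^ m) h) = map_poly ?g (\<kappa> * F)" by (simp only: \<kappa>)
    then have "Polynomial.smult (lead_coeff (map_poly ?g F) ^ m) (map_poly ?g h) = map_poly ?g \<kappa> * map_poly ?g F"
      by (simp only: map_poly_smult_hom[OF g] map_poly_mult_hom[OF g] hom_power[OF g] lcg)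
    then have "lead_coeff (map_poly ?g F) dvd coeff (map_poly ?g F) i"
      by (rule gauss_lead_coeff_dvd[OF _ hg]) (use gc lcg in auto)
    then show ?thesis using lcg by (simp add: cg)
  qed
  have "\<exists>q. q \<in> ?B \<and> coeff F i = q * ?c" for i
    using laurent_dvd_if_germs_dvd[OF c0 cB cB lattice_lat inj dvd] by metis
  then obtain q where q: "\<And>i. q i \<in> ?B" "\<And>i. coeff F i = q i * ?c" by metis
  define F1 where "F1 = (\<Sum>i\<le>n. Polynomial.monom (q i) i)"
  have F1B: "F1 \<in> polys_over ?B" unfolding F1_def using q by (intro subring_sum[OF BP] monom_polys_over[OF B])
  have cF1: "coeff F1 i = (if i \<le> n then q i else 0)" for i
    by (simp add: F1_def coeff_sum coeff_monom)
  have "F = Polynomial.smult ?c F1"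
  proof (rule poly_eqI)
    fix i
    show "coeff F i = coeff (Polynomial.smult ?c F1) i"
    proof (cases "i \<le> n")
      case True
      then have "coeff (Polynomial.smult ?c F1) i = ?c * q i" by (simp add: cF1)
      then show ?thesis by (subst q(2)) (simp only: mult.commute)
    next
      case False
      then show ?thesis using F(4) by (simp add: cF1 coeff_eq_0)
    qed
  qed
  then have "?c * poly F1 z \<in> P" using F(2) by (metis poly_smult)
  then have F1P: "poly F1 z \<in> P" using prime_multD[OF P] cP by blast
  have "q n = 1"
  proof -
    have "?c = q n * ?c" using q(2)[of n] unfolding F(4) .
    then have "(q n - 1) * ?c = 0" by (simp only: left_diff_distrib) simp
    then have "(q n - 1) * ?c \<in> P" using ideal_0[OF Pi] by simp
    then have "q n - 1 \<in> P" using prime_multD[OF P] cP by blast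
    moreover have "q n - 1 \<in> ?B" using q(1) subring_1[OF B] by (intro subring_diff[OF B])
    ultimately have "q n - 1 = 0" using PB by blast
    then show ?thesis by simp
  qed
  then have d1: "degree F1 = n" "lead_coeff F1 = 1"
  proof -
    show "degree F1 = n"
      using \<open>q n = 1\<close> by (intro antisym le_degree degree_le) (auto simp: cF1)
    then show "lead_coeff F1 = 1" using \<open>q n = 1\<close> by (simp add: cF1)
  qed
  show thesis
  proof (rule that[OF F1B d1(2) F1P])
    fix G assume "G \<in> polys_over ?B" "poly G z \<in> P"
    then show "\<exists>\<kappa>. G = \<kappa> * F1" using red[of G F1] F1B F1P d1 by auto
  qed
qed

definition variety_points :: "('k::field, 'n::finite) laurent set \<Rightarrow> ('k alg_closure ^ 'n) set" where
  "variety_points P = {a\<in>torus. \<forall>g\<in>P. laurent_eval g a = 0}"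

text \<open>The monic relation \<open>f\<close> between one further monomial and the base implies all others, so a zero of \<open>f\<close>
  satisfies every equation of the variety in these monomials, and points extend along the remaining
  finite projection.\<close>

lemma hypersurface_projection:
  fixes P :: "('k::field, 'n::finite) laurent set"
  assumes no: "noether N P b e S" and P: "is_prime P" and j: "j \<notin> S"
  obtains f where "f \<in> P" "f \<noteq> 0" "f \<in> supp_in (lat e (insert j S))"
    "\<And>a. a \<in> torus \<Longrightarrow> laurent_eval f a = 0 \<Longrightarrow>
       \<exists>a'\<in>variety_points P. \<forall>m\<in>lat e (insert j S). tmon a' m = tmon a m"
proof -
  let ?B = "supp_in (lat e S) :: ('k, 'n) laurent set"
  let ?G = "lat e (insert j S)"
  let ?z = "lmon (b j) :: ('k, 'n) laurent"
  have d: "dual b e" using no by (auto simp: noether_def finite_proj_def)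
  obtain E where E: "finite_mod ?B E P" using no by (auto simp: noether_def finite_proj_def)
  obtain F where F: "F \<in> polys_over ?B" "lead_coeff F = 1" "poly F ?z \<in> P"
    "\<And>G. G \<in> polys_over ?B \<Longrightarrow> poly G ?z \<in> P \<Longrightarrow> \<exists>\<kappa>. G = \<kappa> * F"
    using monic_relation[OF no P, of ?z] by metis
  let ?f = "poly F ?z"
  have sub: "?B \<subseteq> supp_in ?G" by (intro supp_in_mono lat_mono) auto
  have "b j \<in> ?G" using dual_in_lat[OF d] by simp
  then have f: "?f \<in> supp_in ?G"
    using F(1) sub by (intro poly_in_subring subring_lat) (auto simp: polys_over_def)
  have "?f \<noteq> 0"
  proof
    assume f0: "?f = 0"
    \<comment> \<open>moving the point \<open>(1, \<dots>, 1)\<close> in the direction \<open>e j\<close> changes \<open>z\<close> but not the coefficients of \<open>F\<close>\<close>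
    define a :: "'k alg_closure ^ 'n" where "a = (\<chi> i. 1)"
    have a: "a \<in> torus" by (simp add: a_def torus_def)
    note ev = hom_eval[OF a]
    define p where "p = map_poly (\<lambda>f. laurent_eval f a) F"
    have cp: "coeff p i = laurent_eval (coeff F i) a" for i
      unfolding p_def by (simp add: coeff_map_poly hom_0[OF ev])
    have "poly p t = 0" if t: "t \<noteq> 0" for t
    proof -
      let ?a = "translate a (e j) (t / tmon a (b j))"
      have t': "t / tmon a (b j) \<noteq> 0" using t tmon_nonzero[OF a] by simp
      have a': "?a \<in> torus" using a t' by (rule translate_torus)
      note ev' = hom_eval[OF a']
      have "map_poly (\<lambda>f. laurent_eval f ?a) F = p"
      proof (rule poly_eqI)
        fix i
        have "laurent_eval (coeff F i) ?a = laurent_eval (coeff F i) a"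
          by (rule eval_cong[of _ "lat e S"])
             (use F(1) t' j in \<open>auto simp: polys_over_def tmon_translate_lat\<close>)
        then show "coeff (map_poly (\<lambda>f. laurent_eval f ?a) F) i = coeff p i"
          by (simp add: cp coeff_map_poly hom_0[OF ev'])
      qed
      moreover have "laurent_eval ?z ?a = t"
        unfolding eval_lmon[OF a'] using t' tmon_nonzero[OF a]
        by (simp add: tmon_translate dualD(1)[OF d])
      ultimately show ?thesis using poly_hom[OF ev', of F ?z] f0 hom_0[OF ev'] by simp
    qed
    then have "p = 0" by (rule poly_zero_off_0)
    moreover have "coeff p (degree F) = 1" using F(2) by (simp add: cp hom_1[OF ev])
    ultimately show False by simp
  qed
  moreover have "\<exists>a'\<in>variety_points P. \<forall>m\<in>?G. tmon a' m = tmon a m"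
    if a: "a \<in> torus" and fa: "laurent_eval ?f a = 0" for a
  proof -
    note ev = hom_eval[OF a]
    have van: "laurent_eval g a = 0" if g: "g \<in> P" "g \<in> supp_in ?G" for g
    proof -
      obtain k G where G: "G \<in> polys_over ?B" "poly G ?z = lmon (int k *s b j) * g"
        using slice_poly[OF d j g(2)] .
      have "poly G ?z \<in> P" using G(2) g ideal_mult[OF prime_ideal[OF P]] by auto
      then obtain \<kappa> where "G = \<kappa> * F" using F(4) G(1) by blast
      then have "laurent_eval (poly G ?z) a = 0" using fa by (simp add: hom_mult[OF ev])
      then show ?thesis unfolding G(2) hom_mult[OF ev] eval_lmon[OF a] using tmon_nonzero[OF a] by simp
    qed
    have "finite_mod (supp_in ?G) E P" by (rule finite_mod_mono[OF E sub]) simp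
    then show ?thesis
      using point_extension[OF d prime_ideal[OF P] a _ van] unfolding variety_points_def by blast
  qed
  ultimately show thesis using that F(3) f by blast
qed

section \<open>Non-archimedean norms and roots of polynomials\<close>

lemma
  assumes N: "nonarch_norm N"
  shows norm_nonneg: "N x \<ge> 0" and norm_eq_0: "N x = 0 \<longleftrightarrow> x = 0" and norm_mult: "N (x * y) = N x * N y"
    and norm_add: "N (x + y) \<le> max (N x) (N y)" and norm_one: "N 1 = 1" and norm_pos: "x \<noteq> 0 \<Longrightarrow> N x > 0"
    and norm_neg: "N (- x) = N x" and norm_diff: "N (x - y) \<le> max (N x) (N y)"
    and norm_zero: "N 0 = 0"
proof -
  show *: "N x \<ge> 0" "N x = 0 \<longleftrightarrow> x = 0" "N (x * y) = N x * N y" "N (x + y) \<le> max (N x) (N y)" for x y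
    using N by (auto simp: nonarch_norm_def)
  show "N 0 = 0" using *(2)[of 0] by simp
  show "x \<noteq> 0 \<Longrightarrow> N x > 0" using *(1,2)[of x] by linarith
  have n1: "N 1 = 1" using *(3)[of 1 1] *(2)[of 1] by simp
  then show "N 1 = 1" .
  have "N (- 1) ^ 2 = 1" using *(3)[of "-1" "-1"] n1 by (simp add: power2_eq_square)
  then have "N (- 1) = 1" using *(1)[of "-1"] by (simp add: power2_eq_1_iff)
  then show neg: "N (- x) = N x" for x using *(3)[of "-1" x] by simp
  show "N (x - y) \<le> max (N x) (N y)" using *(4)[of x "-y"] neg[of y] by simp
qed

lemma norm_power: "nonarch_norm N \<Longrightarrow> N (x ^ n) = N x ^ n"
  by (induction n) (simp_all add: norm_one norm_mult)

lemma norm_inverse: "nonarch_norm N \<Longrightarrow> N (inverse x) = inverse (N x)"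
  using norm_mult[of N x "inverse x"] norm_one[of N] norm_zero[of N]
  by (cases "x = 0") (auto simp: inverse_unique)

lemma norm_powi: "nonarch_norm N \<Longrightarrow> N (x powi k) = N x powi k"
  by (simp add: power_int_def norm_power norm_inverse)

lemma norm_prod: "nonarch_norm N \<Longrightarrow> N (prod f A) = (\<Prod>x\<in>A. N (f x))"
  by (induction A rule: infinite_finite_induct) (simp_all add: norm_one norm_mult)

text \<open>The Newton polygon argument for the slope zero: a polynomial without roots of norm one has a
  unique coefficient of largest norm, because multiplication by a linear factor \<open>t - \<alpha>\<close> with
  \<open>|\<alpha>| \<noteq> 1\<close> preserves this property.\<close>

definition dominated :: "('c::field \<Rightarrow> real) \<Rightarrow> 'c poly \<Rightarrow> nat \<Rightarrow> bool" where
  "dominated N p i \<longleftrightarrow> (\<forall>j. j \<noteq> i \<longrightarrow> N (coeff p j) < N (coeff p i))"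

lemma dominated_linear_mult:
  assumes N: "nonarch_norm N" and p: "dominated N p i" and \<alpha>: "N \<alpha> \<noteq> 1"
  shows "\<exists>k. dominated N ([:- \<alpha>, 1:] * p) k"
proof -
  define M where "M = N (coeff p i)"
  have lt: "N (coeff p j) < M" if "j \<noteq> i" for j using p that by (simp add: dominated_def M_def)
  have M: "M > 0" using lt[of "Suc i"] norm_nonneg[OF N, of "coeff p (Suc i)"] by simp
  have le: "N (coeff p j) \<le> M" for j using lt[of j] by (cases "j = i") (auto simp: M_def)
  let ?q = "[:- \<alpha>, 1:] * p"
  define s where "s j = (case j of 0 \<Rightarrow> 0 | Suc j \<Rightarrow> coeff p j)" for j
  have cq: "coeff ?q j = s j - \<alpha> * coeff p j" for j
    by (simp add: s_def coeff_pCons split: nat.split)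
  have sle: "N (s j) \<le> M" for j using M by (auto simp: s_def le norm_zero[OF N] split: nat.split)
  have slt: "N (s j) < M" if "j \<noteq> Suc i" for j using M that by (auto simp: s_def lt norm_zero[OF N] split: nat.split)
  consider "N \<alpha> < 1" | "N \<alpha> > 1" using \<alpha> by linarith
  then show ?thesis
  proof cases
    case 1
    have ac: "N (\<alpha> * coeff p j) < M" for j
    proof -
      have "N \<alpha> * N (coeff p j) \<le> N \<alpha> * M" using le norm_nonneg[OF N] by (intro mult_left_mono) auto
      also have "\<dots> < 1 * M" using 1 M by (intro mult_strict_right_mono) auto
      finally show ?thesis by (simp add: norm_mult[OF N])
    qed
    have "M \<le> N (coeff ?q (Suc i))"
    proof -
      have "M = N (coeff ?q (Suc i) + \<alpha> * coeff p (Suc i))" by (simp add: cq s_def M_def)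
      also have "\<dots> \<le> max (N (coeff ?q (Suc i))) (N (\<alpha> * coeff p (Suc i)))" by (rule norm_add[OF N])
      finally show ?thesis using ac[of "Suc i"] by linarith
    qed
    moreover have "N (coeff ?q j) < M" if "j \<noteq> Suc i" for j
      using norm_diff[OF N, of "s j" "\<alpha> * coeff p j"] slt[OF that] ac[of j] unfolding cq by linarith
    ultimately show ?thesis unfolding dominated_def by (intro exI[of _ "Suc i"]) force
  next
    case 2
    have M': "M < N \<alpha> * M" using 2 M by simp
    have "N \<alpha> * M \<le> N (coeff ?q i)"
    proof -
      have "s i - coeff ?q i = \<alpha> * coeff p i" unfolding cq by simp
      then have "N \<alpha> * M = N (s i - coeff ?q i)" by (simp only: norm_mult[OF N] M_def)
      also have "\<dots> \<le> max (N (s i)) (N (coeff ?q i))" by (rule norm_diff[OF N])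
      finally show ?thesis using sle[of i] M' by linarith
    qed
    moreover have "N (coeff ?q j) < N \<alpha> * M" if "j \<noteq> i" for j
    proof -
      have "N (\<alpha> * coeff p j) < N \<alpha> * M"
        unfolding norm_mult[OF N] using lt[OF that] 2 by (intro mult_strict_left_mono) auto
      then show ?thesis
        using norm_diff[OF N, of "s j" "\<alpha> * coeff p j"] sle[of j] M' unfolding cq by linarith
    qed
    ultimately show ?thesis unfolding dominated_def by (intro exI[of _ i]) force
  qed
qed

lemma root_of_norm_1:
  fixes p :: "'c::alg_closed_field poly"
  assumes N: "nonarch_norm N" and "coeff p i \<noteq> 0" and "i \<noteq> j"
    and eq: "N (coeff p j) = N (coeff p i)" and max: "\<And>k. N (coeff p k) \<le> N (coeff p i)"
  shows "\<exists>t. poly p t = 0 \<and> N t = 1"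
proof (rule ccontr)
  assume "\<not> ?thesis"
  moreover have "p \<noteq> 0" using assms(2) by auto
  ultimately have "\<exists>k. dominated N p k"
  proof (induction "degree p" arbitrary: p)
    case 0
    then obtain c where "p = [:c:]" "c \<noteq> 0" by (auto elim: degree_eq_zeroE)
    then have "dominated N p 0"
      using norm_pos[OF N] by (auto simp: dominated_def coeff_pCons norm_zero[OF N] split: nat.splits)
    then show ?case by blast
  next
    case (Suc n)
    obtain \<alpha> where \<alpha>: "poly p \<alpha> = 0" using alg_closed_imp_poly_has_root[of p] Suc.hyps by auto
    then obtain q where q: "p = [:- \<alpha>, 1:] * q" by (auto simp: poly_eq_0_iff_dvd)
    have "q \<noteq> 0" using Suc.prems q by auto
    moreover have "n = degree q" using Suc.hyps(2) \<open>q \<noteq> 0\<close> degree_mult_eq[of "[:- \<alpha>, 1:]" q] unfolding q by simp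
    moreover have "\<not> (\<exists>t. poly q t = 0 \<and> N t = 1)" using Suc.prems(1) q by auto
    ultimately obtain k where "dominated N q k" using Suc.hyps(1) by blast
    moreover have "N \<alpha> \<noteq> 1" using Suc.prems(1) \<alpha> by auto
    ultimately show ?case using dominated_linear_mult[OF N] q by blast
  qed
  then obtain k where k: "dominated N p k" by blast
  have "k = i" using max[of k] k unfolding dominated_def by (metis not_less)
  then show False using k eq assms(3) unfolding dominated_def by (metis less_irrefl)
qed

section \<open>Kapranov's theorem for hypersurfaces\<close>

lemma exp_ln_powi: "x > 0 \<Longrightarrow> x powi k = exp (of_int k * ln (x::real))"
proof (cases "k \<ge> 0")
  case True
  then show "x > 0 \<Longrightarrow> x powi k = exp (of_int k * ln x)"
    using exp_of_nat_mult[of "nat k" "ln x"] by (simp add: power_int_def)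
next
  case False
  then show "x > 0 \<Longrightarrow> x powi k = exp (of_int k * ln x)"
    using exp_of_nat_mult[of "nat (- k)" "ln x"]
    by (simp add: power_int_def exp_minus power_inverse) (metis inverse_inverse_eq)
qed

lemma norm_tmon:
  assumes N: "nonarch_norm N'" and a: "a \<in> torus"
  shows "N' (tmon a m) = exp (- rdot m (val_map N' a))"
proof -
  have "N' (tmon a m) = (\<Prod>i\<in>UNIV. exp (of_int (m $ i) * ln (N' (a $ i))))"
    unfolding tmon_def norm_prod[OF N] norm_powi[OF N]
    using a norm_pos[OF N] by (intro prod.cong) (auto simp: torus_def exp_ln_powi)
  also have "\<dots> = exp (\<Sum>i\<in>UNIV. of_int (m $ i) * ln (N' (a $ i)))" by (simp add: exp_sum)
  also have "(\<Sum>i\<in>UNIV. of_int (m $ i) * ln (N' (a $ i))) = - rdot m (val_map N' a)"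
    by (simp add: rdot_def val_map_def sum_negf)
  finally show ?thesis .
qed

text \<open>Kapranov's theorem.  Moving the point \<open>a\<close> along a one-parameter curve by a parameter \<open>t\<close> of norm one
  does not change its valuation.  In a direction that separates the exponents the coefficients of \<open>f\<close>
  on the curve are the terms of \<open>f\<close> at \<open>a\<close>.  Two of them have the largest norm, so the restriction
  has a root of norm one.\<close>

lemma kapranov_hypersurface:
  fixes f :: "('k::field, 'n::finite) laurent"
  assumes N: "nonarch_norm N" and N': "nonarch_norm N'" and ext: "\<And>x. N' (to_ac x) = N x"
    and a: "a \<in> torus" and u: "val_map N' a \<in> trop N f"
  shows "\<exists>a'\<in>torus. val_map N' a' = val_map N' a \<and> laurent_eval f a' = 0"
proof (cases "f = 0")
  case True
  then show ?thesis using a by (intro bexI[of _ a]) (auto simp: laurent_eval_def)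
next
  case False
  let ?u = "val_map N' a" and ?K = "Poly_Mapping.keys f"
  obtain m1 m2 where m: "m1 \<in> ?K" "m2 \<in> ?K" "m1 \<noteq> m2" "wt N f m1 ?u = wt N f m2 ?u"
    "\<And>m. m \<in> ?K \<Longrightarrow> wt N f m1 ?u \<le> wt N f m ?u" using u False by (auto simp: trop_def)
  obtain \<delta> where inj: "inj_on (idot \<delta>) ?K" using inj_direction_exists[of ?K] by auto
  obtain lo where lo: "\<And>m. m \<in> ?K \<Longrightarrow> lo \<le> idot \<delta> m" using lower_degree_bound by blast
  let ?p = "curve_poly a \<delta> lo f" and ?d = "\<lambda>m. nat (idot \<delta> m - lo)"
  have nc: "N' (coeff ?p (?d m)) = exp (- wt N f m ?u)" if "m \<in> ?K" for m
  proof -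
    have "N (Poly_Mapping.lookup f m) > 0" using that norm_pos[OF N] by (simp add: in_keys_iff)
    moreover have "N' (coeff ?p (?d m)) = N (Poly_Mapping.lookup f m) * exp (- rdot m ?u)"
      using coeff_curve_poly(1)[OF lo inj that, of a] by (simp add: norm_mult[OF N'] ext norm_tmon[OF N' a])
    ultimately show ?thesis
      by (simp add: wt_def exp_diff exp_minus divide_inverse)
  qed
  have "\<exists>t. poly ?p t = 0 \<and> N' t = 1"
  proof (rule root_of_norm_1[OF N'])
    show "coeff ?p (?d m1) \<noteq> 0" using nc[OF m(1)] norm_zero[OF N'] by force
    show "?d m1 \<noteq> ?d m2" using lo[OF m(1)] lo[OF m(2)] inj m by (auto simp: inj_on_def)
    show "N' (coeff ?p (?d m2)) = N' (coeff ?p (?d m1))" using nc m by simp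
    fix k
    show "N' (coeff ?p k) \<le> N' (coeff ?p (?d m1))"
    proof (cases "k \<in> ?d ` ?K")
      case True
      then show ?thesis using nc m by auto
    next
      case False
      then show ?thesis using coeff_curve_poly(2)[OF lo inj False] norm_zero[OF N'] norm_nonneg[OF N'] by simp
    qed
  qed
  then obtain t where t: "poly ?p t = 0" "N' t = 1" by blast
  have t0: "t \<noteq> 0" using t(2) norm_zero[OF N'] by auto
  have "val_map N' (translate a \<delta> t) = ?u"
    using t by (simp add: val_map_def translate_def norm_mult[OF N'] norm_powi[OF N'])
  moreover have "laurent_eval f (translate a \<delta> t) = 0"
    using poly_curve_poly[OF a t0 lo] t by simp
  ultimately show ?thesis using translate_torus[OF a t0] by blast
qed

section \<open>Multiplicative seminorms on the Laurent polynomial ring\<close>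

text \<open>The multiplicative counterparts \<open>exp (- w)\<close> of the ring valuations \<open>w\<close> that extend the one on the field.
  Valuations of the coordinate ring correspond to seminorms that vanish on the ideal, and the
  value \<open>\<infinity>\<close> becomes \<open>0\<close>.\<close>

definition laurent_seminorm :: "('k::field \<Rightarrow> real) \<Rightarrow> (('k, 'n::finite) laurent \<Rightarrow> real) \<Rightarrow> bool" where
  "laurent_seminorm N \<phi> \<longleftrightarrow> (\<forall>f. \<phi> f \<ge> 0) \<and> (\<forall>f g. \<phi> (f * g) = \<phi> f * \<phi> g) \<and>
     (\<forall>f g. \<phi> (f + g) \<le> max (\<phi> f) (\<phi> g)) \<and> (\<forall>c. \<phi> (Poly_Mapping.single 0 c) = N c)"

definition seminorm_set :: "('k::field \<Rightarrow> real) \<Rightarrow> ('k, 'n::finite) laurent set \<Rightarrow> (real ^ 'n) set" where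
  "seminorm_set N P = {u. \<exists>\<phi>. laurent_seminorm N \<phi> \<and> (\<forall>f\<in>P. \<phi> f = 0) \<and>
     (\<forall>i. \<phi> (lmon (axis i 1)) = exp (- u $ i))}"

lemma seminorm_point:
  fixes P :: "('k::field, 'n::finite) laurent set"
  assumes N': "nonarch_norm N'" and ext: "\<And>x. N' (to_ac x) = N x" and a: "a \<in> variety_points P"
  shows "val_map N' a \<in> seminorm_set N P"
proof -
  have t: "a \<in> torus" using a by (simp add: variety_points_def)
  note ev = hom_eval[OF t]
  let ?\<phi> = "\<lambda>f. N' (laurent_eval f a)"
  have "laurent_eval (Poly_Mapping.single 0 c) a = to_ac c" for c
    unfolding laurent_eval_lift lift_single[OF lift_data_eval[OF t]] by simp
  then have "laurent_seminorm N ?\<phi>"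
    unfolding laurent_seminorm_def
    by (simp add: hom_mult[OF ev] hom_add[OF ev] norm_nonneg[OF N'] norm_mult[OF N'] norm_add[OF N'] ext)
  moreover have "\<forall>f\<in>P. ?\<phi> f = 0" using a norm_zero[OF N'] by (simp add: variety_points_def)
  moreover have "?\<phi> (lmon (axis i 1)) = exp (- val_map N' a $ i)" for i
    by (simp add: eval_lmon[OF t] norm_tmon[OF N' t] rdot_axis)
  ultimately show ?thesis unfolding seminorm_set_def by blast
qed

lemma
  assumes \<phi>: "laurent_seminorm N \<phi>"
  shows seminorm_nonneg: "\<phi> f \<ge> 0" and seminorm_mult: "\<phi> (f * g) = \<phi> f * \<phi> g"
    and seminorm_add: "\<phi> (f + g) \<le> max (\<phi> f) (\<phi> g)" and seminorm_const: "\<phi> (Poly_Mapping.single 0 c) = N c"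
  using assms by (simp_all add: laurent_seminorm_def)

lemma seminorm_sum:
  assumes N: "nonarch_norm N" and \<phi>: "laurent_seminorm N \<phi>" and "finite A" "B > 0" "\<And>x. x \<in> A \<Longrightarrow> \<phi> (F x) < B"
  shows "\<phi> (sum F A) < B"
  using assms(3,5)
proof (induction A rule: finite_induct)
  case empty
  have "\<phi> 0 = 0" using seminorm_const[OF \<phi>, of 0] norm_zero[OF N] by simp
  then show ?case using \<open>B > 0\<close> by simp
next
  case (insert x A)
  then have "\<phi> (F x) < B" "\<phi> (sum F A) < B" by auto
  then have "\<phi> (F x + sum F A) < B" using seminorm_add[OF \<phi>, of "F x" "sum F A"] by linarith
  then show ?case using insert.hyps by simp
qed

lemma seminorm_lmon:
  fixes \<phi> :: "('k::field, 'n::finite) laurent \<Rightarrow> real"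
  assumes N: "nonarch_norm N" and \<phi>: "laurent_seminorm N \<phi>"
    and u: "\<And>i. \<phi> (lmon (axis i 1)) = exp (- u $ i)"
  shows "\<phi> (lmon m) = exp (- rdot m u)"
proof -
  have one: "\<phi> 1 = 1" using seminorm_const[OF \<phi>, of 1] norm_one[OF N] by simp
  have inv: "\<phi> (lmon (- m)) = inverse (\<phi> (lmon m))" for m
    using one seminorm_mult[OF \<phi>, of "lmon m" "lmon (- m)"] by (simp add: lmon_inverse inverse_unique)
  have nat: "\<phi> (lmon (int n *s m)) = \<phi> (lmon m) ^ n" for n m
    unfolding lmon_power[symmetric] by (induction n) (simp_all add: one seminorm_mult[OF \<phi>])
  have ax: "\<phi> (lmon (k *s axis i 1)) = exp (- (of_int k * u $ i))" for k i
  proof (cases "k \<ge> 0")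
    case True
    then show ?thesis using nat[of "nat k" "axis i 1"] u[of i] by (simp flip: exp_of_nat_mult)
  next
    case False
    have "k *s axis i 1 = - (int (nat (- k)) *s axis i 1 :: int^'n)" using False by (simp add: vec_eq_iff)
    then have "\<phi> (lmon (k *s axis i 1)) = inverse (\<phi> (lmon (axis i 1)) ^ nat (- k))" by (simp only: inv nat)
    then show ?thesis using False u[of i] by (simp flip: exp_of_nat_mult exp_minus)
  qed
  have sum: "\<phi> (lmon (\<Sum>i\<in>A. m $ i *s axis i 1)) = exp (- (\<Sum>i\<in>A. of_int (m $ i) * u $ i))" for A
    by (induction A rule: infinite_finite_induct) (simp_all add: one lmon_add seminorm_mult[OF \<phi>] ax exp_add exp_minus exp_diff field_simps)
  have "m = (\<Sum>i\<in>UNIV. m $ i *s axis i 1)"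
    using dualD(2)[OF dual_axis, of m] by (simp add: idot_axis)
  then show ?thesis using sum[of UNIV] by (simp add: rdot_def)
qed

text \<open>If the minimum were attained only once, the seminorm of \<open>f\<close> would be that of its dominant term.\<close>

lemma seminorm_set_subset_trop:
  assumes N: "nonarch_norm N"
  shows "seminorm_set N P \<subseteq> trop_set N P"
proof
  fix u assume "u \<in> seminorm_set N P"
  then obtain \<phi> where \<phi>: "laurent_seminorm N \<phi>" "\<forall>f\<in>P. \<phi> f = 0"
    "\<And>i. \<phi> (lmon (axis i 1)) = exp (- u $ i)" unfolding seminorm_set_def by blast
  have "u \<in> trop N f" if "f \<in> P" for f
  proof (cases "f = 0")
    case True then show ?thesis by (simp add: trop_def)
  next
    case False
    let ?K = "Poly_Mapping.keys f" and ?T = "\<lambda>m. Poly_Mapping.single m (Poly_Mapping.lookup f m)"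
    have T: "\<phi> (?T m) = exp (- wt N f m u)" if "m \<in> ?K" for m
    proof -
      have "N (Poly_Mapping.lookup f m) > 0" using that norm_pos[OF N] by (simp add: in_keys_iff)
      moreover have "?T m = Poly_Mapping.single 0 (Poly_Mapping.lookup f m) * lmon m" by (simp add: lmon_def mult_single)
      ultimately show ?thesis
        by (simp add: seminorm_mult[OF \<phi>(1)] seminorm_const[OF \<phi>(1)] seminorm_lmon[OF N \<phi>(1,3)]
            wt_def exp_add exp_diff exp_minus divide_inverse)
    qed
    have K: "finite ?K" "?K \<noteq> {}" using False by auto
    obtain m1 where m1: "m1 \<in> ?K" "\<And>m. m \<in> ?K \<Longrightarrow> wt N f m1 u \<le> wt N f m u"
      using ex_min_if_finite[of "(\<lambda>m. wt N f m u) ` ?K"] K by (auto simp: not_less)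
    show ?thesis
    proof (rule ccontr)
      assume neg: "u \<notin> trop N f"
      have lt: "wt N f m1 u < wt N f m u" if "m \<in> ?K" "m \<noteq> m1" for m
      proof (rule ccontr)
        assume "\<not> ?thesis"
        then have "wt N f m1 u = wt N f m u" using m1(2)[OF that(1)] by simp
        then have "u \<in> trop N f"
          unfolding trop_def mem_Collect_eq using m1 that
          by (intro disjI2 bexI[of _ m1] bexI[of _ m] conjI ballI) auto
        then show False using neg by simp
      qed
      have "\<phi> (sum ?T (?K - {m1})) < exp (- wt N f m1 u)"
        by (rule seminorm_sum[OF N \<phi>(1)]) (use T lt in auto)
      moreover have "?T m1 = f + Poly_Mapping.single 0 (-1) * sum ?T (?K - {m1})"
      proof -
        have e: "f = ?T m1 + sum ?T (?K - {m1})"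
        proof -
          have "sum ?T ?K = f" by (rule laurent_expand[OF K(1) order_refl, symmetric])
          then show ?thesis using sum.remove[OF K(1) m1(1), of ?T] by simp
        qed
        have "?T m1 = f - sum ?T (?K - {m1})" unfolding eq_diff_eq by (rule e[symmetric])
        moreover have "Poly_Mapping.single 0 (-1) = (- 1 :: ('a, 'b) laurent)" by (simp add: single_uminus)
        ultimately show ?thesis by simp
      qed
      moreover have "N (- 1) = 1" using norm_neg[OF N, of 1] norm_one[OF N] by simp
      ultimately have "\<phi> (?T m1) < exp (- wt N f m1 u)"
        using seminorm_add[OF \<phi>(1), of f "Poly_Mapping.single 0 (-1) * sum ?T (?K - {m1})"] \<phi>(2) \<open>f \<in> P\<close>
        exp_gt_zero[of "- wt N f m1 u"]
        by (simp add: seminorm_mult[OF \<phi>(1)] seminorm_const[OF \<phi>(1)] del: exp_gt_zero)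
      then show False using T[OF m1(1)] by simp
    qed
  qed
  then show "u \<in> trop_set N P" by (simp add: trop_set_def)
qed

text \<open>The seminorms with coordinates in a box form a closed subset of a product of compact intervals,
  since the value at \<open>f\<close> is bounded in terms of the coordinates; Tychonoff's theorem applies.\<close>

lemma compact_seminorm_set_box:
  fixes P :: "('k::field, 'n::finite) laurent set"
  assumes N: "nonarch_norm N"
  shows "compact (seminorm_set N P \<inter> {u. \<forall>i. \<bar>u $ i\<bar> \<le> R})"
proof -
  define C :: "('k, 'n) laurent \<Rightarrow> real" where
    "C f = 1 + (\<Sum>m\<in>Poly_Mapping.keys f. N (Poly_Mapping.lookup f m) * exp (\<Sum>i\<in>UNIV. \<bar>of_int (m $ i)\<bar> * R))" for f
  define X where "X = {\<phi> :: ('k, 'n) laurent \<Rightarrow> real. laurent_seminorm N \<phi> \<and> (\<forall>f. f \<in> P \<longrightarrow> \<phi> f = 0) \<and>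
     (\<forall>i. exp (- R) \<le> \<phi> (lmon (axis i 1)) \<and> \<phi> (lmon (axis i 1)) \<le> exp R)}"
  have closed: "closed X"
    unfolding X_def laurent_seminorm_def
    by (intro closed_Collect_conj closed_Collect_all closed_Collect_le closed_Collect_eq closed_Collect_imp
        open_Collect_const continuous_intros) auto
  let ?L = "\<lambda>\<phi> :: ('k, 'n) laurent \<Rightarrow> real. \<chi> i. - ln (\<phi> (lmon (axis i 1)))"
  have bound: "\<phi> f \<in> {0..C f}" if "\<phi> \<in> X" for \<phi> f
  proof -
    have \<phi>: "laurent_seminorm N \<phi>" using that by (simp add: X_def)
    let ?K = "Poly_Mapping.keys f" and ?T = "\<lambda>m. Poly_Mapping.single m (Poly_Mapping.lookup f m)"
    have pos: "\<phi> (lmon (axis i 1)) > 0" for i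
    proof -
      have "exp (- R) \<le> \<phi> (lmon (axis i 1))" using that by (simp add: X_def)
      then show ?thesis using exp_gt_zero[of "- R"] by linarith
    qed
    have u: "\<phi> (lmon (axis i 1)) = exp (- ?L \<phi> $ i)" for i using pos by simp
    have uR: "\<bar>?L \<phi> $ i\<bar> \<le> R" for i
    proof -
      have "exp (- R) \<le> \<phi> (lmon (axis i 1))" "\<phi> (lmon (axis i 1)) \<le> exp R" using that by (auto simp: X_def)
      then have "- R \<le> ln (\<phi> (lmon (axis i 1)))" "ln (\<phi> (lmon (axis i 1))) \<le> R"
        using pos[of i] by (metis exp_gt_zero ln_exp ln_le_cancel_iff)+
      then show ?thesis by simp
    qed
    have T: "\<phi> (?T m) < C f" if "m \<in> ?K" for m
    proof -
      have "?T m = Poly_Mapping.single 0 (Poly_Mapping.lookup f m) * lmon m" by (simp add: lmon_def mult_single)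
      then have "\<phi> (?T m) = N (Poly_Mapping.lookup f m) * \<phi> (lmon m)"
        by (simp add: seminorm_mult[OF \<phi>] seminorm_const[OF \<phi>])
      also have "\<phi> (lmon m) = exp (- rdot m (?L \<phi>))" by (rule seminorm_lmon[OF N \<phi> u])
      also have "- rdot m (?L \<phi>) \<le> (\<Sum>i\<in>UNIV. \<bar>of_int (m $ i)\<bar> * R)"
        unfolding rdot_def sum_negf[symmetric]
      proof (intro sum_mono)
        fix i
        have "- (of_int (m $ i) * ?L \<phi> $ i) \<le> \<bar>of_int (m $ i)\<bar> * \<bar>?L \<phi> $ i\<bar>" by (metis abs_ge_minus_self abs_mult)
        also have "\<dots> \<le> \<bar>of_int (m $ i)\<bar> * R" using uR by (intro mult_left_mono) auto
        finally show "- (of_int (m $ i) * ?L \<phi> $ i) \<le> \<bar>of_int (m $ i)\<bar> * R" .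
      qed
      then have "N (Poly_Mapping.lookup f m) * exp (- rdot m (?L \<phi>)) \<le>
          N (Poly_Mapping.lookup f m) * exp (\<Sum>i\<in>UNIV. \<bar>of_int (m $ i)\<bar> * R)"
        using norm_nonneg[OF N] by (intro mult_left_mono) auto
      also have "\<dots> \<le> (\<Sum>m\<in>?K. N (Poly_Mapping.lookup f m) * exp (\<Sum>i\<in>UNIV. \<bar>of_int (m $ i)\<bar> * R))"
        using that norm_nonneg[OF N] by (intro member_le_sum) auto
      also have "\<dots> < C f" by (simp add: C_def)
      finally show ?thesis .
    qed
    have "C f > 0" unfolding C_def using norm_nonneg[OF N] by (intro add_pos_nonneg sum_nonneg) auto
    then have "\<phi> (sum ?T ?K) < C f" using T by (intro seminorm_sum[OF N \<phi>]) auto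
    then show ?thesis using laurent_expand[of ?K f] seminorm_nonneg[OF \<phi>, of f] by simp
  qed
  have "compact (PiE UNIV (\<lambda>f. {0..C f}))"
    using compactin_PiE[of "\<lambda>_. euclidean" UNIV "\<lambda>f. {0..C f}"] by (simp add: euclidean_product_topology)
  moreover have "X \<subseteq> PiE UNIV (\<lambda>f. {0..C f})" using bound by auto
  ultimately have "compact X" using closed by (metis compact_Int_closed inf.absorb2 inf_commute)
  moreover have "continuous_on X ?L"
  proof (intro continuous_on_vec_lambda continuous_on_minus continuous_on_ln)
    show "continuous_on X (\<lambda>\<phi>. \<phi> (lmon (axis i 1)))" for i
      by (rule continuous_on_subset[OF continuous_on_product_coordinates]) simp
    show "\<forall>\<phi>\<in>X. \<phi> (lmon (axis i 1)) \<noteq> 0" for i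
    proof
      fix \<phi> assume "\<phi> \<in> X"
      then have "exp (- R) \<le> \<phi> (lmon (axis i 1))" by (simp add: X_def)
      then show "\<phi> (lmon (axis i 1)) \<noteq> 0" using exp_gt_zero[of "- R"] by linarith
    qed
  qed
  ultimately have "compact (?L ` X)" by (rule compact_continuous_image[rotated])
  moreover have "?L ` X = seminorm_set N P \<inter> {u. \<forall>i. \<bar>u $ i\<bar> \<le> R}"
  proof (intro equalityI subsetI)
    fix u assume "u \<in> ?L ` X"
    then obtain \<phi> where \<phi>: "\<phi> \<in> X" "u = ?L \<phi>" by blast
    have r: "exp (- R) \<le> \<phi> (lmon (axis i 1))" "\<phi> (lmon (axis i 1)) \<le> exp R" for i using \<phi> by (auto simp: X_def)
    have pos: "\<phi> (lmon (axis i 1)) > 0" for i using r(1)[of i] exp_gt_zero[of "- R"] by linarith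
    have "\<bar>u $ i\<bar> \<le> R" for i
    proof -
      have "- R \<le> ln (\<phi> (lmon (axis i 1)))" "ln (\<phi> (lmon (axis i 1))) \<le> R"
        using pos[of i] r[of i] by (metis exp_gt_zero ln_exp ln_le_cancel_iff)+
      then show ?thesis using \<phi>(2) by simp
    qed
    moreover have "u \<in> seminorm_set N P"
      unfolding seminorm_set_def using \<phi> pos by (auto simp: X_def)
    ultimately show "u \<in> seminorm_set N P \<inter> {u. \<forall>i. \<bar>u $ i\<bar> \<le> R}" by simp
  next
    fix u assume u: "u \<in> seminorm_set N P \<inter> {u. \<forall>i. \<bar>u $ i\<bar> \<le> R}"
    then obtain \<phi> where \<phi>: "laurent_seminorm N \<phi>" "\<forall>f\<in>P. \<phi> f = 0" "\<And>i. \<phi> (lmon (axis i 1)) = exp (- u $ i)"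
      by (auto simp: seminorm_set_def)
    have "\<phi> \<in> X" unfolding X_def using \<phi> u by (simp add: abs_le_iff)
    moreover have "u = ?L \<phi>" by (simp add: vec_eq_iff \<phi>(3))
    ultimately show "u \<in> ?L ` X" by blast
  qed
  ultimately show ?thesis by simp
qed

lemma closed_seminorm_set:
  assumes N: "nonarch_norm N"
  shows "closed (seminorm_set N P)"
  unfolding closed_sequential_limits
proof (intro allI impI)
  fix x l assume x: "(\<forall>n. x n \<in> seminorm_set N P) \<and> x \<longlonglongrightarrow> l"
  then have "bounded (range x)" using convergent_imp_bounded by blast
  then obtain R where R: "\<And>n. norm (x n) \<le> R" by (auto simp: bounded_iff)
  let ?K = "seminorm_set N P \<inter> {u. \<forall>i. \<bar>u $ i\<bar> \<le> R}"
  have "x n \<in> ?K" for n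
    using x R[of n] order.trans[OF component_le_norm_cart[of "x n"]] by simp
  moreover have "closed ?K" using compact_seminorm_set_box[OF N] by (rule compact_imp_closed)
  ultimately have "l \<in> ?K" using x unfolding closed_sequential_limits by blast
  then show "l \<in> seminorm_set N P" by simp
qed

section \<open>Rational polyhedra\<close>

definition polyhedral :: "real set \<Rightarrow> (real ^ 'n::finite) set \<Rightarrow> bool" where
  "polyhedral \<Gamma> Q \<longleftrightarrow> (\<exists>F. finite F \<and> (\<forall>P\<in>F. rational_polyhedron \<Gamma> P) \<and> Q = \<Union>F)"

lemma rational_polyhedron_rdot:
  "rational_polyhedron \<Gamma> P \<longleftrightarrow> (\<exists>S. finite S \<and> snd ` S \<subseteq> \<Gamma> \<and> P = {u. \<forall>(b, c)\<in>S. rdot b u \<ge> c})"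
  by (simp add: rational_polyhedron_def rdot_def)

lemma rational_polyhedron_UNIV [simp]: "rational_polyhedron \<Gamma> UNIV"
  unfolding rational_polyhedron_rdot by (intro exI[of _ "{}"]) simp

lemma rational_polyhedron_Int:
  assumes "rational_polyhedron \<Gamma> P" "rational_polyhedron \<Gamma> P'"
  shows "rational_polyhedron \<Gamma> (P \<inter> P')"
proof -
  obtain S S' where "finite S" "snd ` S \<subseteq> \<Gamma>" "P = {u. \<forall>(b, c)\<in>S. rdot b u \<ge> c}"
    "finite S'" "snd ` S' \<subseteq> \<Gamma>" "P' = {u. \<forall>(b, c)\<in>S'. rdot b u \<ge> c}"
    using assms unfolding rational_polyhedron_rdot by blast
  then show ?thesis unfolding rational_polyhedron_rdot by (intro exI[of _ "S \<union> S'"]) auto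
qed

lemma rational_polyhedron_mono: "rational_polyhedron \<Gamma> P \<Longrightarrow> \<Gamma> \<subseteq> \<Gamma>' \<Longrightarrow> rational_polyhedron \<Gamma>' P"
  unfolding rational_polyhedron_rdot by blast

lemma polyhedral_UNIV: "polyhedral \<Gamma> UNIV"
  unfolding polyhedral_def by (intro exI[of _ "{UNIV}"]) simp

lemma polyhedral_Int:
  assumes "polyhedral \<Gamma> Q" "polyhedral \<Gamma> Q'"
  shows "polyhedral \<Gamma> (Q \<inter> Q')"
proof -
  obtain F F' where F: "finite F" "\<forall>P\<in>F. rational_polyhedron \<Gamma> P" "Q = \<Union>F"
    "finite F'" "\<forall>P\<in>F'. rational_polyhedron \<Gamma> P" "Q' = \<Union>F'" using assms unfolding polyhedral_def by blast
  show ?thesis unfolding polyhedral_def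
    by (intro exI[of _ "(\<lambda>(P, P'). P \<inter> P') ` (F \<times> F')"]) (use F in \<open>auto intro: rational_polyhedron_Int\<close>)
qed

lemma polyhedral_INT: "finite A \<Longrightarrow> (\<And>x. x \<in> A \<Longrightarrow> polyhedral \<Gamma> (Q x)) \<Longrightarrow> polyhedral \<Gamma> (\<Inter>x\<in>A. Q x)"
  by (induction A rule: finite_induct) (auto simp: polyhedral_UNIV intro: polyhedral_Int)

lemma linear_rdot: "linear (rdot m)"
  by (rule linearI) (simp_all add: rdot_linear)

lemma continuous_on_rdot [continuous_intros]: "continuous_on A (rdot m)"
  by (rule linear_continuous_on) (simp add: linear_rdot linear_conv_bounded_linear[symmetric])

lemma closed_rational_polyhedron: "rational_polyhedron \<Gamma> P \<Longrightarrow> closed P"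
  and convex_rational_polyhedron: "rational_polyhedron \<Gamma> P \<Longrightarrow> convex P"
proof -
  assume "rational_polyhedron \<Gamma> P"
  then obtain S where P: "P = {u. \<forall>(b, c)\<in>S. rdot b u \<ge> c}" unfolding rational_polyhedron_rdot by blast
  then have P': "P = (\<Inter>(b, c)\<in>S. {u. c \<le> rdot b u})" by auto
  show "closed P" unfolding P'
    by (intro closed_INT ballI) (auto intro!: closed_Collect_le continuous_intros)
  have "convex {u. c \<le> rdot b u}" for b :: "int ^ 'a" and c :: real
  proof (rule convexI)
    fix x y :: "real ^ 'a" and s t :: real
    assume *: "x \<in> {u. c \<le> rdot b u}" "y \<in> {u. c \<le> rdot b u}" "0 \<le> s" "0 \<le> t" "s + t = 1"
    have "c = s * c + t * c" using *(5) by (simp flip: distrib_right)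
    also have "\<dots> \<le> s * rdot b x + t * rdot b y" using * by (intro add_mono mult_left_mono) auto
    finally show "s *\<^sub>R x + t *\<^sub>R y \<in> {u. c \<le> rdot b u}" by (simp add: rdot_linear)
  qed
  then show "convex P" unfolding P' by (intro convex_INT) auto
qed

subsection \<open>The value group\<close>

text \<open>The value group of an algebraically closed field is a rational vector space.\<close>

definition divisible_group :: "real set \<Rightarrow> bool" where
  "divisible_group \<Gamma> \<longleftrightarrow> 0 \<in> \<Gamma> \<and> (\<forall>x\<in>\<Gamma>. \<forall>y\<in>\<Gamma>. x + y \<in> \<Gamma>) \<and> (\<forall>x\<in>\<Gamma>. \<forall>q\<in>\<rat>. q * x \<in> \<Gamma>)"

lemma
  assumes "divisible_group \<Gamma>"
  shows divisible_0: "0 \<in> \<Gamma>" and divisible_add: "x \<in> \<Gamma> \<Longrightarrow> y \<in> \<Gamma> \<Longrightarrow> x + y \<in> \<Gamma>"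
    and divisible_scale: "x \<in> \<Gamma> \<Longrightarrow> q \<in> \<rat> \<Longrightarrow> q * x \<in> \<Gamma>"
    and divisible_diff: "x \<in> \<Gamma> \<Longrightarrow> y \<in> \<Gamma> \<Longrightarrow> x - y \<in> \<Gamma>"
proof -
  show *: "0 \<in> \<Gamma>" "x \<in> \<Gamma> \<Longrightarrow> y \<in> \<Gamma> \<Longrightarrow> x + y \<in> \<Gamma>" "x \<in> \<Gamma> \<Longrightarrow> q \<in> \<rat> \<Longrightarrow> q * x \<in> \<Gamma>" for x y q
    using assms by (auto simp: divisible_group_def)
  show "x \<in> \<Gamma> \<Longrightarrow> y \<in> \<Gamma> \<Longrightarrow> x - y \<in> \<Gamma>" using *(2)[of x "-1 * y"] *(3)[of y "-1"] by simp
qed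

lemma divisible_sum: "divisible_group \<Gamma> \<Longrightarrow> (\<And>x. x \<in> A \<Longrightarrow> f x \<in> \<Gamma>) \<Longrightarrow> sum f A \<in> \<Gamma>"
  by (induction A rule: infinite_finite_induct) (auto simp: divisible_0 intro: divisible_add)

lemma divisible_dense:
  assumes \<Gamma>: "divisible_group \<Gamma>" and "\<gamma> \<in> \<Gamma>" "\<gamma> \<noteq> 0" and "\<epsilon> > 0"
  shows "\<exists>y\<in>\<Gamma>. \<bar>y - x\<bar> < \<epsilon>"
proof -
  obtain q where q: "x / \<gamma> - \<epsilon> / \<bar>\<gamma>\<bar> < of_rat q" "of_rat q < x / \<gamma>"
    using of_rat_dense[of "x / \<gamma> - \<epsilon> / \<bar>\<gamma>\<bar>" "x / \<gamma>"] assms by auto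
  have "\<bar>of_rat q * \<gamma> - x\<bar> = \<bar>of_rat q - x / \<gamma>\<bar> * \<bar>\<gamma>\<bar>"
    using assms by (simp add: field_simps flip: abs_mult)
  also have "\<dots> < \<epsilon> / \<bar>\<gamma>\<bar> * \<bar>\<gamma>\<bar>" using q assms by (intro mult_strict_right_mono) (auto simp: abs_if)
  also have "\<dots> = \<epsilon>" using assms by simp
  finally show ?thesis using divisible_scale[OF \<Gamma> assms(2)] by (intro bexI[of _ "of_rat q * \<gamma>"]) auto
qed

lemma divisible_value_group:
  fixes N :: "'c::alg_closed_field \<Rightarrow> real"
  assumes N: "nonarch_norm N"
  shows "divisible_group (value_group N)"
  unfolding divisible_group_def
proof (intro conjI ballI)
  show "0 \<in> value_group N" unfolding value_group_def using norm_one[OF N] by (auto intro!: exI[of _ 1])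
  fix x assume x: "x \<in> value_group N"
  then obtain a where a: "a \<noteq> 0" "x = - ln (N a)" unfolding value_group_def by blast
  {
    fix y assume "y \<in> value_group N"
    then obtain b where b: "b \<noteq> 0" "y = - ln (N b)" unfolding value_group_def by blast
    have "x + y = - ln (N (a * b))"
      using a b norm_pos[OF N a(1)] norm_pos[OF N b(1)] by (simp add: norm_mult[OF N] ln_mult)
    then show "x + y \<in> value_group N" unfolding value_group_def using a b by (intro CollectI exI[of _ "a * b"]) auto
  }
  fix q :: real assume "q \<in> \<rat>"
  then obtain m n where q: "q = of_int m / of_int n" "n > 0" by (auto elim: Rats_cases')
  obtain c where c: "c ^ nat n = a" using nth_root_exists[of "nat n" a] q by auto
  then have "c \<noteq> 0" using a q by auto
  have "- ln (N (c powi m)) = q * x"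
  proof -
    have "ln (N a) = real (nat n) * ln (N c)"
      using norm_pos[OF N \<open>c \<noteq> 0\<close>] by (simp add: c[symmetric] norm_power[OF N] ln_realpow)
    moreover have "ln (N (c powi m)) = of_int m * ln (N c)"
      using norm_pos[OF N \<open>c \<noteq> 0\<close>] by (simp add: norm_powi[OF N] exp_ln_powi)
    ultimately show ?thesis using q a by simp
  qed
  then show "q * x \<in> value_group N" unfolding value_group_def using \<open>c \<noteq> 0\<close>
    by (intro CollectI exI[of _ "c powi m"]) (auto simp: power_int_eq_0_iff)
qed

text \<open>Approximation by points over the value group that keeps all rational relations: write the
  coordinates in terms of the smallest possible number of reals \<open>w\<^sub>i\<close>, which are then linearly
  independent over the rationals modulo the value group, and move the \<open>w\<^sub>i\<close>.\<close>

definition gamma_repr :: "real set \<Rightarrow> real ^ 'n::finite \<Rightarrow> 'n set \<Rightarrow> ('n \<Rightarrow> real) \<Rightarrow> ('n \<Rightarrow> real) \<Rightarrow> ('n \<Rightarrow> 'n \<Rightarrow> real) \<Rightarrow> bool"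
  where "gamma_repr \<Gamma> u A w g q \<longleftrightarrow> (\<forall>j. g j \<in> \<Gamma>) \<and> (\<forall>j i. q j i \<in> \<rat>) \<and> (\<forall>j. u $ j = g j + (\<Sum>i\<in>A. q j i * w i))"

lemma gamma_repr_independent:
  fixes u :: "real ^ 'n::finite"
  assumes \<Gamma>: "divisible_group \<Gamma>"
  obtains A w g q where "gamma_repr \<Gamma> u A w g q"
    "\<And>p. (\<And>i. p i \<in> \<rat>) \<Longrightarrow> (\<Sum>i\<in>A. p i * w i) \<in> \<Gamma> \<Longrightarrow> \<forall>i\<in>A. p i = 0"
proof -
  let ?S = "\<lambda>k. \<exists>A w g q. gamma_repr \<Gamma> u A w g q \<and> card A = k"
  have "gamma_repr \<Gamma> u UNIV (\<lambda>i. u $ i) (\<lambda>_. 0) (\<lambda>j i. if j = i then 1 else 0)"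
    unfolding gamma_repr_def using divisible_0[OF \<Gamma>] by (auto simp: if_distrib[where f = "\<lambda>x. x * _"] cong: if_cong)
  then have "\<exists>k. ?S k" by blast
  then obtain k where k: "?S k" and min: "\<And>l. l < k \<Longrightarrow> \<not> ?S l" using exists_least_iff[of ?S] by blast
  then obtain A w g q where r: "gamma_repr \<Gamma> u A w g q" "card A = k" by blast
  have fin: "finite A" by simp
  have "\<forall>i\<in>A. p i = 0" if p: "\<And>i. p i \<in> \<rat>" "(\<Sum>i\<in>A. p i * w i) \<in> \<Gamma>" for p
  proof (rule ccontr)
    assume "\<not> ?thesis"
    then obtain i0 where i0: "i0 \<in> A" "p i0 \<noteq> 0" by blast
    define \<gamma> where "\<gamma> = (\<Sum>i\<in>A. p i * w i)"
    define g' where "g' j = g j + (q j i0 / p i0) * \<gamma>" for j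
    define q' where "q' j i = q j i - q j i0 / p i0 * p i" for j i
    have w0: "\<gamma> = p i0 * w i0 + (\<Sum>i\<in>A - {i0}. p i * w i)" unfolding \<gamma>_def using i0 fin by (simp add: sum.remove)
    have "gamma_repr \<Gamma> u (A - {i0}) w g' q'"
      unfolding gamma_repr_def
    proof (intro conjI allI)
      fix j
      show "g' j \<in> \<Gamma>" unfolding g'_def using r p unfolding gamma_repr_def \<gamma>_def
        by (intro divisible_add[OF \<Gamma>] divisible_scale[OF \<Gamma>]) auto
      show "q' j i \<in> \<rat>" for i unfolding q'_def using r p unfolding gamma_repr_def by auto
      have "u $ j = g j + (q j i0 * w i0 + (\<Sum>i\<in>A - {i0}. q j i * w i))"
        using r i0 fin unfolding gamma_repr_def by (simp add: sum.remove)
      also have "q j i0 * w i0 = q j i0 / p i0 * (\<gamma> - (\<Sum>i\<in>A - {i0}. p i * w i))"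
        using w0 i0 by simp
      also have "g j + (q j i0 / p i0 * (\<gamma> - (\<Sum>i\<in>A - {i0}. p i * w i)) + (\<Sum>i\<in>A - {i0}. q j i * w i))
         = g' j + (\<Sum>i\<in>A - {i0}. q' j i * w i)"
        by (simp add: g'_def q'_def algebra_simps sum_subtractf sum_distrib_left)
      finally show "u $ j = g' j + (\<Sum>i\<in>A - {i0}. q' j i * w i)" .
    qed
    moreover have "card (A - {i0}) < k" using r(2) i0 fin by (metis card_Diff1_less)
    ultimately show False using min by blast
  qed
  then show thesis using that r(1) by blast
qed

lemma gamma_approximation:
  fixes u :: "real ^ 'n::finite"
  assumes \<Gamma>: "divisible_group \<Gamma>" and \<gamma>: "\<gamma> \<in> \<Gamma>" "\<gamma> \<noteq> 0" and \<epsilon>: "\<epsilon> > 0"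
  shows "\<exists>u'. (\<forall>i. u' $ i \<in> \<Gamma>) \<and> dist u' u < \<epsilon> \<and> (\<forall>b c. c \<in> \<Gamma> \<longrightarrow> rdot b u = c \<longrightarrow> rdot b u' = c)"
proof -
  obtain A w g q where r: "gamma_repr \<Gamma> u A w g q"
    and ind: "\<And>p. (\<And>i. p i \<in> \<rat>) \<Longrightarrow> (\<Sum>i\<in>A. p i * w i) \<in> \<Gamma> \<Longrightarrow> \<forall>i\<in>A. p i = 0"
    using gamma_repr_independent[OF \<Gamma>, of u] by blast
  have g: "g j \<in> \<Gamma>" and q: "q j i \<in> \<rat>" and u: "u $ j = g j + (\<Sum>i\<in>A. q j i * w i)" for i j
    using r by (auto simp: gamma_repr_def)
  define C where "C = 1 + (\<Sum>j\<in>UNIV. \<Sum>i\<in>A. \<bar>q j i\<bar>)"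
  have C: "C > 0" unfolding C_def by (intro add_pos_nonneg sum_nonneg) auto
  have "\<exists>y\<in>\<Gamma>. \<bar>y - w i\<bar> < \<epsilon> / C" for i
    using divisible_dense[OF \<Gamma> \<gamma>, of "\<epsilon> / C" "w i"] \<epsilon> C by simp
  then obtain y where y: "\<And>i. y i \<in> \<Gamma>" "\<And>i. \<bar>y i - w i\<bar> < \<epsilon> / C" by metis
  define u' where "u' = (\<chi> j. g j + (\<Sum>i\<in>A. q j i * y i))"
  have "dist u' u < \<epsilon>"
  proof -
    have "dist u' u \<le> (\<Sum>j\<in>UNIV. \<bar>(u' - u) $ j\<bar>)" unfolding dist_norm by (rule norm_le_l1_cart)
    also have "\<dots> \<le> (\<Sum>j\<in>UNIV. \<Sum>i\<in>A. \<bar>q j i\<bar> * (\<epsilon> / C))"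
    proof (intro sum_mono)
      fix j
      have "(u' - u) $ j = (\<Sum>i\<in>A. q j i * (y i - w i))"
        by (simp add: u'_def u algebra_simps sum_subtractf)
      also have "\<bar>\<dots>\<bar> \<le> (\<Sum>i\<in>A. \<bar>q j i * (y i - w i)\<bar>)" by (rule sum_abs)
      also have "\<dots> \<le> (\<Sum>i\<in>A. \<bar>q j i\<bar> * (\<epsilon> / C))"
        unfolding abs_mult by (intro sum_mono mult_left_mono) (auto intro: less_imp_le y)
      finally show "\<bar>(u' - u) $ j\<bar> \<le> (\<Sum>i\<in>A. \<bar>q j i\<bar> * (\<epsilon> / C))" .
    qed
    also have "\<dots> = (C - 1) * (\<epsilon> / C)" by (simp only: sum_distrib_right[symmetric]) (simp add: C_def)
    also have "\<dots> < C * (\<epsilon> / C)" using \<epsilon> C by (intro mult_strict_right_mono) auto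
    also have "\<dots> = \<epsilon>" using C by simp
    finally show ?thesis .
  qed
  moreover have "u' $ i \<in> \<Gamma>" for i
    unfolding u'_def using g q y by (auto intro!: divisible_add[OF \<Gamma>] divisible_sum[OF \<Gamma>] divisible_scale[OF \<Gamma>])
  moreover have "rdot b u' = c" if c: "c \<in> \<Gamma>" "rdot b u = c" for b c
  proof -
    define p where "p i = (\<Sum>j\<in>UNIV. of_int (b $ j) * q j i)" for i
    have ex: "(\<Sum>j\<in>UNIV. of_int (b $ j) * (g j + (\<Sum>i\<in>A. q j i * z i))) =
        (\<Sum>j\<in>UNIV. of_int (b $ j) * g j) + (\<Sum>i\<in>A. p i * z i)" for z
    proof -
      have "(\<Sum>j\<in>UNIV. of_int (b $ j) * (\<Sum>i\<in>A. q j i * z i)) = (\<Sum>j\<in>UNIV. \<Sum>i\<in>A. of_int (b $ j) * q j i * z i)"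
        by (simp add: sum_distrib_left mult.assoc)
      also have "\<dots> = (\<Sum>i\<in>A. p i * z i)" unfolding p_def sum_distrib_right by (rule sum.swap)
      finally show ?thesis by (simp add: distrib_left sum.distrib)
    qed
    have "(\<Sum>i\<in>A. p i * w i) = c - (\<Sum>j\<in>UNIV. of_int (b $ j) * g j)"
      using c(2) ex[of w] unfolding rdot_def u by simp
    also have "\<dots> \<in> \<Gamma>" using c g by (intro divisible_diff[OF \<Gamma>] divisible_sum[OF \<Gamma>] divisible_scale[OF \<Gamma>]) auto
    finally have "\<forall>i\<in>A. p i = 0" using q by (intro ind) (auto simp: p_def intro!: Rats_sum)
    then show ?thesis using c(2) ex[of w] ex[of y] unfolding rdot_def u u'_def by simp
  qed
  ultimately show ?thesis by blast
qed

text \<open>The constraints that are tight at \<open>u\<close> are rational relations and stay tight under the approximation;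
  the others are open conditions.\<close>

lemma rational_polyhedron_dense:
  fixes u :: "real ^ 'n::finite"
  assumes \<Gamma>: "divisible_group \<Gamma>" and \<gamma>: "\<gamma> \<in> \<Gamma>" "\<gamma> \<noteq> 0" and \<epsilon>: "\<epsilon> > 0"
    and P: "rational_polyhedron \<Gamma> P" and u: "u \<in> P"
  shows "\<exists>u'\<in>P. (\<forall>i. u' $ i \<in> \<Gamma>) \<and> dist u' u < \<epsilon>"
proof -
  obtain S where S: "finite S" "snd ` S \<subseteq> \<Gamma>" "P = {u. \<forall>(b, c)\<in>S. rdot b u \<ge> c}"
    using P unfolding rational_polyhedron_rdot by blast
  define U where "U = ball u \<epsilon> \<inter> (\<Inter>(b, c)\<in>{(b, c)\<in>S. rdot b u > c}. {x. c < rdot b x})"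
  have finS: "finite {(b, c)\<in>S. rdot b u > c}" by (rule finite_subset[OF _ S(1)]) auto
  have "open U" unfolding U_def
    by (intro open_Int open_ball open_INT finS) (auto intro!: open_Collect_less continuous_intros)
  moreover have "u \<in> U" using \<epsilon> by (auto simp: U_def)
  ultimately obtain \<eta> where \<eta>: "\<eta> > 0" "ball u \<eta> \<subseteq> U" by (meson openE)
  obtain u' :: "real ^ 'n" where u': "\<forall>i. u' $ i \<in> \<Gamma>" "dist u' u < \<eta>" "\<forall>b c. c \<in> \<Gamma> \<longrightarrow> rdot b u = c \<longrightarrow> rdot b u' = c"
    using gamma_approximation[OF \<Gamma> \<gamma> \<eta>(1), of u] by blast
  have "u' \<in> U" using u'(2) \<eta>(2) by (auto simp: dist_commute)
  have "c \<le> rdot b u'" if bc: "(b, c) \<in> S" for b c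
  proof (cases "rdot b u = c")
    case True
    moreover have "c \<in> \<Gamma>" using S(2) bc by force
    ultimately show ?thesis using u'(3) by simp
  next
    case False
    then have "rdot b u > c" using u S(3) bc by force
    then show ?thesis using \<open>u' \<in> U\<close> bc unfolding U_def by force
  qed
  then have "u' \<in> P" unfolding S(3) by auto
  moreover have "dist u' u < \<epsilon>" using \<open>u' \<in> U\<close> by (auto simp: U_def dist_commute)
  ultimately show ?thesis using u'(1) by blast
qed

lemma polyhedral_dense:
  fixes u :: "real ^ 'n::finite"
  assumes \<Gamma>: "divisible_group \<Gamma>" and \<gamma>: "\<gamma> \<in> \<Gamma>" "\<gamma> \<noteq> 0" and \<epsilon>: "\<epsilon> > 0"
    and Q: "polyhedral \<Gamma> Q" and u: "u \<in> Q"
  shows "\<exists>u'\<in>Q. (\<forall>i. u' $ i \<in> \<Gamma>) \<and> dist u' u < \<epsilon>"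
proof -
  obtain F where F: "\<forall>P\<in>F. rational_polyhedron \<Gamma> P" "Q = \<Union>F" using Q unfolding polyhedral_def by blast
  then obtain P where "P \<in> F" "u \<in> P" using u by blast
  then show ?thesis using rational_polyhedron_dense[OF \<Gamma> \<gamma> \<epsilon>, of P u] F by blast
qed

text \<open>One polyhedron for each pair of terms that attain the minimum.\<close>

lemma polyhedral_trop:
  fixes f :: "('k::field, 'n::finite) laurent"
  assumes N: "nonarch_norm N" and "f \<noteq> 0"
  shows "polyhedral (value_group N) (trop N f)"
proof -
  let ?K = "Poly_Mapping.keys f" and ?v = "\<lambda>m. - ln (N (Poly_Mapping.lookup f m))"
  define S where "S = (\<lambda>(m1, m2). {(m1 - m2, ?v m2 - ?v m1), (m2 - m1, ?v m1 - ?v m2)} \<union> (\<lambda>m. (m - m1, ?v m1 - ?v m)) ` ?K)"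
  define P where "P = (\<lambda>p. {u :: real ^ 'n. \<forall>(b, c)\<in>S p. rdot b u \<ge> c})"
  let ?I = "{(m1, m2)\<in>?K \<times> ?K. m1 \<noteq> m2}"
  have "finite ?I" by (rule finite_subset[of _ "?K \<times> ?K"]) auto
  have vd: "?v m - ?v m' \<in> value_group N" if "m \<in> ?K" "m' \<in> ?K" for m m'
  proof -
    let ?a = "Poly_Mapping.lookup f m" and ?b = "Poly_Mapping.lookup f m'"
    have ab: "?a \<noteq> 0" "?b \<noteq> 0" using that by (auto simp: in_keys_iff)
    have "?v m - ?v m' = - ln (N (?a / ?b))"
      using norm_pos[OF N ab(1)] norm_pos[OF N ab(2)]
      by (simp add: divide_inverse norm_mult[OF N] norm_inverse[OF N] ln_mult ln_inverse)
    then show ?thesis unfolding value_group_def using ab by (intro CollectI exI[of _ "?a / ?b"]) auto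
  qed
  have "rational_polyhedron (value_group N) (P p)" if "p \<in> ?I" for p
    unfolding rational_polyhedron_rdot
    by (intro exI[of _ "S p"]) (use that vd in \<open>auto simp: P_def S_def\<close>)
  moreover have "trop N f = \<Union>(P ` ?I)"
  proof (intro equalityI subsetI)
    fix u assume "u \<in> trop N f"
    then obtain m1 m2 where m: "m1 \<in> ?K" "m2 \<in> ?K" "m1 \<noteq> m2" "wt N f m1 u = wt N f m2 u"
      "\<And>m. m \<in> ?K \<Longrightarrow> wt N f m1 u \<le> wt N f m u" using assms(2) by (auto simp: trop_def)
    have "?v m1 - ?v m \<le> rdot (m - m1) u" if "m \<in> ?K" for m
      using m(5)[OF that] by (simp add: wt_def rdot_linear)
    then have "u \<in> P (m1, m2)" using m(4) by (auto simp: P_def S_def wt_def rdot_linear)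
    then show "u \<in> \<Union>(P ` ?I)" using m by blast
  next
    fix u assume "u \<in> \<Union>(P ` ?I)"
    then obtain m1 m2 where m: "m1 \<in> ?K" "m2 \<in> ?K" "m1 \<noteq> m2" "u \<in> P (m1, m2)" by blast
    have "wt N f m1 u = wt N f m2 u" using m(4) by (simp add: P_def S_def wt_def rdot_linear)
    moreover have "\<forall>m\<in>?K. wt N f m1 u \<le> wt N f m u" using m(4) by (simp add: P_def S_def wt_def rdot_linear algebra_simps)
    ultimately show "u \<in> trop N f" unfolding trop_def using m by blast
  qed
  ultimately show ?thesis unfolding polyhedral_def using \<open>finite ?I\<close> by (intro exI[of _ "P ` ?I"]) auto
qed

text \<open>In a direction \<open>\<delta>\<close> that separates the exponents, a break of the concave piecewise linear
  function on a line persists on nearby lines.  So a tropical hypersurface is locally as large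
  as a hyperplane transversal to \<open>\<delta>\<close>.\<close>

lemma trop_transversal:
  fixes f :: "('k::field, 'n::finite) laurent"
  assumes f: "f \<noteq> 0" and u: "u \<in> trop N f" and inj: "inj_on (idot \<delta>) (Poly_Mapping.keys f)" and \<epsilon>: "\<epsilon> > 0"
  shows "\<exists>\<eta>>0. \<forall>x. dist x u < \<eta> \<longrightarrow> (\<exists>t. \<bar>t\<bar> \<le> \<epsilon> \<and> x + t *\<^sub>R (\<chi> i. of_int (\<delta> $ i)) \<in> trop N f)"
proof -
  let ?K = "Poly_Mapping.keys f" and ?d = "(\<chi> i. of_int (\<delta> $ i)) :: real ^ 'n"
  have rd: "rdot m ?d = of_int (idot \<delta> m)" for m by (simp add: rdot_def idot_def mult.commute)
  obtain a b where ab: "a \<in> ?K" "b \<in> ?K" "a \<noteq> b" "wt N f a u = wt N f b u"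
    "\<And>m. m \<in> ?K \<Longrightarrow> wt N f a u \<le> wt N f m u" using u f by (auto simp: trop_def)
  have "idot \<delta> a \<noteq> idot \<delta> b" using inj ab by (auto simp: inj_on_def)
  then obtain m1 m2 where m: "m1 \<in> ?K" "m2 \<in> ?K" "wt N f m1 u = wt N f m2 u" "idot \<delta> m1 < idot \<delta> m2"
    "\<And>m. m \<in> ?K \<Longrightarrow> wt N f m1 u \<le> wt N f m u"
    using ab that by (cases "idot \<delta> a < idot \<delta> b") (force, force)
  have cont: "isCont (wt N f m) u" for m unfolding wt_def
    by (intro continuous_intros linear_continuous_at) (simp add: linear_rdot linear_conv_bounded_linear[symmetric])
  have "\<forall>\<^sub>F x in nhds u. \<forall>m\<in>?K. \<bar>wt N f m x - wt N f m u\<bar> < \<epsilon> / 4"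
  proof (intro eventually_ball_finite finite_keys ballI)
    fix m
    have "(wt N f m \<longlongrightarrow> wt N f m u) (nhds u)" using cont by (simp add: continuous_at tendsto_at_iff_tendsto_nhds)
    then show "\<forall>\<^sub>F x in nhds u. \<bar>wt N f m x - wt N f m u\<bar> < \<epsilon> / 4"
      using tendstoD[of "wt N f m" "wt N f m u" "nhds u" "\<epsilon> / 4"] \<epsilon> by (simp add: dist_real_def)
  qed
  then obtain \<eta> where \<eta>: "\<eta> > 0" "\<And>x. dist x u < \<eta> \<Longrightarrow> \<forall>m\<in>?K. \<bar>wt N f m x - wt N f m u\<bar> < \<epsilon> / 4"
    unfolding eventually_nhds_metric by blast
  have "\<exists>t. \<bar>t\<bar> \<le> \<epsilon> \<and> x + t *\<^sub>R ?d \<in> trop N f" if x: "dist x u < \<eta>" for x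
  proof (rule ccontr)
    assume neg: "\<not> ?thesis"
    have w: "wt N f m (x + t *\<^sub>R ?d) = wt N f m x + t * of_int (idot \<delta> m)" for m t
      by (simp add: wt_def rdot_linear rd)
    \<comment> \<open>if the line through \<open>x\<close> avoids the hypersurface, the segment is the disjoint union of the closed sets
      on which a given term is minimal, so a single term \<open>p\<close> is minimal at both ends; but \<open>m1\<close> and \<open>m2\<close>,
      which balance at \<open>u\<close>, bound it from different sides\<close>
    define C where "C m = {t \<in> {-\<epsilon>..\<epsilon>}. \<forall>m'\<in>?K. wt N f m (x + t *\<^sub>R ?d) \<le> wt N f m' (x + t *\<^sub>R ?d)}" for m
    have Ccl: "closed (C m)" for m
    proof -
      have "C m = {-\<epsilon>..\<epsilon>} \<inter> (\<Inter>m'\<in>?K. {t. wt N f m x + t * of_int (idot \<delta> m) \<le> wt N f m' x + t * of_int (idot \<delta> m')})"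
        unfolding C_def w by auto
      then show ?thesis
        by (simp only:) (intro closed_Int closed_INT ballI closed_Collect_le continuous_intros closed_real_atLeastAtMost)
    qed
    have cover: "\<exists>m\<in>?K. t \<in> C m" if "t \<in> {-\<epsilon>..\<epsilon>}" for t
    proof -
      have "finite ((\<lambda>m. wt N f m (x + t *\<^sub>R ?d)) ` ?K)" "(\<lambda>m. wt N f m (x + t *\<^sub>R ?d)) ` ?K \<noteq> {}" using m(1) by auto
      then obtain m where "m \<in> ?K" "\<And>m'. m' \<in> ?K \<Longrightarrow> wt N f m (x + t *\<^sub>R ?d) \<le> wt N f m' (x + t *\<^sub>R ?d)"
        using ex_min_if_finite[of "(\<lambda>m. wt N f m (x + t *\<^sub>R ?d)) ` ?K"] by (auto simp: not_less)
      then show ?thesis unfolding C_def using that by blast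
    qed
    have disj: "C m \<inter> C m' = {}" if "m \<in> ?K" "m' \<in> ?K" "m \<noteq> m'" for m m'
    proof (rule ccontr)
      assume "C m \<inter> C m' \<noteq> {}"
      then obtain t where t: "t \<in> C m" "t \<in> C m'" by blast
      then have "wt N f m (x + t *\<^sub>R ?d) = wt N f m' (x + t *\<^sub>R ?d)"
        using that unfolding C_def by (auto intro: antisym)
      then have "x + t *\<^sub>R ?d \<in> trop N f" unfolding trop_def using that t(1) unfolding C_def by blast
      moreover have "\<bar>t\<bar> \<le> \<epsilon>" using t(1) unfolding C_def by auto
      ultimately show False using neg by blast
    qed
    obtain p where p: "p \<in> ?K" "-\<epsilon> \<in> C p" using cover[of "-\<epsilon>"] \<epsilon> by auto
    have "\<epsilon> \<in> C p"
    proof (rule ccontr)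
      assume "\<epsilon> \<notin> C p"
      let ?B = "\<Union>m\<in>?K - {p}. C m"
      obtain p' where "p' \<in> ?K" "\<epsilon> \<in> C p'" using cover[of \<epsilon>] \<epsilon> by auto
      then have "?B \<inter> {-\<epsilon>..\<epsilon>} \<noteq> {}" using \<open>\<epsilon> \<notin> C p\<close> \<epsilon> by force
      moreover have "C p \<inter> {-\<epsilon>..\<epsilon>} \<noteq> {}" using p(2) \<epsilon> by force
      moreover have "{-\<epsilon>..\<epsilon>} \<subseteq> C p \<union> ?B" using cover by blast
      moreover have "C p \<inter> ?B \<inter> {-\<epsilon>..\<epsilon>} = {}" using disj p(1) by blast
      moreover have "closed ?B" using Ccl by (intro closed_UN) auto
      ultimately have "\<not> connected {-\<epsilon>..\<epsilon>}" unfolding connected_closed using Ccl by blast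
      then show False by simp
    qed
    have 1: "wt N f p x - \<epsilon> * of_int (idot \<delta> p) \<le> wt N f m2 x - \<epsilon> * of_int (idot \<delta> m2)"
      using p(2) m(2) w[of _ "-\<epsilon>"] unfolding C_def by auto
    have 2: "wt N f p x + \<epsilon> * of_int (idot \<delta> p) \<le> wt N f m1 x + \<epsilon> * of_int (idot \<delta> m1)"
      using \<open>\<epsilon> \<in> C p\<close> m(1) w[of _ \<epsilon>] unfolding C_def by auto
    have "of_int (idot \<delta> m1) + 1 \<le> (of_int (idot \<delta> m2) :: real)" using m(4) by linarith
    then have "\<epsilon> * (of_int (idot \<delta> m1) + 1) \<le> \<epsilon> * (of_int (idot \<delta> m2) :: real)" using \<epsilon> by (intro mult_left_mono) auto
    then have "2 * wt N f p x + \<epsilon> \<le> wt N f m1 x + wt N f m2 x" using 1 2 by (simp add: algebra_simps)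
    moreover have "\<bar>wt N f p x - wt N f p u\<bar> < \<epsilon> / 4" "\<bar>wt N f m1 x - wt N f m1 u\<bar> < \<epsilon> / 4"
      "\<bar>wt N f m2 x - wt N f m2 u\<bar> < \<epsilon> / 4" using \<eta>(2)[OF x] p(1) m by auto
    ultimately show False using m(3) m(5)[OF p(1)] by linarith
  qed
  then show ?thesis using \<eta>(1) by blast
qed

section \<open>Linear algebra of exponent lattices\<close>

lemma rdot_inner: "rdot m u = (\<chi> i. of_int (m $ i)) \<bullet> u"
  by (simp add: rdot_def inner_vec_def)

lemma subspace_rdot_kernel: "subspace {x. \<forall>m\<in>G. rdot m x = 0}"
  by (simp add: subspace_def rdot_linear) (simp add: rdot_def)

lemma dim_rdot_kernel:
  fixes b :: "'n::finite \<Rightarrow> int ^ 'n"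
  assumes d: "dual b e"
  shows "dim {x. \<forall>j\<in>A. rdot (b j) x = 0} + card A = CARD('n)"
proof -
  define r where "r m = (\<chi> i. real_of_int (m $ i))" for m :: "int ^ 'n"
  have rr: "r m \<bullet> x = rdot m x" for m x by (simp add: r_def rdot_inner)
  have er: "r (e i) \<bullet> r (b j) = (if i = j then 1 else 0)" for i j
  proof -
    have "r (e i) \<bullet> r (b j) = of_int (idot (e i) (b j))" by (simp add: r_def inner_vec_def idot_def)
    then show ?thesis by (simp add: dualD(1)[OF d])
  qed
  have inj: "inj_on (r \<circ> b) A"
    by (rule inj_onI) (metis comp_apply er zero_neq_one)
  have ind: "independent ((r \<circ> b) ` A)"
  proof (rule independent_if_scalars_zero)
    show "finite ((r \<circ> b) ` A)" by simp
    fix c y assume z: "(\<Sum>x\<in>(r \<circ> b) ` A. c x *\<^sub>R x) = 0" and "y \<in> (r \<circ> b) ` A"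
    then obtain i where i: "i \<in> A" "y = r (b i)" by auto
    have "0 = r (e i) \<bullet> (\<Sum>x\<in>(r \<circ> b) ` A. c x *\<^sub>R x)" using z by simp
    also have "\<dots> = (\<Sum>j\<in>A. c (r (b j)) * (r (e i) \<bullet> r (b j)))"
      unfolding inner_sum_right sum.reindex[OF inj] by simp
    also have "\<dots> = (\<Sum>j\<in>A. if j = i then c (r (b j)) else 0)" by (intro sum.cong) (auto simp: er)
    also have "\<dots> = c y" using i by simp
    finally show "c y = 0" by simp
  qed
  have "dim (span ((r \<circ> b) ` A)) = card A"
    using dim_span_eq_card_independent[OF ind] card_image[OF inj] by simp
  moreover have "{x. \<forall>j\<in>A. rdot (b j) x = 0} = {y \<in> UNIV. \<forall>x \<in> span ((r \<circ> b) ` A). orthogonal x y}"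
  proof (intro equalityI subsetI)
    fix y assume "y \<in> {x. \<forall>j\<in>A. rdot (b j) x = 0}"
    then have y: "\<forall>z\<in>(r \<circ> b) ` A. orthogonal y z" by (auto simp: orthogonal_def inner_commute[of y] rr)
    have "orthogonal x y" if "x \<in> span ((r \<circ> b) ` A)" for x
      using orthogonal_to_span[OF that, of y] y unfolding orthogonal_commute[of _ y] by blast
    then show "y \<in> {y \<in> UNIV. \<forall>x \<in> span ((r \<circ> b) ` A). orthogonal x y}" by simp
  next
    fix y assume "y \<in> {y \<in> UNIV. \<forall>x \<in> span ((r \<circ> b) ` A). orthogonal x y}"
    then have "orthogonal (r (b j)) y" if "j \<in> A" for j
      using span_base[of "r (b j)" "(r \<circ> b) ` A"] that by auto
    then show "y \<in> {x. \<forall>j\<in>A. rdot (b j) x = 0}" by (simp add: orthogonal_def rr)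
  qed
  ultimately show ?thesis
    using dim_subspace_orthogonal_to_vectors[of "span ((r \<circ> b) ` A)" UNIV] by simp
qed

lemma rdot_lat_zero:
  assumes d: "dual b e"
  shows "(\<forall>m\<in>lat e S. rdot m x = 0) \<longleftrightarrow> (\<forall>j\<in>S. rdot (b j) x = 0)"
proof (intro iffI ballI)
  fix j assume "\<forall>m\<in>lat e S. rdot m x = 0" "j \<in> S"
  then show "rdot (b j) x = 0" using dual_in_lat[OF d] by blast
next
  fix m assume *: "\<forall>j\<in>S. rdot (b j) x = 0" and m: "m \<in> lat e S"
  have "rdot m x = (\<Sum>j\<in>UNIV. of_int (idot (e j) m) * rdot (b j) x)"
    by (subst dualD(2)[OF d, of m]) (simp add: rdot_sum_left rdot_linear)
  also have "\<dots> = 0" using * m by (intro sum.neutral) (auto simp: lat_def)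
  finally show "rdot m x = 0" .
qed

lemma rdot_basis_zero:
  assumes d: "dual b e" and "\<forall>j. rdot (b j) x = 0"
  shows "x = 0"
proof -
  have "\<forall>m\<in>lat e UNIV. rdot m x = 0" using rdot_lat_zero[OF d, of UNIV x] assms(2) by simp
  then have "\<forall>i. rdot (axis i 1) x = 0" by simp
  then show ?thesis by (simp add: rdot_axis vec_eq_iff)
qed

lemma dim_sums_le:
  fixes A B :: "'a::euclidean_space set"
  assumes "subspace A" "subspace B"
  shows "dim {x + y |x y. x \<in> A \<and> y \<in> B} \<le> dim A + dim B"
  using dim_sums_Int[OF assms] by simp

text \<open>A linear image of a closed set need not be closed.  It is if the map is injective on the
  differences of the set, where it is an embedding up to a constant.\<close>

lemma closed_image_injective_direction:
  fixes L :: "'a::euclidean_space \<Rightarrow> 'b::euclidean_space"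
  assumes L: "linear L" and D: "subspace D" and inj: "\<And>x. x \<in> D \<Longrightarrow> L x = 0 \<Longrightarrow> x = 0"
    and C: "closed C" "\<And>x y. x \<in> C \<Longrightarrow> y \<in> C \<Longrightarrow> x - y \<in> D"
  shows "closed (L ` C)"
  unfolding closed_sequential_limits
proof (intro allI impI)
  have bl: "bounded_linear L" using L by (simp add: linear_conv_bounded_linear)
  obtain c where c: "c > 0" "\<And>x. x \<in> D \<Longrightarrow> norm (L x) \<ge> c * norm x"
    using injective_imp_isometric[OF closed_subspace[OF D] D bl] inj by blast
  fix y l assume y: "(\<forall>n. y n \<in> L ` C) \<and> y \<longlonglongrightarrow> l"
  then have "\<forall>n. \<exists>x\<in>C. y n = L x" by blast
  then obtain x where x: "\<And>n. x n \<in> C" "\<And>n. y n = L (x n)" by metis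
  have "Cauchy x"
  proof (rule metric_CauchyI)
    fix \<epsilon> :: real assume "\<epsilon> > 0"
    have "Cauchy y" using y LIMSEQ_imp_Cauchy by blast
    then obtain M where M: "\<And>m n. m \<ge> M \<Longrightarrow> n \<ge> M \<Longrightarrow> dist (y m) (y n) < c * \<epsilon>"
      using metric_CauchyD[of y "c * \<epsilon>"] c(1) \<open>\<epsilon> > 0\<close> by auto
    have "dist (x m) (x n) < \<epsilon>" if "m \<ge> M" "n \<ge> M" for m n
    proof -
      have "c * norm (x m - x n) \<le> norm (L (x m - x n))" using c(2) C(2) x(1) by blast
      also have "\<dots> = dist (y m) (y n)" using x(2) by (simp add: dist_norm linear_diff[OF L])
      also have "\<dots> < c * \<epsilon>" using M that by blast
      finally show ?thesis using c(1) by (simp add: dist_norm)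
    qed
    then show "\<exists>M. \<forall>m\<ge>M. \<forall>n\<ge>M. dist (x m) (x n) < \<epsilon>" by blast
  qed
  then obtain x0 where x0: "x \<longlonglongrightarrow> x0" using Cauchy_convergent_iff convergent_def by blast
  then have "x0 \<in> C" using C(1) x(1) unfolding closed_sequential_limits by blast
  have "(\<lambda>n. L (x n)) \<longlonglongrightarrow> L x0" using bl x0 by (rule bounded_linear.tendsto)
  moreover have "(\<lambda>n. L (x n)) = y" using x(2) by auto
  ultimately have "L x0 = l" using y LIMSEQ_unique by metis
  then show "l \<in> L ` C" using \<open>x0 \<in> C\<close> by blast
qed

section \<open>The tropical variety of a prime ideal\<close>

text \<open>A prime \<open>P\<close> with a Noether normalization.  \<open>V\<close> is the set of valuations of its points, and \<open>K0\<close> is the direction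
  of the fibres of the projection of \<open>\<real>\<^sup>n\<close> to the base.\<close>

locale prime_variety =
  fixes N :: "'k::field \<Rightarrow> real" and N' :: "'k alg_closure \<Rightarrow> real"
    and P :: "('k, 'n::finite) laurent set" and b e :: "'n \<Rightarrow> int ^ 'n" and S :: "'n set"
  assumes N: "nonarch_norm N" and N': "nonarch_norm N'" and ext: "\<And>x. N' (to_ac x) = N x"
    and nontrivial: "nontrivial_norm N"
    and P: "is_prime P" and no: "noether N P b e S"
begin

abbreviation "\<Gamma> \<equiv> value_group N'"
abbreviation "gamma_points \<equiv> {u :: real ^ 'n. \<forall>i. u $ i \<in> \<Gamma>}"
abbreviation "V \<equiv> val_map N' ` variety_points P"
abbreviation "K0 \<equiv> {x. \<forall>m\<in>lat e S. rdot m x = 0}"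

lemma dual_be: "dual b e" and prime_meet: "P \<inter> supp_in (lat e S) = {0}"
  using no by (auto simp: noether_def finite_proj_def)

lemma divisible: "divisible_group \<Gamma>"
  by (rule divisible_value_group[OF N'])

lemma gamma_nonzero: obtains \<gamma> where "\<gamma> \<in> \<Gamma>" "\<gamma> \<noteq> 0"
proof -
  obtain x where x: "x \<noteq> 0" "N x \<noteq> 1" using nontrivial by (auto simp: nontrivial_norm_def)
  have "ln (N x) \<noteq> 0" using x norm_pos[OF N x(1)] by simp
  moreover have "- ln (N x) \<in> \<Gamma>"
    unfolding value_group_def using x(1) ext[of x] by (intro CollectI exI[of _ "to_ac x"]) simp
  ultimately show thesis using that[of "- ln (N x)"] by simp
qed

lemma value_group_subset: "value_group N \<subseteq> \<Gamma>"
proof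
  fix y assume "y \<in> value_group N"
  then obtain x where "x \<noteq> 0" "y = - ln (N x)" unfolding value_group_def by blast
  then show "y \<in> \<Gamma>" unfolding value_group_def using ext[of x] by (intro CollectI exI[of _ "to_ac x"]) simp
qed

lemma polyhedral_trop_gamma:
  assumes "f \<noteq> 0" shows "polyhedral \<Gamma> (trop N f)"
proof -
  obtain F where "finite F" "\<forall>C\<in>F. rational_polyhedron (value_group N) C" "trop N f = \<Union>F"
    using polyhedral_trop[OF N assms] unfolding polyhedral_def by blast
  then show ?thesis unfolding polyhedral_def
    using rational_polyhedron_mono[OF _ value_group_subset] by (intro exI[of _ F]) blast
qed

lemma gamma_point:
  fixes u :: "real ^ 'n"
  assumes "u \<in> gamma_points"
  obtains a :: "'k alg_closure ^ 'n" where "a \<in> torus" "val_map N' a = u"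
proof -
  have "\<forall>i. \<exists>x. x \<noteq> 0 \<and> u $ i = - ln (N' x)" using assms unfolding value_group_def by simp blast
  then obtain x where x: "\<And>i. x i \<noteq> 0" "\<And>i. u $ i = - ln (N' (x i))" by metis
  then show thesis using that[of "\<chi> i. x i"] by (simp add: torus_def val_map_def vec_eq_iff)
qed

lemma rdot_val_eq:
  assumes "a \<in> torus" "a' \<in> torus" "tmon a' m = tmon a m"
  shows "rdot m (val_map N' a') = rdot m (val_map N' a)"
proof -
  have "exp (- rdot m (val_map N' a')) = exp (- rdot m (val_map N' a))"
    using assms norm_tmon[OF N'] by metis
  then show ?thesis by simp
qed

lemma V_subset_seminorm_set: "V \<subseteq> seminorm_set N P"
  using seminorm_point[OF N' ext] by auto

lemma V_subset_trop_set: "V \<subseteq> trop_set N P"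
  using V_subset_seminorm_set seminorm_set_subset_trop[OF N] by blast

text \<open>A sequence of further monomials \<open>h T\<close> in general position, each with the equation \<open>f T\<close> of the
  hypersurface onto which the base coordinates and \<open>h T\<close> map the variety.  A nonzero vector in the fibre
  direction is orthogonal to few of the \<open>h T\<close>.\<close>

definition separating :: "(nat \<Rightarrow> int ^ 'n) \<Rightarrow> (nat \<Rightarrow> ('k, 'n) laurent) \<Rightarrow> bool" where
  "separating h f \<longleftrightarrow> (\<forall>T. f T \<in> P \<and> f T \<noteq> 0) \<and>
     (\<forall>T u. u \<in> trop N (f T) \<longrightarrow> u \<in> gamma_points \<longrightarrow> (\<exists>t\<in>V. t - u \<in> K0 \<and> rdot (h T) (t - u) = 0)) \<and>
     (\<forall>x. x \<in> K0 \<longrightarrow> x \<noteq> 0 \<longrightarrow>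
        finite {T. rdot (h T) x = 0} \<and> card {T. rdot (h T) x = 0} < card (- S)) \<and>
     (\<forall>T. dim {x\<in>K0. rdot (h T) x = 0} + card S + 1 = CARD('n))"

lemma
  assumes "separating h f"
  shows separating_f: "f T \<in> P" "f T \<noteq> 0"
    and separating_lift: "u \<in> trop N (f T) \<Longrightarrow> u \<in> gamma_points \<Longrightarrow> \<exists>t\<in>V. t - u \<in> K0 \<and> rdot (h T) (t - u) = 0"
    and separating_few: "x \<in> K0 \<Longrightarrow> x \<noteq> 0 \<Longrightarrow>
      finite {T. rdot (h T) x = 0} \<and> card {T. rdot (h T) x = 0} < card (- S)"
    and separating_dim: "dim {x\<in>K0. rdot (h T) x = 0} + card S + 1 = CARD('n)"
  using assms unfolding separating_def by blast+

text \<open>The monomials lie on a moment curve with respect to the basis vectors outside \<open>S\<close>.  Each of them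
  can replace one of these vectors without changing the base, so that the hypersurface projection
  applies to it; Kapranov's theorem lifts points of \<open>trop N (f T)\<close>.\<close>

lemma separating_exists:
  assumes "S \<noteq> UNIV"
  shows "\<exists>h f. separating h f"
proof -
  obtain j0 where j0: "j0 \<in> - S" using assms by blast
  from moment_curve[OF j0] obtain c :: "nat \<Rightarrow> 'n \<Rightarrow> int" where
    "(\<forall>T. c T j0 = 1) \<and> (\<forall>\<delta> :: 'n \<Rightarrow> real. (\<exists>j\<in>- S. \<delta> j \<noteq> 0) \<longrightarrow>
       finite {T. (\<Sum>j\<in>- S. of_int (c T j) * \<delta> j) = 0} \<and>
       card {T. (\<Sum>j\<in>- S. of_int (c T j) * \<delta> j) = 0} < card (- S))"
    by (rule exE)
  note c = conjunct1[OF this, rule_format] and few = conjunct2[OF this]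
  define h where "h T = (\<Sum>j\<in>- S. c T j *s b j)" for T
  define bT where "bT T = b(j0 := h T)" for T
  define eT where "eT T = (\<lambda>j. if j \<in> - S \<and> j \<noteq> j0 then e j - c T j *s e j0 else e j)" for T
  have dT: "dual (bT T) (eT T)" for T
    unfolding bT_def eT_def h_def using dual_update[of b e j0 "- S" "c T"] dual_be j0 c by blast
  have latT: "lat (eT T) S = lat e S" for T
  proof (intro equalityI subsetI)
    fix m assume m: "m \<in> lat (eT T) S"
    have m0: "idot (e j0) m = 0" using m j0 by (auto simp: lat_def eT_def dest!: spec[of _ j0])
    have "idot (e j) m = 0" if "j \<notin> S" for j
    proof (cases "j = j0")
      case False
      then have "idot (e j - c T j *s e j0) m = 0" using m that by (auto simp: lat_def eT_def dest!: spec[of _ j])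
      then show ?thesis using m0 by (simp add: idot_commute[of _ m] idot_linear_right)
    qed (use m0 in simp)
    then show "m \<in> lat e S" by (simp add: lat_def)
  next
    fix m assume "m \<in> lat e S"
    then show "m \<in> lat (eT T) S" using j0
      by (auto simp: lat_def eT_def idot_commute[of _ m] idot_linear_right)
  qed
  have noT: "noether N P (bT T) (eT T) S" for T
    using no dT[of T] unfolding noether_def finite_proj_def latT by simp
  have rl: "rdot (h T) x = (\<Sum>j\<in>- S. of_int (c T j) * rdot (b j) x)" for T x
    by (simp add: h_def rdot_sum_left rdot_linear)
  have "\<exists>f. f \<in> P \<and> f \<noteq> 0 \<and> (\<forall>u. u \<in> trop N f \<longrightarrow> u \<in> gamma_points \<longrightarrow>
       (\<exists>t\<in>V. t - u \<in> K0 \<and> rdot (h T) (t - u) = 0))" for T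
  proof -
    have "j0 \<notin> S" using j0 by simp
    obtain f where f: "f \<in> P" "f \<noteq> 0" "f \<in> supp_in (lat (eT T) (insert j0 S))"
      "\<And>a. a \<in> torus \<Longrightarrow> laurent_eval f a = 0 \<Longrightarrow>
       \<exists>a'\<in>variety_points P. \<forall>m\<in>lat (eT T) (insert j0 S). tmon a' m = tmon a m"
      using hypersurface_projection[OF noT P \<open>j0 \<notin> S\<close>] by blast
    have "\<exists>t\<in>V. t - u \<in> K0 \<and> rdot (h T) (t - u) = 0"
      if u: "u \<in> trop N f" and g: "u \<in> gamma_points" for u
    proof -
      obtain a :: "'k alg_closure ^ 'n" where a: "a \<in> torus" "val_map N' a = u" using gamma_point[OF g] .
      obtain a1 where a1: "a1 \<in> torus" "val_map N' a1 = u" "laurent_eval f a1 = 0"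
        using kapranov_hypersurface[OF N N' ext a(1), of f] u a(2) by auto
      obtain a2 where a2: "a2 \<in> variety_points P" "\<forall>m\<in>lat (eT T) (insert j0 S). tmon a2 m = tmon a1 m"
        using f(4)[OF a1(1,3)] by blast
      have t2: "a2 \<in> torus" using a2(1) by (simp add: variety_points_def)
      have eq: "rdot m (val_map N' a2 - u) = 0" if "m \<in> lat (eT T) (insert j0 S)" for m
        using rdot_val_eq[OF a1(1) t2, of m] a2(2) that a1(2) by (simp add: rdot_linear)
      have "h T \<in> lat (eT T) (insert j0 S)"
        using dual_in_lat[OF dT, of j0 "insert j0 S" T] by (simp add: bT_def)
      moreover have "lat e S \<subseteq> lat (eT T) (insert j0 S)" using latT lat_mono[of S "insert j0 S" "eT T"] by auto
      ultimately show ?thesis using eq a2(1) by (intro bexI[of _ "val_map N' a2"]) auto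
    qed
    then show ?thesis using f by blast
  qed
  then have "\<forall>T. \<exists>f. f \<in> P \<and> f \<noteq> 0 \<and> (\<forall>u. u \<in> trop N f \<longrightarrow> u \<in> gamma_points \<longrightarrow>
       (\<exists>t\<in>V. t - u \<in> K0 \<and> rdot (h T) (t - u) = 0))" by (rule allI)
  from choice[OF this] obtain f where f: "\<forall>T. f T \<in> P \<and> f T \<noteq> 0 \<and> (\<forall>u. u \<in> trop N (f T) \<longrightarrow> u \<in> gamma_points \<longrightarrow>
       (\<exists>t\<in>V. t - u \<in> K0 \<and> rdot (h T) (t - u) = 0))" by (rule exE)
  have card: "finite {T. rdot (h T) x = 0} \<and> card {T. rdot (h T) x = 0} < card (- S)"
    if x: "x \<in> K0" "x \<noteq> 0" for x
  proof -
    have "\<exists>j\<in>- S. rdot (b j) x \<noteq> 0"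
      using rdot_basis_zero[OF dual_be, of x] rdot_lat_zero[OF dual_be, of S x] x by auto
    then show ?thesis unfolding rl by (rule few[THEN spec, THEN mp])
  qed
  have dim: "dim {x\<in>K0. rdot (h T) x = 0} + card S + 1 = CARD('n)" for T
  proof -
    have "{x\<in>K0. rdot (h T) x = 0} = {x. \<forall>j\<in>insert j0 S. rdot (bT T j) x = 0}"
      using j0 rdot_lat_zero[OF dual_be, of S] by (auto simp: bT_def)
    moreover have "card (insert j0 S) = card S + 1" using j0 by simp
    ultimately show ?thesis using dim_rdot_kernel[OF dT, of "insert j0 S" T] by simp
  qed
  have "separating h f" unfolding separating_def using f card dim by blast
  then show ?thesis by blast
qed

lemma S_UNIV_point:
  assumes "S = UNIV"
  shows "P = {0}" "u \<in> gamma_points \<Longrightarrow> u \<in> V"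
proof -
  show P0: "P = {0}" using prime_meet assms by simp
  assume "u \<in> gamma_points"
  then obtain a :: "'k alg_closure ^ 'n" where a: "a \<in> torus" "val_map N' a = u" by (rule gamma_point)
  then have "a \<in> variety_points P" by (simp add: variety_points_def P0 laurent_eval_def)
  then show "u \<in> V" using a by blast
qed

text \<open>A common point \<open>u\<close> of the hypersurfaces of sufficiently many \<open>f T\<close> is the tropicalization of a
  point of the variety: each \<open>f T\<close> yields such a point \<open>t\<close> in the finite fibre through \<open>u\<close> with
  \<open>h T\<cdot>t = h T\<cdot>u\<close>, and a \<open>t \<noteq> u\<close> serves only few \<open>T\<close>.\<close>

lemma finite_tropical_basis:
  "\<exists>B. finite B \<and> B \<subseteq> P \<and> 0 \<notin> B \<and> (\<forall>u. (\<forall>f\<in>B. u \<in> trop N f) \<longrightarrow> u \<in> gamma_points \<longrightarrow> u \<in> V)"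
proof (cases "S = UNIV")
  case True
  then show ?thesis using S_UNIV_point(2) by (intro exI[of _ "{}"]) simp
next
  case False
  obtain h f where sep: "separating h f" using separating_exists[OF False] by blast
  note f = separating_f[OF sep] and lift = separating_lift[OF sep] and few = separating_few[OF sep]
  have "\<exists>M. \<forall>u. finite (fibre (trop_set N P) (lat e S) u) \<and> card (fibre (trop_set N P) (lat e S) u) \<le> M"
    using no by (simp add: noether_def finite_proj_def)
  then obtain M where "\<forall>u. finite (fibre (trop_set N P) (lat e S) u) \<and> card (fibre (trop_set N P) (lat e S) u) \<le> M"
    by (rule exE)
  then have M: "\<And>u. finite (fibre (trop_set N P) (lat e S) u)"
    "\<And>u. card (fibre (trop_set N P) (lat e S) u) \<le> M" by simp_all
  define n where "n = Suc (M * card (- S))"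
  have "u \<in> V" if u: "\<forall>g\<in>f ` {..<n}. u \<in> trop N g" "u \<in> gamma_points" for u
  proof (rule ccontr)
    assume nV: "u \<notin> V"
    let ?F = "fibre (trop_set N P) (lat e S) u - {u}" and ?bad = "\<lambda>t. {T. rdot (h T) (t - u) = 0}"
    have bad: "finite (?bad t) \<and> card (?bad t) < card (- S)" if "t \<in> ?F" for t
    proof -
      have "t - u \<in> K0" "t - u \<noteq> 0" using that by (auto simp: fibre_def rdot_linear)
      then show ?thesis by (rule few)
    qed
    have "{..<n} \<subseteq> (\<Union>t\<in>?F. ?bad t)"
    proof
      fix T assume "T \<in> {..<n}"
      then obtain t where t: "t \<in> V" "t - u \<in> K0" "rdot (h T) (t - u) = 0" using lift[of u T] u by blast
      then have "t \<in> ?F" using nV V_subset_trop_set by (auto simp: fibre_def rdot_linear)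
      then show "T \<in> (\<Union>t\<in>?F. ?bad t)" using t(3) by blast
    qed
    then have "n \<le> card (\<Union>t\<in>?F. ?bad t)"
      using card_mono[of "\<Union>t\<in>?F. ?bad t" "{..<n}"] bad M(1)[of u] by auto
    also have "\<dots> \<le> (\<Sum>t\<in>?F. card (?bad t))" using M(1)[of u] by (intro card_UN_le) simp
    also have "\<dots> \<le> (\<Sum>t\<in>?F. card (- S))" using bad by (intro sum_mono) (auto intro: less_imp_le)
    also have "\<dots> \<le> M * card (- S)"
      using M[of u] by (simp add: le_trans[OF card_Diff1_le])
    finally show False by (simp add: n_def)
  qed
  then show ?thesis using f by (intro exI[of _ "f ` {..<n}"]) force
qed

text \<open>The circle of inclusions that is closed by the finite tropical basis and the density of the points over
  the value group.\<close>

theorem closure_points_eq: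
  shows "closure V = seminorm_set N P" and "closure V = trop_set N P" and "polyhedral \<Gamma> (closure V)"
proof -
  obtain \<gamma> where \<gamma>: "\<gamma> \<in> \<Gamma>" "\<gamma> \<noteq> 0" using gamma_nonzero .
  from finite_tropical_basis obtain B where "finite B \<and> B \<subseteq> P \<and> 0 \<notin> B \<and>
      (\<forall>u. (\<forall>f\<in>B. u \<in> trop N f) \<longrightarrow> u \<in> gamma_points \<longrightarrow> u \<in> V)" by (rule exE)
  then have B: "finite B" "B \<subseteq> P" "0 \<notin> B"
    "\<And>u. (\<forall>f\<in>B. u \<in> trop N f) \<Longrightarrow> u \<in> gamma_points \<Longrightarrow> u \<in> V" by simp_all
  let ?Q = "\<Inter>f\<in>B. trop N f"
  have poly: "polyhedral \<Gamma> ?Q"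
  proof (rule polyhedral_INT[OF B(1)])
    fix f assume "f \<in> B"
    then show "polyhedral \<Gamma> (trop N f)" using B(3) by (intro polyhedral_trop_gamma) auto
  qed
  have 1: "closure V \<subseteq> seminorm_set N P"
    using V_subset_seminorm_set closed_seminorm_set[OF N] by (rule closure_minimal)
  have 2: "seminorm_set N P \<subseteq> trop_set N P" by (rule seminorm_set_subset_trop[OF N])
  have 3: "trop_set N P \<subseteq> ?Q" unfolding trop_set_def using B(2) by blast
  have 4: "?Q \<subseteq> closure V"
  proof
    fix u assume u: "u \<in> ?Q"
    show "u \<in> closure V" unfolding closure_approachable
    proof (intro allI impI)
      fix \<epsilon> :: real assume "\<epsilon> > 0"
      then obtain u' where "u' \<in> ?Q" "u' \<in> gamma_points" "dist u' u < \<epsilon>"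
        using polyhedral_dense[OF divisible \<gamma> _ poly u] by blast
      then show "\<exists>y\<in>V. dist y u < \<epsilon>" using B(4) by blast
    qed
  qed
  show "closure V = seminorm_set N P" "closure V = trop_set N P" using 1 2 3 4 by blast+
  have "closure V = ?Q" using 1 2 3 4 by blast
  then show "polyhedral \<Gamma> (closure V)" using poly by simp
qed

lemma dim_K0: "dim K0 + card S = CARD('n)"
  using dim_rdot_kernel[OF dual_be, of S] rdot_lat_zero[OF dual_be, of S] by simp

text \<open>\<open>C\<close> lies in the affine space through \<open>p\<close> with direction space \<open>D\<close>, spans it, and \<open>D\<close> meets the fibres
  of the projection to the base in points.\<close>

definition transversal :: "(real ^ 'n) set \<Rightarrow> real ^ 'n \<Rightarrow> (real ^ 'n) set \<Rightarrow> bool" where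
  "transversal C p D \<longleftrightarrow> subspace D \<and> (\<forall>x\<in>C. x - p \<in> D) \<and> D \<inter> K0 \<subseteq> {0} \<and>
     aff_dim C = int (dim D) \<and> dim D \<le> card S"

lemma
  assumes "transversal C p D"
  shows transversal_subspace: "subspace D" and transversal_diff: "x \<in> C \<Longrightarrow> x - p \<in> D"
    and transversal_meet: "D \<inter> K0 \<subseteq> {0}" and transversal_dim: "aff_dim C = int (dim D)" "dim D \<le> card S"
  using assms unfolding transversal_def by blast+

text \<open>A convex subset of the tropical variety meets the fibres in points, so that its direction space
  is transversal to the fibre direction.\<close>

lemma convex_direction:
  assumes C: "convex C" "C \<noteq> {}" "C \<subseteq> trop_set N P"
  shows "\<exists>p D. transversal C p D"
proof -
  obtain p where p: "p \<in> rel_interior C" using C rel_interior_eq_empty by blast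
  define D where "D = span ((\<lambda>x. - p + x) ` C)"
  have pC: "p \<in> C" using p rel_interior_subset by blast
  then have ph: "p \<in> affine hull C" by (simp add: hull_inc)
  have D: "subspace D" unfolding D_def by simp
  have xD: "x - p \<in> D" if "x \<in> C" for x
    unfolding D_def using that by (intro span_base) (auto intro!: image_eqI[of _ _ x])
  have hull: "affine hull C = (\<lambda>x. p + x) ` D" unfolding D_def by (rule affine_hull_span_gen[OF ph])
  have dimD: "aff_dim C = int (dim D)" unfolding D_def by (simp add: aff_dim_eq_dim[OF ph])
  have DK: "D \<inter> K0 \<subseteq> {0}"
  proof
    fix d assume d: "d \<in> D \<inter> K0"
    show "d \<in> {0}"
    proof (rule ccontr)
      assume "d \<notin> {0}"
      then have d0: "norm d > 0" by simp
      obtain \<epsilon> where \<epsilon>: "\<epsilon> > 0" "ball p \<epsilon> \<inter> affine hull C \<subseteq> C" using p mem_rel_interior_ball by blast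
      let ?I = "{0<..<\<epsilon> / norm d}"
      have "(\<lambda>t. p + t *\<^sub>R d) ` ?I \<subseteq> fibre (trop_set N P) (lat e S) p"
      proof (intro image_subsetI)
        fix t assume t: "t \<in> ?I"
        have "p + t *\<^sub>R d \<in> affine hull C" unfolding hull using d D by (auto intro!: imageI subspace_scale)
        moreover have "p + t *\<^sub>R d \<in> ball p \<epsilon>" using t d0 by (simp add: dist_norm field_simps)
        ultimately have "p + t *\<^sub>R d \<in> trop_set N P" using \<epsilon>(2) C(3) by blast
        then show "p + t *\<^sub>R d \<in> fibre (trop_set N P) (lat e S) p" using d by (simp add: fibre_def rdot_linear)
      qed
      moreover have "finite (fibre (trop_set N P) (lat e S) p)" using no by (auto simp: noether_def finite_proj_def)
      ultimately have "finite ((\<lambda>t. p + t *\<^sub>R d) ` ?I)" using finite_subset by blast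
      moreover have "inj_on (\<lambda>t. p + t *\<^sub>R d) ?I" using d0 by (auto intro!: inj_onI)
      ultimately have "finite ?I" by (rule finite_imageD)
      moreover have "infinite ?I" using \<epsilon>(1) d0 by (simp add: infinite_Ioo)
      ultimately show False by blast
    qed
  qed
  have "dim D + dim K0 \<le> CARD('n)"
  proof -
    have "dim {x + y |x y. x \<in> D \<and> y \<in> K0} + dim (D \<inter> K0) = dim D + dim K0"
      by (rule dim_sums_Int[OF D subspace_rdot_kernel])
    moreover have "dim (D \<inter> K0) = 0" using DK by (simp add: subset_singleton_iff dim_eq_0)
    moreover have "dim {x + y |x y. x \<in> D \<and> y \<in> K0} \<le> CARD('n)"
      using dim_subset_UNIV[of "{x + y |x y. x \<in> D \<and> y \<in> K0}"] by simp
    ultimately show ?thesis by linarith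
  qed
  then have "dim D \<le> card S" using dim_K0 by linarith
  then have "transversal C p D" unfolding transversal_def using D xD DK dimD by blast
  then show ?thesis by blast
qed

text \<open>Purity.  If the polyhedra of full dimension \<open>card S\<close> missed a point \<open>u\<close>, choose \<open>h T\<close> separating \<open>u\<close>
  from the rest of its fibre.  Near \<open>u\<close> the hypersurface of \<open>f T\<close> would then be covered by affine spaces of
  codimension at least two, whereas it is transversal to a generic direction.\<close>

lemma full_dimensional_cover:
  assumes F: "finite F" "\<forall>C\<in>F. rational_polyhedron \<Gamma> C" "trop_set N P = \<Union>F" and "S \<noteq> UNIV"
  shows "trop_set N P = \<Union>{C\<in>F. aff_dim C = int (card S)}"
proof (rule ccontr)
  let ?Q = "trop_set N P" and ?F1 = "{C\<in>F. aff_dim C = int (card S)}"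
  assume "?Q \<noteq> \<Union>?F1"
  then obtain u where u: "u \<in> ?Q" "u \<notin> \<Union>?F1" using F(3) by auto
  obtain \<gamma> where \<gamma>: "\<gamma> \<in> \<Gamma>" "\<gamma> \<noteq> 0" using gamma_nonzero .
  obtain h f where sep: "separating h f" using separating_exists[OF \<open>S \<noteq> UNIV\<close>] by blast
  note f = separating_f[OF sep] and lift = separating_lift[OF sep] and few = separating_few[OF sep]
    and dimK = separating_dim[OF sep]
  let ?\<Phi> = "fibre ?Q (lat e S) u"
  have fin\<Phi>: "finite ?\<Phi>" using no by (auto simp: noether_def finite_proj_def)
  have "finite (\<Union>t\<in>?\<Phi> - {u}. {T. rdot (h T) (t - u) = 0})"
  proof (intro finite_UN_I)
    fix t assume "t \<in> ?\<Phi> - {u}"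
    then have "t - u \<in> K0" "t - u \<noteq> 0" by (auto simp: fibre_def rdot_linear)
    then show "finite {T. rdot (h T) (t - u) = 0}" using few by blast
  qed (use fin\<Phi> in simp)
  then obtain T where T: "T \<notin> (\<Union>t\<in>?\<Phi> - {u}. {T. rdot (h T) (t - u) = 0})"
    using ex_new_if_finite[OF infinite_UNIV_nat] by blast
  let ?K = "{x\<in>K0. rdot (h T) x = 0}"
  have Ksub: "subspace ?K"
    using subspace_rdot_kernel[of "lat e S"] by (simp add: subspace_def rdot_linear) (simp add: rdot_def)
  obtain j0 where j0: "j0 \<notin> S" using \<open>S \<noteq> UNIV\<close> by blast
  \<comment> \<open>\<open>L\<close> is the projection to the base coordinates and \<open>h T\<close>, with \<open>?K\<close> as its kernel; by the choice of \<open>T\<close>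
    it separates \<open>u\<close> from the polyhedra of dimension \<open>card S\<close>\<close>
  define L :: "real ^ 'n \<Rightarrow> real ^ 'n" where
    "L x = (\<chi> i. if i \<in> S then rdot (b i) x else if i = j0 then rdot (h T) x else 0)" for x
  have L: "linear L" by (rule linearI) (auto simp: L_def vec_eq_iff rdot_linear)
  have Lker: "L x = 0 \<longleftrightarrow> x \<in> ?K" for x
    using j0 rdot_lat_zero[OF dual_be, of S x] by (auto simp: L_def vec_eq_iff split: if_splits)
  have Leq: "L x = L y \<longleftrightarrow> x - y \<in> ?K" for x y unfolding Lker[symmetric] linear_diff[OF L] by simp
  have dir: "\<exists>p D. transversal C p D" if "C \<in> F" "C \<noteq> {}" for C
  proof (rule convex_direction)
    show "convex C" "C \<noteq> {}" "C \<subseteq> ?Q" using that F convex_rational_polyhedron by blast+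
  qed
  have "closed (\<Union>C\<in>?F1. L ` C)"
  proof (rule closed_UN)
    show "finite ?F1" using F(1) by simp
    show "\<forall>C\<in>?F1. closed (L ` C)"
    proof
      fix C assume C: "C \<in> ?F1"
      show "closed (L ` C)"
      proof (cases "C = {}")
        case False
        then obtain p D where tr: "transversal C p D" using dir[of C] C by blast
        note D = transversal_subspace[OF tr] transversal_diff[OF tr] transversal_meet[OF tr]
        show ?thesis
        proof (rule closed_image_injective_direction[OF L D(1)])
          show "x \<in> D \<Longrightarrow> L x = 0 \<Longrightarrow> x = 0" for x using D(3) Lker[of x] by blast
          show "closed C" using C F closed_rational_polyhedron by blast
          show "x \<in> C \<Longrightarrow> y \<in> C \<Longrightarrow> x - y \<in> D" for x y
            using subspace_diff[OF D(1), of "x - p" "y - p"] D(2) by simp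
        qed
      qed simp
    qed
  qed
  then have cl: "closed (L ` \<Union>?F1)" by (simp only: image_Union)
  have Lu: "L u \<notin> L ` \<Union>?F1"
  proof
    assume "L u \<in> L ` \<Union>?F1"
    then obtain x where x1: "L u = L x" and x: "x \<in> \<Union>?F1" by (rule imageE)
    have xK: "x - u \<in> ?K" using x1 Leq[of x u] by simp
    have "x \<in> ?Q" using x F(3) by blast
    then have "x \<in> ?\<Phi>" using xK by (simp add: fibre_def rdot_linear)
    moreover have "x \<noteq> u" using x u(2) by blast
    ultimately have "T \<in> (\<Union>t\<in>?\<Phi> - {u}. {T. rdot (h T) (t - u) = 0})"
      using xK by (intro UN_I[of x]) simp_all
    then show False using T by (rule notE[rotated])
  qed
  have "continuous_on UNIV L" using L by (intro linear_continuous_on) (simp add: linear_conv_bounded_linear)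
  then have op: "open (L -` (- (L ` \<Union>?F1)))" using cl by (intro open_vimage) auto
  have "u \<in> L -` (- (L ` \<Union>?F1))" by (rule vimageI2, rule ComplI, erule notE[OF Lu])
  with op obtain \<eta> where e0: "\<eta> > 0" "\<forall>x. dist x u < \<eta> \<longrightarrow> x \<in> L -` (- (L ` \<Union>?F1))"
    unfolding open_dist by blast
  have \<eta>: "\<eta> > 0" "\<And>x. dist x u < \<eta> \<Longrightarrow> L x \<notin> L ` \<Union>?F1"
    using e0 by (simp_all add: vimage_def)
  have "\<forall>C. \<exists>p D. C \<in> F \<longrightarrow> C \<noteq> {} \<longrightarrow> transversal C p D"
    using dir by blast
  then obtain p D where pD: "\<And>C. C \<in> F \<Longrightarrow> C \<noteq> {} \<Longrightarrow> transversal C (p C) (D C)" by metis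
  let ?F2 = "{C\<in>F. C \<noteq> {} \<and> C \<notin> ?F1}"
  define A where "A C = {x + y |x y. x \<in> D C \<and> y \<in> ?K}" for C
  have Asub: "subspace (A C)" if "C \<in> ?F2" for C
    unfolding A_def using transversal_subspace[OF pD, of C] that Ksub by (intro subspace_sums) auto
  \<comment> \<open>points of the hypersurface near \<open>u\<close> come from the polyhedra of smaller dimension, moved by the
    kernel of \<open>L\<close>: first for points over the value group, then for their limits\<close>
  have near: "y \<in> (\<Union>C\<in>?F2. (+) (p C) ` A C)" if y: "y \<in> trop N (f T)" "dist y u < \<eta>" for y
  proof -
    have "closed (\<Union>C\<in>?F2. (+) (p C) ` A C)"
      using F(1) Asub by (intro closed_UN) (auto intro: closed_translation closed_subspace)
    moreover have "y \<in> closure (\<Union>C\<in>?F2. (+) (p C) ` A C)"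
      unfolding closure_approachable
    proof (intro allI impI)
      fix \<epsilon> :: real assume "\<epsilon> > 0"
      then have "min \<epsilon> (\<eta> - dist y u) > 0" using y by simp
      from polyhedral_dense[OF divisible \<gamma> this polyhedral_trop_gamma[OF f(2)] y(1)]
      obtain z where z: "z \<in> trop N (f T)" "z \<in> gamma_points" "dist z y < min \<epsilon> (\<eta> - dist y u)"
        by blast
      obtain t where t: "t \<in> V" "t - z \<in> ?K" using lift[OF z(1,2)] by blast
      have "dist z u < \<eta>" using z(3) dist_triangle[of z u y] by simp
      then have "L z \<notin> L ` \<Union>?F1" by (rule \<eta>(2))
      moreover have "L t = L z" using t(2) by (simp only: Leq)
      ultimately have "t \<notin> \<Union>?F1" by (metis imageI)
      moreover have "t \<in> \<Union>F" using t(1) V_subset_trop_set F(3) by blast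
      ultimately obtain C where C: "C \<in> ?F2" "t \<in> C" by blast
      have "t - p C \<in> D C" using transversal_diff[OF pD, of C t] C by blast
      moreover have "z - t \<in> ?K" using subspace_neg[OF Ksub t(2)] by simp
      ultimately have "(t - p C) + (z - t) \<in> A C" unfolding A_def by blast
      then have "z \<in> (+) (p C) ` A C" by (rule image_eqI[rotated]) simp
      then show "\<exists>z\<in>(\<Union>C\<in>?F2. (+) (p C) ` A C). dist z y < \<epsilon>" using C(1) z(3) by auto
    qed
    ultimately show ?thesis by simp
  qed
  obtain \<delta> where inj: "inj_on (idot \<delta>) (Poly_Mapping.keys (f T))"
    using inj_direction_exists[of "Poly_Mapping.keys (f T)"] by auto
  let ?d = "(\<chi> i. of_int (\<delta> $ i)) :: real ^ 'n"
  define \<epsilon> where "\<epsilon> = \<eta> / (2 * (norm ?d + 1))"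
  have \<epsilon>: "\<epsilon> > 0" unfolding \<epsilon>_def using \<eta>(1) by (auto intro!: divide_pos_pos add_nonneg_pos)
  have \<epsilon>d: "\<epsilon> * norm ?d \<le> \<eta> / 2"
  proof -
    have "\<epsilon> * norm ?d \<le> \<epsilon> * (norm ?d + 1)" using \<epsilon> by simp
    also have "\<dots> = \<eta> / 2" unfolding \<epsilon>_def using norm_ge_zero[of ?d] by (simp add: field_simps add_nonneg_eq_0_iff)
    finally show ?thesis .
  qed
  have "u \<in> trop N (f T)" using u(1) f(1) by (auto simp: trop_set_def)
  then obtain \<eta>1 where \<eta>1: "\<eta>1 > 0"
    "\<And>x. dist x u < \<eta>1 \<Longrightarrow> \<exists>t. \<bar>t\<bar> \<le> \<epsilon> \<and> x + t *\<^sub>R ?d \<in> trop N (f T)"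
    using trop_transversal[OF f(2) _ inj \<epsilon>] by blast
  define W where "W C = {x + y |x y. x \<in> A C \<and> y \<in> span {?d}}" for C
  have cover: "ball u (min \<eta>1 (\<eta> / 2)) \<subseteq> (\<Union>C\<in>?F2. (+) (p C) ` W C)"
  proof
    fix x assume "x \<in> ball u (min \<eta>1 (\<eta> / 2))"
    then have x: "dist x u < \<eta>1" "dist x u < \<eta> / 2" by (auto simp: dist_commute)
    obtain t where t: "\<bar>t\<bar> \<le> \<epsilon>" "x + t *\<^sub>R ?d \<in> trop N (f T)" using \<eta>1(2)[OF x(1)] by blast
    have "dist (x + t *\<^sub>R ?d) u \<le> dist x u + norm (t *\<^sub>R ?d)"
      using norm_triangle_ineq[of "x - u" "t *\<^sub>R ?d"] by (simp add: dist_norm algebra_simps)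
    also have "norm (t *\<^sub>R ?d) \<le> \<epsilon> * norm ?d" using t(1) by (simp add: mult_right_mono)
    also have "dist x u + \<epsilon> * norm ?d < \<eta>" using x(2) \<epsilon>d by linarith
    finally have "dist (x + t *\<^sub>R ?d) u < \<eta>" by simp
    then obtain C a where C: "C \<in> ?F2" "a \<in> A C" "x + t *\<^sub>R ?d = p C + a" using near[OF t(2)] by blast
    have xe: "x = p C + (a + (- t) *\<^sub>R ?d)" using C(3) by (simp add: algebra_simps)
    have "(- t) *\<^sub>R ?d \<in> span {?d}" by (intro span_scale span_base) simp
    then have "a + (- t) *\<^sub>R ?d \<in> W C" unfolding W_def using C(2) by blast
    then have "x \<in> (+) (p C) ` W C" using xe by (rule image_eqI[rotated])
    then show "x \<in> (\<Union>C\<in>?F2. (+) (p C) ` W C)" using C(1) by blast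
  qed
  have "negligible (\<Union>C\<in>?F2. (+) (p C) ` W C)"
  proof (rule negligible_Union)
    show "finite ((\<lambda>C. (+) (p C) ` W C) ` ?F2)" using F(1) by simp
    fix X assume "X \<in> (\<lambda>C. (+) (p C) ` W C) ` ?F2"
    then obtain C where C: "C \<in> ?F2" "X = (+) (p C) ` W C" by blast
    have "dim (D C) < card S" using transversal_dim[OF pD, of C] C(1) by auto
    moreover have "dim (A C) \<le> dim (D C) + dim ?K"
      unfolding A_def using transversal_subspace[OF pD, of C] C(1) Ksub by (intro dim_sums_le) auto
    moreover have "dim (W C) \<le> dim (A C) + dim (span {?d})" unfolding W_def using Asub[OF C(1)] by (intro dim_sums_le) auto
    moreover have "dim (span {?d}) \<le> 1" using dim_le_card[of "{?d}" "{?d}"] by (simp add: span_superset)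
    ultimately have "dim (W C) < CARD('n)" using dimK[of T] by linarith
    then have "negligible (W C)" by (intro negligible_lowdim) simp
    then show "negligible X" unfolding C(2) by (rule negligible_translation)
  qed
  then have "negligible (ball u (min \<eta>1 (\<eta> / 2)))" using cover negligible_subset by blast
  moreover have "\<not> negligible (ball u (min \<eta>1 (\<eta> / 2)))"
    using \<eta>(1) \<eta>1(1) by (intro open_not_negligible) auto
  ultimately show False by blast
qed

theorem trop_set_pure: "pure_rational_polyhedral_set \<Gamma> (card S) (trop_set N P)"
proof (cases "S = UNIV")
  case True
  then have "trop_set N P = UNIV" using S_UNIV_point(1) by (auto simp: trop_set_def trop_def)
  then show ?thesis unfolding pure_rational_polyhedral_set_def using True
    by (intro exI[of _ "{UNIV}"]) (simp add: aff_dim_UNIV)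
next
  case False
  obtain F where F: "finite F" "\<forall>C\<in>F. rational_polyhedron \<Gamma> C" "trop_set N P = \<Union>F"
    using closure_points_eq(2,3) unfolding polyhedral_def by auto
  show ?thesis unfolding pure_rational_polyhedral_set_def
    using full_dimensional_cover[OF F False] F
    by (intro exI[of _ "{C\<in>F. aff_dim C = int (card S)}"]) auto
qed

end

section \<open>Chains of prime ideals\<close>

lemma noether_of_prime:
  assumes "is_prime P"
  obtains b e S where "noether N P b e S"
proof -
  have "\<exists>b e S. noether N P b e S"
    using noether_exists[OF assms finite_proj_trivial[OF prime_ideal[OF assms]], of N] by (elim exE conjE) (intro exI)
  then show thesis using that by (elim exE)
qed

text \<open>By incomparability the larger prime contains a nonzero element of the base, so a further
  elimination step takes place.\<close>

lemma noether_strict: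
  assumes no: "noether N P b e S" and P: "is_prime P" and P': "is_prime P'" and sub: "P \<subset> P'"
  obtains b' e' S' where "noether N P' b' e' S'" "card S' < card S"
proof -
  obtain E where E: "finite_mod (supp_in (lat e S)) E P" using no by (auto simp: noether_def finite_proj_def)
  obtain g where g: "g \<in> P'" "g \<notin> P" using sub by blast
  obtain c where c: "c \<in> supp_in (lat e S)" "c \<in> P'" "c \<notin> P"
    using incomparability[OF subring_lat P E prime_ideal[OF P'] _ g] sub by blast
  have "c \<noteq> 0" using c(3) ideal_0[OF prime_ideal[OF P]] by blast
  then have "P' \<inter> supp_in (lat e S) \<noteq> {0}" using c by blast
  moreover have "finite_proj N P' b e S" using no sub finite_proj_mono unfolding noether_def by blast
  ultimately show thesis using noether_exists[OF P', of N b e S] that by blast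
qed

text \<open>Setting the base monomial with exponent \<open>b i\<close> equal to one is a retraction \<open>\<sigma>\<close> of the base onto one of rank one
  less.  A prime \<open>Q\<close> that lies over the kernel of \<open>\<sigma>\<close> is finite over the smaller base, and its tropical
  variety is orthogonal to \<open>b i\<close>, so that its fibres are contained in fibres of the old projection.\<close>

lemma noether_drop:
  fixes P :: "('k::field, 'n::finite) laurent set"
  assumes N: "nonarch_norm N" and no: "noether N P b e S" and P: "is_prime P" and i: "i \<in> S"
  obtains Q where "is_prime Q" "P \<subset> Q" "noether N Q b e (S - {i})"
proof -
  let ?B = "supp_in (lat e S) :: ('k, 'n) laurent set"
  let ?B' = "supp_in (lat e (S - {i})) :: ('k, 'n) laurent set"
  have d: "dual b e" and PB: "P \<inter> ?B = {0}" using no by (auto simp: noether_def finite_proj_def)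
  obtain E where E: "finite_mod ?B E P" using no by (auto simp: noether_def finite_proj_def)
  define \<pi> where "\<pi> m = m - idot (e i) m *s b i" for m
  have pi_lat: "\<pi> m \<in> lat e (S - {i})" if "m \<in> lat e S" for m
    unfolding \<pi>_def using lat_split[OF d, of m i "S - {i}"] that i by (simp add: insert_absorb)
  have pi_id: "\<pi> m = m" if "m \<in> lat e (S - {i})" for m using that by (simp add: \<pi>_def lat_def)
  define \<sigma> where "\<sigma> = lift (Poly_Mapping.single 0) (\<lambda>m. lmon (\<pi> m) :: ('k, 'n) laurent)"
  have ld: "lift_data (Poly_Mapping.single 0) (\<lambda>m. lmon (\<pi> m) :: ('k, 'n) laurent)"
  proof -
    have "\<pi> (m + m') = \<pi> m + \<pi> m'" for m m' by (simp add: \<pi>_def idot_linear_right vec_eq_iff algebra_simps)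
    moreover have "\<pi> 0 = 0" by (simp add: \<pi>_def vec_eq_iff)
    ultimately show ?thesis by (simp add: lift_data_def single_add mult_single lmon_add)
  qed
  have hom: "is_hom \<sigma>" unfolding \<sigma>_def by (rule hom_lift[OF ld])
  have sB: "\<sigma> g \<in> ?B'" if "g \<in> ?B" for g
    unfolding \<sigma>_def lift_def
  proof (intro subring_sum subring_mult subring_lat)
    fix m assume "m \<in> Poly_Mapping.keys g"
    then have "m \<in> lat e S" using that by (auto simp: supp_in_def)
    then show "lmon (\<pi> m) \<in> ?B'" using pi_lat by simp
    show "Poly_Mapping.single 0 (Poly_Mapping.lookup g m) \<in> ?B'" by (simp add: lat_def)
  qed
  have s_id: "\<sigma> g = g" if "g \<in> ?B'" for g
  proof -
    have "\<sigma> g = (\<Sum>m\<in>Poly_Mapping.keys g. Poly_Mapping.single m (Poly_Mapping.lookup g m))"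
      unfolding \<sigma>_def lift_def
      by (intro sum.cong refl) (use that in \<open>auto simp: supp_in_def pi_id lmon_def mult_single\<close>)
    also have "\<dots> = g" by (rule laurent_expand[symmetric]) auto
    finally show ?thesis .
  qed
  have BB': "?B' \<subseteq> ?B" by (intro supp_in_mono lat_mono) auto
  define \<mm> where "\<mm> = {g\<in>?B. \<sigma> g \<in> P}"
  note Pi = prime_ideal[OF P]
  have pm: "prime_in ?B \<mm>" unfolding prime_in_def
  proof (intro conjI ballI impI)
    show "0 \<in> \<mm>" using subring_0[OF subring_lat] ideal_0[OF Pi] by (simp add: \<mm>_def hom_0[OF hom])
    show "1 \<notin> \<mm>" using prime_1[OF P] by (simp add: \<mm>_def hom_1[OF hom])
    show "x + y \<in> \<mm>" if "x \<in> \<mm>" "y \<in> \<mm>" for x y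
      using that ideal_add[OF Pi] subring_add[OF subring_lat] by (auto simp: \<mm>_def hom_add[OF hom])
    show "c * x \<in> \<mm>" if "c \<in> ?B" "x \<in> \<mm>" for c x
      using that ideal_mult[OF Pi] subring_mult[OF subring_lat] by (auto simp: \<mm>_def hom_mult[OF hom])
    show "x \<in> \<mm> \<or> y \<in> \<mm>" if "x \<in> ?B" "y \<in> ?B" "x * y \<in> \<mm>" for x y
      using that prime_multD[OF P] by (auto simp: \<mm>_def hom_mult[OF hom])
  qed (auto simp: \<mm>_def)
  have "P \<inter> ?B \<subseteq> \<mm>" using PB pm by (auto simp: prime_in_def)
  then obtain Q where Q: "is_prime Q" "P \<subseteq> Q" "Q \<inter> ?B = \<mm>"
    using lying_over[OF subring_lat Pi E pm] by blast
  define z where "z = (lmon (b i) - 1 :: ('k, 'n) laurent)"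
  have zB: "z \<in> ?B" unfolding z_def using dual_in_lat[OF d i]
    by (intro subring_diff subring_1 subring_lat) simp
  have "\<pi> (b i) = 0" by (simp add: \<pi>_def dualD(1)[OF d])
  then have "\<sigma> z = 0" unfolding z_def hom_diff[OF hom] hom_1[OF hom] unfolding \<sigma>_def lift_lmon[OF ld] by simp
  then have "z \<in> \<mm>" unfolding \<mm>_def using zB ideal_0[OF Pi] by simp
  then have zQ: "z \<in> Q" using Q(3) by blast
  have bi0: "b i \<noteq> 0" using dualD(1)[OF d, of i i] by auto
  have keys_z: "Poly_Mapping.keys z = {b i, 0}"
  proof -
    have "Poly_Mapping.lookup z m = (if m = b i then 1 else if m = 0 then - 1 else 0)" for m
      using bi0 by (auto simp: z_def lmon_def lookup_minus lookup_single lookup_one when_def)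
    then show ?thesis by (auto simp: in_keys_iff split: if_splits)
  qed
  then have "z \<noteq> 0" by auto
  then have "z \<notin> P" using PB zB by blast
  then have "P \<subset> Q" using Q(2) zQ by blast
  moreover have "noether N Q b e (S - {i})" unfolding noether_def finite_proj_def
  proof (intro conjI d)
    have "finite_mod ?B' E Q" unfolding finite_mod_def
    proof (intro conjI allI)
      show "finite E" using E by (simp add: finite_mod_def)
      fix g
      obtain c where c: "\<forall>x\<in>E. c x \<in> ?B" "g - (\<Sum>x\<in>E. c x * x) \<in> P" using E unfolding finite_mod_def by blast
      have cs: "c x - \<sigma> (c x) \<in> Q" if "x \<in> E" for x
      proof -
        have "c x \<in> ?B" "\<sigma> (c x) \<in> ?B'" using c that sB by auto
        then have "c x - \<sigma> (c x) \<in> ?B" "\<sigma> (c x - \<sigma> (c x)) = 0"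
          using BB' s_id[of "\<sigma> (c x)"] by (auto intro!: subring_diff[OF subring_lat] simp: hom_diff[OF hom])
        then have "c x - \<sigma> (c x) \<in> \<mm>" using ideal_0[OF Pi] by (simp add: \<mm>_def)
        then show ?thesis using Q(3) by blast
      qed
      have "g - (\<Sum>x\<in>E. \<sigma> (c x) * x) = (g - (\<Sum>x\<in>E. c x * x)) + (\<Sum>x\<in>E. (c x - \<sigma> (c x)) * x)"
        by (simp add: left_diff_distrib sum_subtractf)
      also have "\<dots> \<in> Q"
        using c(2) Q(2) cs by (intro ideal_add ideal_sum ideal_mult2 prime_ideal[OF Q(1)]) auto
      finally show "\<exists>c. (\<forall>x\<in>E. c x \<in> ?B') \<and> g - (\<Sum>x\<in>E. c x * x) \<in> Q"
        using c(1) sB by (intro exI[of _ "\<lambda>x. \<sigma> (c x)"]) auto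
    qed
    then show "\<exists>E. finite_mod ?B' E Q" by blast
    have "\<exists>M. \<forall>u. finite (fibre (trop_set N P) (lat e S) u) \<and> card (fibre (trop_set N P) (lat e S) u) \<le> M"
      using no by (simp add: noether_def finite_proj_def)
    then obtain M where M: "\<forall>u. finite (fibre (trop_set N P) (lat e S) u) \<and> card (fibre (trop_set N P) (lat e S) u) \<le> M"
      by (rule exE)
    have "finite (fibre (trop_set N Q) (lat e (S - {i})) u) \<and> card (fibre (trop_set N Q) (lat e (S - {i})) u) \<le> M" for u
    proof (cases "fibre (trop_set N Q) (lat e (S - {i})) u = {}")
      case False
      then obtain v where v: "v \<in> fibre (trop_set N Q) (lat e (S - {i})) u" by blast
      have b0: "rdot (b i) w = 0" if "w \<in> trop_set N Q" for w
      proof -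
        have "w \<in> trop N z" using that zQ by (auto simp: trop_set_def)
        then obtain m1 m2 where "m1 \<in> {b i, 0}" "m2 \<in> {b i, 0}" "m1 \<noteq> m2" "wt N z m1 w = wt N z m2 w"
          using \<open>z \<noteq> 0\<close> unfolding trop_def keys_z by blast
        then have "wt N z (b i) w = wt N z 0 w" by auto
        moreover have "Poly_Mapping.lookup z (b i) = 1" "Poly_Mapping.lookup z 0 = - 1"
          using bi0 by (auto simp: z_def lmon_def lookup_minus lookup_single lookup_one when_def)
        ultimately show ?thesis by (simp add: wt_def norm_neg[OF N] norm_one[OF N])
      qed
      have "fibre (trop_set N Q) (lat e (S - {i})) u \<subseteq> fibre (trop_set N P) (lat e S) v"
      proof
        fix w assume w: "w \<in> fibre (trop_set N Q) (lat e (S - {i})) u"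
        have "rdot m w = rdot m v" if m: "m \<in> lat e S" for m
        proof -
          have "rdot (\<pi> m) w = rdot (\<pi> m) v" using w v pi_lat[OF m] by (simp add: fibre_def)
          then show ?thesis using b0[of w] b0[of v] w v by (simp add: \<pi>_def rdot_linear fibre_def)
        qed
        moreover have "trop_set N Q \<subseteq> trop_set N P" using Q(2) by (auto simp: trop_set_def)
        ultimately show "w \<in> fibre (trop_set N P) (lat e S) v" using w by (auto simp: fibre_def)
      qed
      then show ?thesis using M card_mono finite_subset by (meson order.trans)
    next
      case True
      show ?thesis unfolding True by simp
    qed
    then show "\<exists>M. \<forall>u. finite (fibre (trop_set N Q) (lat e (S - {i})) u) \<and>
       card (fibre (trop_set N Q) (lat e (S - {i})) u) \<le> M" by blast
    show "Q \<inter> ?B' = {0}"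
    proof (intro equalityI subsetI)
      fix g assume g: "g \<in> Q \<inter> ?B'"
      then have "g \<in> \<mm>" using Q(3) BB' by blast
      then have "g \<in> P" using s_id[of g] g by (simp add: \<mm>_def)
      then show "g \<in> {0}" using PB g BB' by blast
    next
      fix g :: "('k, 'n) laurent" assume "g \<in> {0}"
      then show "g \<in> Q \<inter> ?B'" using ideal_0[OF prime_ideal[OF Q(1)]] subring_0[OF subring_lat] by auto
    qed
  qed
  ultimately show thesis using that Q(1) by blast
qed

text \<open>Descending, so that the corresponding closed sets ascend.\<close>

definition prime_chain :: "'a::comm_ring_1 set \<Rightarrow> nat \<Rightarrow> (nat \<Rightarrow> 'a set) \<Rightarrow> bool" where
  "prime_chain I n q \<longleftrightarrow> (\<forall>i\<le>n. is_prime (q i) \<and> I \<subseteq> q i) \<and> (\<forall>i<n. q (Suc i) \<subset> q i)"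

lemma prime_chain_exists:
  fixes P :: "('k::field, 'n::finite) laurent set"
  assumes N: "nonarch_norm N" and no: "noether N P b e S" and P: "is_prime P"
  shows "\<exists>q. prime_chain P (card S) q \<and> q (card S) = P"
  using no P
proof (induction "card S" arbitrary: P S)
  case 0
  then show ?case by (intro exI[of _ "\<lambda>_. P"]) (simp add: prime_chain_def)
next
  case (Suc n)
  then obtain i where i: "i \<in> S" by (metis card.empty ex_in_conv nat.distinct(1))
  obtain Q where Q: "is_prime Q" "P \<subset> Q" "noether N Q b e (S - {i})"
    using noether_drop[OF N Suc.prems i] .
  have cS: "card (S - {i}) = n" using Suc.hyps(2) i by simp
  obtain q where q: "prime_chain Q n q" "q n = Q" using Suc.hyps(1)[OF cS[symmetric] Q(3,1)] unfolding cS by blast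
  have "prime_chain P (Suc n) (q(Suc n := P))"
    unfolding prime_chain_def
  proof (intro conjI allI impI)
    fix j assume "j \<le> Suc n"
    then show "is_prime ((q(Suc n := P)) j)" "P \<subseteq> (q(Suc n := P)) j"
      using q(1) Q(2) Suc.prems(2) by (auto simp: prime_chain_def le_Suc_eq)
  next
    fix j assume "j < Suc n"
    then show "(q(Suc n := P)) (Suc j) \<subset> (q(Suc n := P)) j"
      using q Q(2) by (cases "j = n") (auto simp: prime_chain_def)
  qed
  then show ?case unfolding Suc.hyps(2)[symmetric] by (intro exI[of _ "q(Suc n := P)"]) simp
qed

lemma prime_chain_bound:
  assumes no: "noether N P b e S" and P: "is_prime P" and q: "prime_chain P n q"
  shows "n \<le> card S"
proof -
  have "\<exists>b' e' S'. noether N (q (n - k)) b' e' S' \<and> card S' + k \<le> card S" if "k \<le> n" for k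
    using that
  proof (induction k)
    case 0
    have qn: "is_prime (q n)" "P \<subseteq> q n" using q by (auto simp: prime_chain_def)
    have "finite_proj N (q n) b e S" using no qn(2) finite_proj_mono unfolding noether_def by blast
    then show ?case using noether_exists[OF qn(1)] by force
  next
    case (Suc k)
    then obtain b' e' S' where IH: "noether N (q (n - k)) b' e' S'" "card S' + k \<le> card S" by auto
    have lt: "n - Suc k < n" "Suc (n - Suc k) = n - k" using Suc.prems by auto
    have sub: "q (n - k) \<subset> q (n - Suc k)" using q lt unfolding prime_chain_def by metis
    have pr: "is_prime (q (n - k))" "is_prime (q (n - Suc k))" using q by (auto simp: prime_chain_def)
    obtain b2 e2 S2 where "noether N (q (n - Suc k)) b2 e2 S2" "card S2 < card S'"
      using noether_strict[OF IH(1) pr sub] .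
    then show ?case using IH(2) by (intro exI[of _ b2] exI[of _ e2] exI[of _ S2]) simp
  qed
  from this[of n] show ?thesis by auto
qed

section \<open>The spectrum of the coordinate ring\<close>

text \<open>Primes of the coordinate ring correspond to primes of the Laurent polynomial ring over \<open>I\<close> by
  taking preimages (\<open>pre\<close>) and images.  The maps \<open>vanishing\<close> and \<open>common\<close> are the usual ones between
  sets of functions and sets of primes; they match the irreducible closed sets with the primes.\<close>

locale laurent_ideal =
  fixes I :: "('k::field, 'n::finite) laurent set"
  assumes I: "ideal I laurent_ring"
begin

abbreviation "A \<equiv> coord_ring I"
abbreviation "cl \<equiv> coord_class I"

lemma laurent_ring_simps [simp]:
  "carrier (laurent_ring :: ('k, 'n) laurent ring) = UNIV" "mult (laurent_ring :: ('k, 'n) laurent ring) = (*)"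
  "one (laurent_ring :: ('k, 'n) laurent ring) = 1" "zero (laurent_ring :: ('k, 'n) laurent ring) = 0"
  "add (laurent_ring :: ('k, 'n) laurent ring) = (+)"
  by (simp_all add: ring_of_type_algebra_def)

lemma I_ideal: "is_ideal I"
proof -
  interpret ideal I "laurent_ring :: ('k, 'n) laurent ring" by (rule I)
  show ?thesis unfolding is_ideal_def
    using additive_subgroup.zero_closed[OF additive_subgroup_axioms] additive_subgroup.a_closed[OF additive_subgroup_axioms] I_l_closed
    by auto
qed

lemma cl_def': "cl f = {h + f |h. h \<in> I}"
  unfolding coord_class_def a_r_coset_def' by auto

lemma cl_eq: "cl f = cl g \<longleftrightarrow> f - g \<in> I"
proof
  assume "cl f = cl g"
  moreover have "f \<in> cl f" unfolding cl_def' using ideal_0[OF I_ideal] by (intro CollectI exI[of _ 0]) simp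
  ultimately show "f - g \<in> I" unfolding cl_def' by auto
next
  assume fg: "f - g \<in> I"
  show "cl f = cl g"
  proof (intro equalityI subsetI)
    fix x assume "x \<in> cl f"
    then obtain h where "h \<in> I" "x = h + f" unfolding cl_def' by blast
    then have "x = (h + (f - g)) + g" "h + (f - g) \<in> I" using fg ideal_add[OF I_ideal] by auto
    then show "x \<in> cl g" unfolding cl_def' by blast
  next
    fix x assume "x \<in> cl g"
    then obtain h where "h \<in> I" "x = h + g" unfolding cl_def' by blast
    then have "x = (h - (f - g)) + f" "h - (f - g) \<in> I" using fg ideal_diff[OF I_ideal] by auto
    then show "x \<in> cl f" unfolding cl_def' by blast
  qed
qed

lemma cl_hom: "cl \<in> Ring.ring_hom laurent_ring A"
proof -
  interpret ideal I "laurent_ring :: ('k, 'n) laurent ring" by (rule I)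
  show ?thesis using rcos_ring_hom unfolding coord_ring_def by (simp add: coord_class_def[abs_def])
qed

lemma cl_mult: "cl f \<otimes>\<^bsub>A\<^esub> cl g = cl (f * g)" and cl_add: "cl f \<oplus>\<^bsub>A\<^esub> cl g = cl (f + g)"
  and cl_one: "\<one>\<^bsub>A\<^esub> = cl 1"
  using ring_hom_mult[OF cl_hom, of f g] ring_hom_add[OF cl_hom, of f g] ring_hom_one[OF cl_hom] by auto

lemma cl_zero: "\<zero>\<^bsub>A\<^esub> = cl 0"
proof -
  have "cl 0 = I" unfolding cl_def' by auto
  then show ?thesis by (simp add: coord_ring_def FactRing_def)
qed

lemma carrier_A: "carrier A = range cl"
  unfolding coord_ring_def FactRing_def A_RCOSETS_def' by (auto simp: coord_class_def)

lemma cring_A: "cring A"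
proof -
  interpret ideal I "laurent_ring :: ('k, 'n) laurent ring" by (rule I)
  show ?thesis unfolding coord_ring_def by (rule quotient_is_cring) (rule cring_from_type_algebra)
qed

definition pre :: "('k, 'n) laurent set set \<Rightarrow> ('k, 'n) laurent set" where
  "pre p = {f. cl f \<in> p}"

lemma cl_0_in: "p \<in> prime_spectrum A \<Longrightarrow> cl 0 \<in> p"
  unfolding prime_spectrum_def using additive_subgroup.zero_closed[of p A]
  by (auto simp: cl_zero[symmetric] dest!: primeideal.axioms(1) ideal.axioms(1))

lemma spectrum_pre:
  assumes p: "p \<in> prime_spectrum A"
  shows "is_prime (pre p)" "I \<subseteq> pre p"
proof -
  interpret primeideal p A using p by (simp add: prime_spectrum_def)
  show "I \<subseteq> pre p"
  proof
    fix f assume "f \<in> I"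
    then have "cl f = cl 0" by (simp add: cl_eq)
    then show "f \<in> pre p" using cl_0_in[OF p] by (simp add: pre_def)
  qed
  show "is_prime (pre p)" unfolding is_prime_def is_ideal_def pre_def mem_Collect_eq
  proof (intro conjI allI impI ballI)
    show "cl 0 \<in> p" by (rule cl_0_in[OF p])
    show "cl (x + y) \<in> p" if "x \<in> {f. cl f \<in> p}" "y \<in> {f. cl f \<in> p}" for x y
      using that additive_subgroup.a_closed[OF additive_subgroup_axioms, of "cl x" "cl y"] by (simp add: cl_add)
    show "cl (a * x) \<in> p" if "x \<in> {f. cl f \<in> p}" for a x
      using that I_l_closed[of "cl x" "cl a"] by (simp add: cl_mult carrier_A)
    show "cl 1 \<notin> p"
    proof
      assume "cl 1 \<in> p"
      then have "cl f \<in> p" for f using I_l_closed[of "cl 1" "cl f"] by (simp add: cl_mult carrier_A)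
      then have "p = carrier A" using a_subset by (auto simp: carrier_A)
      then show False using I_notcarr by simp
    qed
    show "cl a \<in> p \<or> cl b \<in> p" if "cl (a * b) \<in> p" for a b
      using that I_prime[of "cl a" "cl b"] by (simp add: cl_mult carrier_A)
  qed
qed

lemma prime_spectrum_image:
  assumes q: "is_prime q" "I \<subseteq> q"
  shows "cl ` q \<in> prime_spectrum A" "pre (cl ` q) = q"
proof -
  note qi = prime_ideal[OF q(1)]
  show pre: "pre (cl ` q) = q"
  proof (intro equalityI subsetI)
    fix f assume "f \<in> pre (cl ` q)"
    then obtain g where "g \<in> q" "f - g \<in> I" by (auto simp: pre_def cl_eq)
    then show "f \<in> q" using q(2) ideal_diff_cong[OF qi, of f g] by blast
  qed (auto simp: pre_def)
  then have mem: "cl f \<in> cl ` q \<longleftrightarrow> f \<in> q" for f by (auto simp: pre_def)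
  interpret A: cring A by (rule cring_A)
  have "ideal (cl ` q) A"
  proof (rule idealI[OF A.ring_axioms])
    show "subgroup (cl ` q) (add_monoid A)"
    proof (rule A.add.subgroupI)
      show "cl ` q \<subseteq> carrier A" by (auto simp: carrier_A)
      show "cl ` q \<noteq> {}" using ideal_0[OF qi] by auto
      fix x assume "x \<in> cl ` q"
      then obtain f where f: "x = cl f" "f \<in> q" by blast
      have "cl (- f) \<oplus>\<^bsub>A\<^esub> cl f = \<zero>\<^bsub>A\<^esub>" by (simp add: cl_add cl_zero)
      then have "\<ominus>\<^bsub>A\<^esub> x = cl (- f)" unfolding f(1) by (intro A.minus_equality) (auto simp: carrier_A)
      then show "\<ominus>\<^bsub>A\<^esub> x \<in> cl ` q" using ideal_uminus[OF qi f(2)] by simp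
    next
      fix x y assume "x \<in> cl ` q" "y \<in> cl ` q"
      then show "x \<oplus>\<^bsub>A\<^esub> y \<in> cl ` q" using ideal_add[OF qi] by (auto simp: cl_add)
    qed
    fix a x assume "a \<in> cl ` q" "x \<in> carrier A"
    then show "x \<otimes>\<^bsub>A\<^esub> a \<in> cl ` q" "a \<otimes>\<^bsub>A\<^esub> x \<in> cl ` q"
      using ideal_mult[OF qi] ideal_mult2[OF qi] by (auto simp: carrier_A cl_mult)
  qed
  then have "primeideal (cl ` q) A"
  proof (rule primeidealI[OF _ cring_A])
    show "carrier A \<noteq> cl ` q" using mem[of 1] prime_1[OF q(1)] by (auto simp: carrier_A)
    fix a b assume ab: "a \<in> carrier A" "b \<in> carrier A" "a \<otimes>\<^bsub>A\<^esub> b \<in> cl ` q"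
    then obtain f g where fg: "a = cl f" "b = cl g" by (auto simp: carrier_A)
    then have "f * g \<in> q" using ab(3) mem[of "f * g"] by (simp only: cl_mult)
    then show "a \<in> cl ` q \<or> b \<in> cl ` q" unfolding fg mem by (rule prime_multD[OF q(1)])
  qed
  then show "cl ` q \<in> prime_spectrum A" by (simp add: prime_spectrum_def)
qed

abbreviation "Z \<equiv> zariski_topology A"
abbreviation "D f \<equiv> {p \<in> prime_spectrum A. cl f \<notin> p}"

definition vanishing :: "('k, 'n) laurent set \<Rightarrow> ('k, 'n) laurent set set set" where
  "vanishing q = {p \<in> prime_spectrum A. q \<subseteq> pre p}"

definition common :: "('k, 'n) laurent set set set \<Rightarrow> ('k, 'n) laurent set" where
  "common C = (\<Inter>p\<in>C. pre p)"

lemma zariski_def': "Z = topology_generated_by (range D)"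
  unfolding zariski_topology_def carrier_A image_image ..

lemma topspace_zariski: "topspace Z = prime_spectrum A"
proof -
  have "cl 1 \<notin> p" if "p \<in> prime_spectrum A" for p
    using prime_1[OF spectrum_pre(1)[OF that]] by (simp add: pre_def)
  then show ?thesis unfolding zariski_def' topology_generated_by_topspace by blast
qed

text \<open>The basic open sets only generate the topology, but they are closed under intersection.\<close>

lemma zariski_basis:
  assumes "openin Z U" "p \<in> U"
  shows "\<exists>f. p \<in> D f \<and> D f \<subseteq> U"
proof -
  have "generate_topology_on (range D) U" using assms(1) unfolding zariski_def' openin_topology_generated_by_iff .
  then show ?thesis using assms(2)
  proof (induction arbitrary: p rule: generate_topology_on.induct)
    case (Int a b)
    have "p \<in> a" "p \<in> b" using Int.prems by simp_all
    obtain f where f: "p \<in> D f \<and> D f \<subseteq> a" using Int.IH(1)[OF \<open>p \<in> a\<close>] by (rule exE)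
    obtain g where g: "p \<in> D g \<and> D g \<subseteq> b" using Int.IH(2)[OF \<open>p \<in> b\<close>] by (rule exE)
    note fg = f[THEN conjunct1] f[THEN conjunct2] g[THEN conjunct1] g[THEN conjunct2]
    have "D (f * g) = D f \<inter> D g"
    proof -
      have "cl (f * g) \<in> r \<longleftrightarrow> cl f \<in> r \<or> cl g \<in> r" if "r \<in> prime_spectrum A" for r
        using prime_multD[OF spectrum_pre(1)[OF that], of f g] ideal_mult[OF prime_ideal[OF spectrum_pre(1)[OF that]], of g f]
          ideal_mult2[OF prime_ideal[OF spectrum_pre(1)[OF that]], of f g] by (auto simp: pre_def)
      then show ?thesis by blast
    qed
    then show ?case using fg by (intro exI[of _ "f * g"]) blast
  next
    case (UN K)
    then obtain k where "k \<in> K" "p \<in> k" by blast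
    then show ?case using UN.IH by blast
  qed auto
qed

lemma closed_vanishing: "closedin Z (vanishing q)"
proof -
  have "prime_spectrum A - vanishing q = (\<Union>f\<in>q. D f)" by (auto simp: vanishing_def pre_def)
  moreover have "openin Z (D f)" for f unfolding zariski_def' by (intro topology_generated_by_Basis) simp
  ultimately show ?thesis unfolding closedin_def topspace_zariski by (auto simp: vanishing_def)
qed

lemma closed_eq_vanishing:
  assumes "closedin Z C"
  shows "C = vanishing (common C)"
proof (intro equalityI subsetI)
  have sub: "C \<subseteq> prime_spectrum A" using closedin_subset[OF assms] by (simp add: topspace_zariski)
  fix p assume "p \<in> C"
  then show "p \<in> vanishing (common C)" using sub by (auto simp: vanishing_def common_def)
next
  fix p assume p: "p \<in> vanishing (common C)"
  show "p \<in> C"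
  proof (rule ccontr)
    assume "p \<notin> C"
    then have "p \<in> prime_spectrum A - C" using p by (simp add: vanishing_def)
    moreover have "openin Z (prime_spectrum A - C)" using assms by (simp add: closedin_def topspace_zariski)
    ultimately obtain f where f: "p \<in> D f" "D f \<subseteq> prime_spectrum A - C" using zariski_basis by blast
    have "C \<subseteq> prime_spectrum A" using closedin_subset[OF assms] by (simp add: topspace_zariski)
    then have "f \<in> common C" using f(2) by (auto simp: common_def pre_def)
    then have "f \<in> pre p" using p by (auto simp: vanishing_def)
    then show False using f(1) by (simp add: pre_def)
  qed
qed

lemma irreducible_common_prime:
  assumes irr: "irreducible_closedin Z C"
  shows "is_prime (common C)" "I \<subseteq> common C"
proof -
  have C: "closedin Z C" "C \<noteq> {}" and
    split: "\<And>C1 C2. closedin Z C1 \<Longrightarrow> closedin Z C2 \<Longrightarrow> C = C1 \<union> C2 \<Longrightarrow> C = C1 \<or> C = C2"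
    using irr unfolding irreducible_closedin_def by blast+
  have sub: "C \<subseteq> prime_spectrum A" using closedin_subset[OF C(1)] by (simp add: topspace_zariski)
  note pr = spectrum_pre(1)[OF subsetD[OF sub]]
  show "I \<subseteq> common C" using spectrum_pre(2) sub by (auto simp: common_def)
  show "is_prime (common C)" unfolding is_prime_def
  proof (intro conjI allI impI)
    show "is_ideal (common C)" unfolding is_ideal_def common_def
      using ideal_0[OF prime_ideal[OF pr]] ideal_add[OF prime_ideal[OF pr]] ideal_mult[OF prime_ideal[OF pr]] by auto
    show "1 \<notin> common C" using C(2) prime_1[OF pr] by (auto simp: common_def)
    fix a b assume ab: "a * b \<in> common C"
    have "C = (C \<inter> vanishing {a}) \<union> (C \<inter> vanishing {b})"
      using ab prime_multD[OF pr] sub by (auto simp: common_def vanishing_def)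
    then have "C = C \<inter> vanishing {a} \<or> C = C \<inter> vanishing {b}"
      using C(1) closed_vanishing by (intro split) auto
    then show "a \<in> common C \<or> b \<in> common C" by (auto simp: common_def vanishing_def)
  qed
qed

lemma common_vanishing:
  assumes "is_prime q" "I \<subseteq> q"
  shows "common (vanishing q) = q"
proof -
  have "cl ` q \<in> vanishing q" using prime_spectrum_image[OF assms] by (simp add: vanishing_def)
  then have "common (vanishing q) \<subseteq> q" using prime_spectrum_image(2)[OF assms] by (auto simp: common_def)
  then show ?thesis by (auto simp: common_def vanishing_def)
qed

text \<open>A closed set that contains the generic point \<open>q\<close> contains every prime over \<open>q\<close>.\<close>

lemma irreducible_vanishing:
  assumes q: "is_prime q" "I \<subseteq> q"
  shows "irreducible_closedin Z (vanishing q)"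
  unfolding irreducible_closedin_def
proof (intro conjI allI impI)
  let ?p = "cl ` q"
  have p: "?p \<in> prime_spectrum A" "pre ?p = q" by (rule prime_spectrum_image[OF q])+
  then have pV: "?p \<in> vanishing q" by (simp add: vanishing_def)
  show "closedin Z (vanishing q)" by (rule closed_vanishing)
  show "vanishing q \<noteq> {}" using pV by blast
  fix C1 C2 assume C: "closedin Z C1 \<and> closedin Z C2 \<and> vanishing q = C1 \<union> C2"
  have "vanishing q \<subseteq> C'" if "closedin Z C'" "?p \<in> C'" for C'
  proof -
    have "common C' \<subseteq> q" using that(2) p(2) by (auto simp: common_def)
    then have "vanishing q \<subseteq> vanishing (common C')" by (auto simp: vanishing_def)
    then show ?thesis using closed_eq_vanishing[OF that(1)] by simp
  qed
  moreover have "?p \<in> C1 \<or> ?p \<in> C2" using pV C by blast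
  ultimately show "vanishing q = C1 \<or> vanishing q = C2" using C by blast
qed

lemma chain_of_primes:
  assumes "prime_chain I n q"
  shows "irreducible_chain Z n (\<lambda>i. vanishing (q i))"
  unfolding irreducible_chain_def
proof (intro conjI allI impI)
  fix i assume "i \<le> n"
  then show "irreducible_closedin Z (vanishing (q i))"
    using assms by (intro irreducible_vanishing) (auto simp: prime_chain_def)
next
  fix i assume i: "i < n"
  then have q: "is_prime (q i)" "I \<subseteq> q i" "is_prime (q (Suc i))" "I \<subseteq> q (Suc i)" "q (Suc i) \<subset> q i"
    using assms by (auto simp: prime_chain_def)
  have "vanishing (q i) \<subseteq> vanishing (q (Suc i))" using q(5) by (auto simp: vanishing_def)
  moreover have "vanishing (q i) \<noteq> vanishing (q (Suc i))"
  proof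
    assume "vanishing (q i) = vanishing (q (Suc i))"
    then have "common (vanishing (q i)) = common (vanishing (q (Suc i)))" by (rule arg_cong)
    then have "q i = q (Suc i)" unfolding common_vanishing[OF q(1,2)] common_vanishing[OF q(3,4)] .
    then show False using q(5) by blast
  qed
  ultimately show "vanishing (q i) \<subset> vanishing (q (Suc i))" by blast
qed

lemma primes_of_chain:
  assumes "irreducible_chain Z n C"
  shows "prime_chain I n (\<lambda>i. common (C i))"
  unfolding prime_chain_def
proof (intro conjI allI impI)
  fix i assume "i \<le> n"
  then have "irreducible_closedin Z (C i)" using assms by (simp add: irreducible_chain_def)
  then show "is_prime (common (C i))" "I \<subseteq> common (C i)" by (rule irreducible_common_prime)+
next
  fix i assume i: "i < n"
  then have C: "closedin Z (C i)" "closedin Z (C (Suc i))" "C i \<subset> C (Suc i)"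
    using assms by (auto simp: irreducible_chain_def irreducible_closedin_def)
  have "common (C (Suc i)) \<subseteq> common (C i)" using C(3) by (auto simp: common_def)
  moreover have "common (C (Suc i)) \<noteq> common (C i)"
    using closed_eq_vanishing[OF C(1)] closed_eq_vanishing[OF C(2)] C(3) by auto
  ultimately show "common (C (Suc i)) \<subset> common (C i)" by blast
qed

lemma least_prime:
  assumes "irreducible_subvariety I"
  obtains P where "is_prime P" "I \<subseteq> P" "\<And>q. is_prime q \<Longrightarrow> I \<subseteq> q \<Longrightarrow> P \<subseteq> q"
proof -
  have irr: "irreducible_closedin Z (prime_spectrum A)" using assms by (simp add: irreducible_subvariety_def)
  have "common (prime_spectrum A) \<subseteq> q" if "is_prime q" "I \<subseteq> q" for q
    using prime_spectrum_image[OF that] by (auto simp: common_def)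
  then show thesis using that irreducible_common_prime[OF irr] by blast
qed

lemma dimension_eq_rank:
  assumes N: "nonarch_norm N" and P: "is_prime P" "I \<subseteq> P" "\<And>q. is_prime q \<Longrightarrow> I \<subseteq> q \<Longrightarrow> P \<subseteq> q"
    and no: "noether N P b e S" and r: "subvariety_dimension I r"
  shows "r = card S"
proof (rule antisym)
  have IP: "prime_chain I n q \<longleftrightarrow> prime_chain P n q" for n q
    unfolding prime_chain_def using P by blast
  obtain C where "irreducible_chain Z r C"
    using r unfolding subvariety_dimension_def has_topological_dimension_def by blast
  then show "r \<le> card S" using primes_of_chain IP prime_chain_bound[OF no P(1)] by blast
  obtain q where "prime_chain P (card S) q" using prime_chain_exists[OF N no P(1)] by blast
  then have "irreducible_chain Z (card S) (\<lambda>i. vanishing (q i))" using chain_of_primes IP by blast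
  then show "card S \<le> r" using r unfolding subvariety_dimension_def has_topological_dimension_def by blast
qed

section \<open>The Bieri-Groves set\<close>

text \<open>The kernel of the evaluation at a geometric point is a prime over \<open>I\<close>, so it contains \<open>P\<close>.\<close>

lemma geometric_points_eq:
  assumes P: "is_prime P" "I \<subseteq> P" "\<And>q. is_prime q \<Longrightarrow> I \<subseteq> q \<Longrightarrow> P \<subseteq> q"
  shows "geometric_points I = variety_points P"
proof (intro equalityI subsetI)
  fix a assume "a \<in> variety_points P"
  then show "a \<in> geometric_points I" using P(2) by (auto simp: variety_points_def geometric_points_def torus_def)
next
  fix a assume "a \<in> geometric_points I"
  then have a: "a \<in> torus" "\<forall>f\<in>I. laurent_eval f a = 0" by (auto simp: geometric_points_def torus_def)
  note ev = hom_eval[OF a(1)]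
  have "is_prime {f. laurent_eval f a = 0}"
    unfolding is_prime_def is_ideal_def
    by (simp add: hom_0[OF ev] hom_add[OF ev] hom_mult[OF ev] hom_1[OF ev])
  then have "P \<subseteq> {f. laurent_eval f a = 0}" using a(2) by (intro P(3)) auto
  then show "a \<in> variety_points P" using a(1) by (auto simp: variety_points_def)
qed

text \<open>The kernel of a multiplicative seminorm is prime.\<close>

lemma seminorm_set_least_prime:
  assumes N: "nonarch_norm N" and P: "is_prime P" "I \<subseteq> P" "\<And>q. is_prime q \<Longrightarrow> I \<subseteq> q \<Longrightarrow> P \<subseteq> q"
  shows "seminorm_set N I = seminorm_set N P"
proof (intro equalityI subsetI)
  fix u assume "u \<in> seminorm_set N P"
  then show "u \<in> seminorm_set N I" using P(2) unfolding seminorm_set_def by blast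
next
  fix u assume "u \<in> seminorm_set N I"
  then obtain \<phi> where \<phi>: "laurent_seminorm N \<phi>" "\<forall>f\<in>I. \<phi> f = 0" "\<forall>i. \<phi> (lmon (axis i 1)) = exp (- u $ i)"
    unfolding seminorm_set_def by blast
  have "is_prime {f. \<phi> f = 0}"
    unfolding is_prime_def is_ideal_def mem_Collect_eq
  proof (intro conjI allI ballI impI)
    show "\<phi> 0 = 0" using seminorm_const[OF \<phi>(1), of 0] norm_zero[OF N] by simp
    show "\<phi> 1 \<noteq> 0" using seminorm_const[OF \<phi>(1), of 1] norm_one[OF N] by simp
    show "\<phi> (x + y) = 0" if "x \<in> {f. \<phi> f = 0}" "y \<in> {f. \<phi> f = 0}" for x y
      using that seminorm_add[OF \<phi>(1), of x y] seminorm_nonneg[OF \<phi>(1), of "x + y"] by simp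
    show "\<phi> (x * y) = 0" if "y \<in> {f. \<phi> f = 0}" for x y using that by (simp add: seminorm_mult[OF \<phi>(1)])
    show "\<phi> x = 0 \<or> \<phi> y = 0" if "\<phi> (x * y) = 0" for x y using that by (simp add: seminorm_mult[OF \<phi>(1)])
  qed
  then have "P \<subseteq> {f. \<phi> f = 0}" using \<phi>(2) by (intro P(3)) auto
  then show "u \<in> seminorm_set N P" unfolding seminorm_set_def using \<phi> by blast
qed

text \<open>The dictionary between additive valuations and multiplicative seminorms is \<open>w = - log \<phi>\<close>.\<close>

lemma bieri_groves_eq_seminorm_set:
  assumes N: "nonarch_norm N"
  shows "bieri_groves_set N I = seminorm_set N I"
proof (intro equalityI subsetI)
  fix u assume "u \<in> bieri_groves_set N I"
  then obtain w where w: "ring_valuation A w" "\<And>c. w (cl (laurent_const c)) = norm_val N c"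
    "\<And>i. w (cl (laurent_var i)) = ereal (u $ i)"
    unfolding bieri_groves_set_def extending_valuations_def by blast
  have fin: "w (cl f) \<noteq> - \<infinity>" and mult: "w (cl (f * g)) = w (cl f) + w (cl g)"
    and add: "w (cl (f + g)) \<ge> min (w (cl f)) (w (cl g))" for f g
    using w(1) unfolding ring_valuation_def by (auto simp: carrier_A simp flip: cl_mult cl_add)
  define \<phi> where "\<phi> f = (if w (cl f) = \<infinity> then 0 else exp (- real_of_ereal (w (cl f))))" for f
  have val: "w (cl f) = \<infinity> \<or> (\<exists>x. w (cl f) = ereal x)" for f using fin[of f] by (cases "w (cl f)") auto
  have "laurent_seminorm N \<phi>" unfolding laurent_seminorm_def
  proof (intro conjI allI)
    show "\<phi> f \<ge> 0" for f by (simp add: \<phi>_def)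
    show "\<phi> (f * g) = \<phi> f * \<phi> g" for f g
      using val[of f] val[of g] by (auto simp: \<phi>_def mult exp_add[symmetric] exp_diff)
    show "\<phi> (f + g) \<le> max (\<phi> f) (\<phi> g)" for f g
      using val[of f] val[of g] val[of "f + g"] add[of f g] by (auto simp: \<phi>_def min_def max_def split: if_splits)
    show "\<phi> (Poly_Mapping.single 0 c) = N c" for c
      using w(2)[of c] norm_zero[OF N] norm_pos[OF N, of c] by (auto simp: \<phi>_def laurent_const_def norm_val_def)
  qed
  moreover have "\<forall>f\<in>I. \<phi> f = 0"
  proof
    fix f assume "f \<in> I"
    then have "cl f = \<zero>\<^bsub>A\<^esub>" by (simp add: cl_zero cl_eq)
    then show "\<phi> f = 0" using w(1) by (simp add: \<phi>_def ring_valuation_def)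
  qed
  moreover have "\<phi> (lmon (axis i 1)) = exp (- u $ i)" for i
    using w(3)[of i] by (simp add: \<phi>_def laurent_var_def lmon_def)
  ultimately show "u \<in> seminorm_set N I" unfolding seminorm_set_def by blast
next
  fix u assume "u \<in> seminorm_set N I"
  then obtain \<phi> where \<phi>: "laurent_seminorm N \<phi>" "\<forall>f\<in>I. \<phi> f = 0" "\<forall>i. \<phi> (lmon (axis i 1)) = exp (- u $ i)"
    unfolding seminorm_set_def by blast
  have le: "\<phi> f \<le> \<phi> g" if "f - g \<in> I" for f g
    using seminorm_add[OF \<phi>(1), of "f - g" g] \<phi>(2) that seminorm_nonneg[OF \<phi>(1), of g] by simp
  have cong: "\<phi> f = \<phi> g" if "cl f = cl g" for f g
    using le[of f g] le[of g f] that cl_eq[of f g] cl_eq[of g f] by simp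
  define W where "W f = (if \<phi> f = 0 then \<infinity> else ereal (- ln (\<phi> f)))" for f
  define w where "w C = W (SOME f. cl f = C)" for C
  have wW: "w (cl f) = W f" for f
  proof -
    have "cl (SOME g. cl g = cl f) = cl f" by (rule someI[of _ f]) (rule refl)
    from cong[OF this] show ?thesis unfolding w_def W_def by (simp only:)
  qed
  have pos: "\<phi> f > 0" if "\<phi> f \<noteq> 0" for f using that seminorm_nonneg[OF \<phi>(1), of f] by simp
  have "ring_valuation A w" unfolding ring_valuation_def
  proof (intro conjI ballI)
    fix a assume "a \<in> carrier A"
    then obtain f where f: "a = cl f" by (auto simp: carrier_A)
    show "w a \<noteq> - \<infinity>" by (simp add: f wW W_def)
    fix b assume "b \<in> carrier A"
    then obtain g where g: "b = cl g" by (auto simp: carrier_A)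
    show "w (a \<otimes>\<^bsub>A\<^esub> b) = w a + w b"
      using pos[of f] pos[of g] by (simp add: f g cl_mult wW W_def seminorm_mult[OF \<phi>(1)] ln_mult)
    show "min (w a) (w b) \<le> w (a \<oplus>\<^bsub>A\<^esub> b)"
    proof (cases "\<phi> (f + g) = 0")
      case False
      note p = pos[OF False]
      have "\<phi> (f + g) \<le> \<phi> f \<or> \<phi> (f + g) \<le> \<phi> g" using seminorm_add[OF \<phi>(1), of f g] by linarith
      then have "W f \<le> W (f + g) \<or> W g \<le> W (f + g)" using p by (auto simp: W_def)
      then show ?thesis by (auto simp: f g cl_add wW min_le_iff_disj)
    qed (simp add: f g cl_add wW W_def)
  next
    show "w \<zero>\<^bsub>A\<^esub> = \<infinity>" using seminorm_const[OF \<phi>(1), of 0] norm_zero[OF N] by (simp add: cl_zero wW W_def)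
    show "w \<one>\<^bsub>A\<^esub> = 0" using seminorm_const[OF \<phi>(1), of 1] norm_one[OF N] by (simp add: cl_one wW W_def)
  qed
  moreover have "w (cl (laurent_const c)) = norm_val N c" for c
    unfolding wW W_def laurent_const_def seminorm_const[OF \<phi>(1)] norm_val_def using norm_eq_0[OF N] by simp
  moreover have "w (cl (laurent_var i)) = ereal (u $ i)" for i
    using \<phi>(3) by (simp add: wW W_def laurent_var_def lmon_def)
  ultimately show "u \<in> bieri_groves_set N I"
    unfolding bieri_groves_set_def extending_valuations_def by blast
qed

end

section \<open>The theorem\<close>

lemma pure_uminus:
  fixes Q :: "(real ^ 'n::finite) set"
  assumes "pure_rational_polyhedral_set \<Gamma> r Q"
  shows "pure_rational_polyhedral_set \<Gamma> r (uminus ` Q)"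
proof -
  obtain F where F: "finite F" "\<forall>C\<in>F. rational_polyhedron \<Gamma> C" "Q = \<Union>F"
    "\<forall>C\<in>F. (\<forall>C'\<in>F. C \<subseteq> C' \<longrightarrow> C = C') \<longrightarrow> aff_dim C = int r"
    using assms unfolding pure_rational_polyhedral_set_def by blast
  have sub: "uminus ` C \<subseteq> uminus ` C' \<longleftrightarrow> C \<subseteq> C'" "uminus ` C = uminus ` C' \<longleftrightarrow> C = C'" for C C' :: "(real ^ 'n) set"
    by (rule inj_image_subset_iff inj_image_eq_iff, simp)+
  have poly: "rational_polyhedron \<Gamma> (uminus ` C)" if "C \<in> F" for C
  proof -
    have "rational_polyhedron \<Gamma> C" using F(2) that by (rule bspec)
    then obtain S where S: "finite S" "snd ` S \<subseteq> \<Gamma>" "C = {u. \<forall>(b, c)\<in>S. rdot b u \<ge> c}"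
      unfolding rational_polyhedron_rdot by (elim exE conjE)
    have neg: "rdot (- b) u = rdot b (- u)" for b and u :: "real ^ 'n" by (simp add: rdot_def)
    have "uminus ` C = {u. - u \<in> C}"
    proof (intro equalityI subsetI)
      fix u assume "u \<in> {u. - u \<in> C}"
      then show "u \<in> uminus ` C" by (intro image_eqI[of _ _ "- u"]) simp_all
    qed auto
    also have "\<dots> = {u. \<forall>(b, c)\<in>(\<lambda>(b, c). (- b, c)) ` S. rdot b u \<ge> c}" unfolding S(3) by (auto simp: neg)
    finally show ?thesis unfolding rational_polyhedron_rdot
      using S by (intro exI[of _ "(\<lambda>(b, c). (- b, c)) ` S"]) force
  qed
  have dim: "aff_dim (uminus ` C) = aff_dim C" for C :: "(real ^ 'n) set"
    by (rule aff_dim_injective_linear_image) (auto intro: linear_uminus inj_uminus)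
  show ?thesis unfolding pure_rational_polyhedral_set_def
    by (intro exI[of _ "(`) uminus ` F"] conjI) (use F poly in \<open>auto simp: sub dim\<close>)
qed

theorem theorem2p2p5:
  fixes N :: "'k::field \<Rightarrow> real"
    and N' :: "'k alg_closure \<Rightarrow> real"
    and I :: "('k, 'n::finite) laurent set"
    and r :: nat
  assumes "nonarch_norm N" and "nontrivial_norm N" and "complete_norm N"
    and "nonarch_norm N'" and "\<And>x. N' (to_ac x) = N x"
    and "ideal I laurent_ring"
    and "irreducible_subvariety I"
    and "subvariety_dimension I r"
  shows "tropical_variety N' I = bieri_groves_set N I \<and>
    pure_rational_polyhedral_set (value_group N') r (tropical_variety N' I) \<and>
    pure_rational_polyhedral_set (value_group N') r (amoeba N' I)"
proof -
  interpret laurent_ideal I by (rule laurent_ideal.intro) (rule assms(6))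
  obtain P where least: "is_prime P" "I \<subseteq> P" "\<And>q. is_prime q \<Longrightarrow> I \<subseteq> q \<Longrightarrow> P \<subseteq> q"
    by (rule least_prime[OF assms(7)]) blast
  obtain b e S where no: "noether N P b e S" using noether_of_prime[OF least(1)] .
  interpret prime_variety N N' P b e S
    by unfold_locales (use assms(1,2,4,5) least(1) no in auto)
  have r: "r = card S" by (rule dimension_eq_rank[OF N least no assms(8)])
  have points: "geometric_points I = variety_points P" by (rule geometric_points_eq[OF least])
  have T: "tropical_variety N' I = closure V"
    unfolding tropical_variety_def points ..
  have "Log_map N' ` geometric_points I = uminus ` V"
    unfolding points image_image Log_map_def ..
  then have am: "amoeba N' I = uminus ` tropical_variety N' I"
    unfolding T amoeba_def
    by (simp only: closure_injective_linear_image[OF linear_uminus inj_uminus])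
  have "seminorm_set N I = seminorm_set N P" by (rule seminorm_set_least_prime[OF N least])
  then have "tropical_variety N' I = bieri_groves_set N I"
    unfolding T closure_points_eq(1) bieri_groves_eq_seminorm_set[OF N] by (rule sym)
  moreover have pure: "pure_rational_polyhedral_set (value_group N') r (tropical_variety N' I)"
    unfolding T closure_points_eq(2) r by (rule trop_set_pure)
  moreover have "pure_rational_polyhedral_set (value_group N') r (amoeba N' I)"
    unfolding am by (rule pure_uminus[OF pure])
  ultimately show ?thesis by (intro conjI)
qed

end
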